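(* Let $B$ be a standard $d$-dimensional Brownian motion and let the tensor powers $(\mathbb{R}^d)^{\otimes n}$ be equipped with a family of admissible norms under which each canonical basis vector $e_1,\dots,e_d$ of $\mathbb{R}^d$ has norm one. Then for each $0\le s<t$, the random variable $\widetilde L_{s,t}$ is almost surely equal to a deterministic constant, and this constant is at most $d^2(t-s)$.
   Context: For $x\ge 0$, $x!\triangleq\Gamma(x+1)$. $\mathbb{B}^n_{s,t}=\int_{s<u_1<\cdots<u_n<t}\circ dB_{u_1}\otimes\cdots\otimes\circ dB_{u_n}$ (iterated Stratonovich integrals) and $\widetilde L_{s,t}\triangleq\limsup_{n\to\infty}\big((\tfrac n2)!\|\mathbb{B}^n_{s,t}\|\big)^{2/n}$. A family of norms on the tensor powers is admissible if $\|a\otimes b\|\le\|a\|\|b\|$ for all homogeneous tensors $a,b$ and each norm is invariant under the permutation maps $\mathcal{P}^\sigma$ induced by $a_1\otimes\cdots\otimes a_n\mapsto a_{\sigma(1)}\otimes\cdots\otimes a_{\sigma(n)}$. *)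

theory Defs
  imports "HOL-Probability.Probability"
begin

definition std_brownian :: "'a measure \<Rightarrow> nat \<Rightarrow> (real \<Rightarrow> 'a \<Rightarrow> nat \<Rightarrow> real) \<Rightarrow> bool" where
  "std_brownian M d B \<longleftrightarrow>
     prob_space M \<and>
     (\<forall>t\<ge>0. \<forall>i<d. (\<lambda>w. B t w i) \<in> borel_measurable M) \<and>
     (AE w in M. \<forall>i<d. B 0 w i = 0) \<and>
     (AE w in M. \<forall>i<d. continuous_on {0..} (\<lambda>t. B t w i)) \<and>
     (\<forall>(k::nat) (tt::nat \<Rightarrow> real). 0 \<le> tt 0 \<longrightarrow> (\<forall>j<k. tt j < tt (Suc j)) \<longrightarrow>
        prob_space.indep_vars M (\<lambda>_. borel)
          (\<lambda>(j, i) w. B (tt (Suc j)) w i - B (tt j) w i) ({..<k} \<times> {..<d}) \<and>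
        (\<forall>j<k. \<forall>i<d. distributed M lborel (\<lambda>w. B (tt (Suc j)) w i - B (tt j) w i)
                         (normal_density 0 (sqrt (tt (Suc j) - tt j)))))"

text \<open>An element of the n-th tensor power of R^d is represented by its coefficient
  function on words: a w is the coefficient of e_(w!0) \<otimes> ... \<otimes> e_(w!(n-1)),
  supported on words of length n with letters in {..<d} (letters are 0-based).\<close>

definition tens :: "nat \<Rightarrow> nat \<Rightarrow> (nat list \<Rightarrow> real) set" where
  "tens d n = {a. \<forall>w. a w \<noteq> 0 \<longrightarrow> length w = n \<and> set w \<subseteq> {..<d}}"

definition tprod :: "nat \<Rightarrow> (nat list \<Rightarrow> real) \<Rightarrow> (nat list \<Rightarrow> real) \<Rightarrow> nat list \<Rightarrow> real" where
  "tprod n a b w = (if n \<le> length w then a (take n w) * b (drop n w) else 0)"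

definition tperm :: "(nat \<Rightarrow> nat) \<Rightarrow> (nat list \<Rightarrow> real) \<Rightarrow> nat list \<Rightarrow> real" where
  "tperm \<sigma> a v = a (map (\<lambda>j. v ! \<sigma> j) [0..<length v])"

definition basis_tensor :: "nat \<Rightarrow> nat list \<Rightarrow> real" where
  "basis_tensor i w = (if w = [i] then 1 else 0)"

definition is_norm_on :: "(nat list \<Rightarrow> real) set \<Rightarrow> ((nat list \<Rightarrow> real) \<Rightarrow> real) \<Rightarrow> bool" where
  "is_norm_on V nm \<longleftrightarrow>
     (\<forall>a\<in>V. 0 \<le> nm a \<and> (nm a = 0 \<longleftrightarrow> a = (\<lambda>_. 0))) \<and>
     (\<forall>a\<in>V. \<forall>c. nm (\<lambda>w. c * a w) = \<bar>c\<bar> * nm a) \<and>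
     (\<forall>a\<in>V. \<forall>b\<in>V. nm (\<lambda>w. a w + b w) \<le> nm a + nm b)"

definition admissible_norms :: "nat \<Rightarrow> (nat \<Rightarrow> (nat list \<Rightarrow> real) \<Rightarrow> real) \<Rightarrow> bool" where
  "admissible_norms d N \<longleftrightarrow>
     (\<forall>n. is_norm_on (tens d n) (N n)) \<and>
     (\<forall>n m. \<forall>a\<in>tens d n. \<forall>b\<in>tens d m. N (n + m) (tprod n a b) \<le> N n a * N m b) \<and>
     (\<forall>n \<sigma>. \<sigma> permutes {..<n} \<longrightarrow> (\<forall>a\<in>tens d n. N n (tperm \<sigma> a) = N n a))"

definition is_partition :: "real \<Rightarrow> real \<Rightarrow> real list \<Rightarrow> bool" where
  "is_partition s t p \<longleftrightarrow> 2 \<le> length p \<and> p ! 0 = s \<and> last p = t \<and> sorted_wrt (<) p"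

definition mesh :: "real list \<Rightarrow> real" where
  "mesh p = Max ((\<lambda>k. p ! Suc k - p ! k) ` {..<length p - 1})"

definition conv_in_prob :: "'a measure \<Rightarrow> (nat \<Rightarrow> 'a \<Rightarrow> real) \<Rightarrow> ('a \<Rightarrow> real) \<Rightarrow> bool" where
  "conv_in_prob M Y Z \<longleftrightarrow>
     (\<forall>e>0. (\<lambda>k. measure M {w \<in> space M. e < \<bar>Y k w - Z w\<bar>}) \<longlonglongrightarrow> 0)"

definition strat_sum ::
  "(real \<Rightarrow> 'a \<Rightarrow> nat \<Rightarrow> real) \<Rightarrow> (real \<Rightarrow> 'a \<Rightarrow> nat list \<Rightarrow> real) \<Rightarrow> real list \<Rightarrow> nat list \<Rightarrow> nat \<Rightarrow> 'a \<Rightarrow> real" where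
  "strat_sum B Y p v i w = (\<Sum>k<length p - 1.
      (Y (p ! k) w v + Y (p ! Suc k) w v) / 2 * (B (p ! Suc k) w i - B (p ! k) w i))"

text \<open>X n s t w is the n-th iterated Stratonovich integral of B over s<u_1<...<u_n<t,
  defined recursively by X (n+1) s t = int_s^t X n s u \<otimes> o dB_u, the Stratonovich
  integral being the limit in probability of midpoint Riemann sums as the mesh tends to 0.\<close>
definition strat_signature ::
  "'a measure \<Rightarrow> nat \<Rightarrow> (real \<Rightarrow> 'a \<Rightarrow> nat \<Rightarrow> real) \<Rightarrow> (nat \<Rightarrow> real \<Rightarrow> real \<Rightarrow> 'a \<Rightarrow> nat list \<Rightarrow> real) \<Rightarrow> bool" where
  "strat_signature M d B X \<longleftrightarrow>
     (\<forall>n s t w. X n s t w \<in> tens d n) \<and>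
     (\<forall>n s t v. (\<lambda>w. X n s t w v) \<in> borel_measurable M) \<and>
     (\<forall>s t w. X 0 s t w = (\<lambda>v. if v = [] then 1 else 0)) \<and>
     (\<forall>n s w. X (Suc n) s s w = (\<lambda>_. 0)) \<and>
     (\<forall>n s t v i (P :: nat \<Rightarrow> real list). 0 \<le> s \<longrightarrow> s < t \<longrightarrow> length v = n \<longrightarrow>
        set v \<subseteq> {..<d} \<longrightarrow> i < d \<longrightarrow> (\<forall>k. is_partition s t (P k)) \<longrightarrow>
        (\<lambda>k. mesh (P k)) \<longlonglongrightarrow> 0 \<longrightarrow>
        conv_in_prob M (\<lambda>k. strat_sum B (X n s) (P k) v i) (\<lambda>w. X (Suc n) s t w (v @ [i])))"

definition Ltilde ::
  "(nat \<Rightarrow> (nat list \<Rightarrow> real) \<Rightarrow> real) \<Rightarrow> (nat \<Rightarrow> real \<Rightarrow> real \<Rightarrow> 'a \<Rightarrow> nat list \<Rightarrow> real) \<Rightarrow> real \<Rightarrow> real \<Rightarrow> 'a \<Rightarrow> ereal" where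
  "Ltilde N X s t w = limsup (\<lambda>n. ereal ((Gamma (real n / 2 + 1) * N n (X n s t w)) powr (2 / real n)))"

end

theory Submission
  imports Defs
begin

text \<open>
  Write \<open>L\<^sub>s\<^sub>,\<^sub>t\<close> for the limsup. Chen's identity holds almost surely because Stratonovich sums are
  additive under concatenation of partitions, and every coefficient of the signature is almost surely a
  measurable functional of the path, so that signatures over adjacent intervals are independent and obey
  Brownian scaling.

  Upper bound: let \<open>c(u, v)\<close> be the correlation of the coefficients of the words \<open>u\<close>, \<open>v\<close> over \<open>[0, 1]\<close>.
  Expanding the correlation over \<open>[0, 1 + h]\<close> by Chen's identity and comparing coefficients of \<open>h\<close>
  expresses \<open>(|u| + |v|) / 2 * c(u, v)\<close> through correlations of words with two letters fewer in total;
  Pascal's rule then gives that every coefficient at level \<open>n\<close> has second moment at most \<open>2\<^sup>n / n!\<close>.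
  Since there are \<open>d\<^sup>n\<close> words, Borel-Cantelli yields \<open>L\<^sub>0\<^sub>,\<^sub>1 \<le> d\<^sup>2\<close>.

  Constancy: Chen's identity and the binomial theorem give \<open>L\<^sub>0\<^sub>,\<^sub>2 \<le> L\<^sub>0\<^sub>,\<^sub>1 + L\<^sub>1\<^sub>,\<^sub>2\<close>. By scaling the left side
  has the law of \<open>2 L\<^sub>0\<^sub>,\<^sub>1\<close>, so both sides have the same mean and agree almost surely; comparing variances,
  \<open>4 Var = 2 Var\<close>, so \<open>L\<^sub>0\<^sub>,\<^sub>1\<close> is constant.
\<close>

subsection \<open>Convergence in probability\<close>

text \<open>The signature is given only through limits in probability at fixed times, so every
  identity carries a null set depending on the times and the word; the arguments combine countably
  many of them at once. No moment is given either: square integrability of the coefficients has to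
  be extracted from the approximating sums before a correlation can be formed, and only then do
  algebraic recursions take over.

  The constant \<open>d ^ 2\<close> arises from \<open>d ^ n * d ^ n\<close> under the root: one
  factor counts the words of length \<open>n\<close>, the other is the Cauchy-Schwarz cost of
  passing to second moments from the \<open>l1\<close> norm, which dominates the given norms at
  positive levels. The factor \<open>2 ^ n / fact n\<close> is cancelled, up to a polynomial, by the
  square of \<open>Gamma (n / 2 + 1)\<close>.

  The upper bound precedes constancy because comparing variances requires growth rates that are
  almost surely finite and square integrable. Scaling is what lets three intervals suffice; no
  zero-one law enters.\<close>

lemma (in prob_space) conv_in_prob_AE_subseq:
  assumes [measurable]: "\<And>k. Y k \<in> borel_measurable M" "Z \<in> borel_measurable M"
    and conv: "conv_in_prob M Y Z"
  shows "\<exists>r. strict_mono (r::nat\<Rightarrow>nat) \<and> (AE w in M. (\<lambda>k. Y (r k) w) \<longlonglongrightarrow> Z w)"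
proof -
  \<comment> \<open>Truncation at 1 makes the distance integrable with no moment assumption, and
    convergence in probability becomes convergence in \<open>L1\<close>, which has almost surely
    convergent subsequences.\<close>
  define u where "u k w = min 1 \<bar>Y k w - Z w\<bar>" for k w
  have [measurable]: "u k \<in> borel_measurable M" for k
    unfolding u_def by measurable
  have int: "integrable M (u k)" for k
    by (rule integrable_const_bound[of _ 1]) (auto simp: u_def)
  have nn: "0 \<le> (\<integral>x. u k x \<partial>M)" for k
    by (intro integral_nonneg_AE) (auto simp: u_def)
  have bound: "(\<integral>x. u k x \<partial>M) \<le> e + measure M {w \<in> space M. e < \<bar>Y k w - Z w\<bar>}" if "e > 0" for k e
  proof -
    have "(\<integral>x. u k x \<partial>M) \<le> (\<integral>x. e + indicator {w \<in> space M. e < \<bar>Y k w - Z w\<bar>} x \<partial>M)"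
      using that by (intro integral_mono int Bochner_Integration.integrable_add integrable_real_indicator)
        (auto simp: u_def indicator_def emeasure_eq_measure)
    also have "\<dots> = e + measure M {w \<in> space M. e < \<bar>Y k w - Z w\<bar>}"
      by (subst Bochner_Integration.integral_add)
        (auto simp: prob_space emeasure_eq_measure intro!: integrable_real_indicator)
    finally show ?thesis .
  qed
  have "(\<lambda>k. \<integral>x. u k x \<partial>M) \<longlonglongrightarrow> 0"
  proof (rule LIMSEQ_I)
    fix e :: real assume "e > 0"
    have "(\<lambda>k. measure M {w \<in> space M. e/2 < \<bar>Y k w - Z w\<bar>}) \<longlonglongrightarrow> 0"
      using conv \<open>e > 0\<close> unfolding conv_in_prob_def by (meson half_gt_zero)
    from LIMSEQ_D[OF this, of "e/2"] \<open>e > 0\<close> obtain n0 where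
      n0: "\<And>k. k \<ge> n0 \<Longrightarrow> measure M {w \<in> space M. e/2 < \<bar>Y k w - Z w\<bar>} < e/2"
      by auto
    have "norm ((\<integral>x. u k x \<partial>M) - 0) < e" if "k \<ge> n0" for k
      using bound[of "e/2" k] n0[OF that] nn[of k] \<open>e > 0\<close> by simp
    then show "\<exists>no. \<forall>k\<ge>no. norm ((\<integral>x. u k x \<partial>M) - 0) < e" by blast
  qed
  moreover have "(\<integral>x. norm (u k x) \<partial>M) = (\<integral>x. u k x \<partial>M)" for k
    by (rule Bochner_Integration.integral_cong) (auto simp: u_def)
  ultimately obtain r where r: "strict_mono (r::nat\<Rightarrow>nat)" "AE x in M. (\<lambda>n. u (r n) x) \<longlonglongrightarrow> 0"
    using tendsto_L1_AE_subseq[of M u, OF int] by auto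
  have "AE w in M. (\<lambda>k. Y (r k) w) \<longlonglongrightarrow> Z w"
    using r(2)
  proof eventually_elim
    case (elim w)
    \<comment> \<open>A value below 1 is an untruncated one, so the distance itself tends to
      0.\<close>
    have "eventually (\<lambda>n. u (r n) w < 1) sequentially"
      using order_tendstoD(2)[OF elim, of 1] by simp
    then have "eventually (\<lambda>n. \<bar>Y (r n) w - Z w\<bar> = u (r n) w) sequentially"
      by eventually_elim (auto simp: u_def)
    then have "(\<lambda>n. \<bar>Y (r n) w - Z w\<bar>) \<longlonglongrightarrow> 0"
      using elim by (simp add: tendsto_cong)
    then show ?case by (simp add: LIM_zero_cancel tendsto_rabs_zero_iff)
  qed
  with r(1) show ?thesis by blast
qed

lemma conv_in_prob_subseq:
  assumes "conv_in_prob M Y Z" "strict_mono (r::nat\<Rightarrow>nat)"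
  shows "conv_in_prob M (\<lambda>k. Y (r k)) Z"
  using assms LIMSEQ_subseq_LIMSEQ[OF _ assms(2)] unfolding conv_in_prob_def comp_def by fast

text \<open>Each further limit is obtained along a subsequence of the previous one, which keeps the
  earlier limits. With one common subsequence, an algebraic identity between approximating sums
  becomes an identity between their limits.\<close>

lemma (in prob_space) conv_in_prob_AE_subseq_finite:
  assumes "finite J"
    and "\<And>j k. j \<in> J \<Longrightarrow> Y j k \<in> borel_measurable M" "\<And>j. j \<in> J \<Longrightarrow> Z j \<in> borel_measurable M"
    and "\<And>j. j \<in> J \<Longrightarrow> conv_in_prob M (Y j) (Z j)"
  shows "\<exists>r. strict_mono (r::nat\<Rightarrow>nat) \<and> (AE w in M. \<forall>j\<in>J. (\<lambda>k. Y j (r k) w) \<longlonglongrightarrow> Z j w)"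
  using assms
proof (induction J rule: finite_induct)
  case empty
  show ?case by (intro exI[of _ id]) (auto simp: strict_mono_def)
next
  case (insert j J)
  then obtain r where r: "strict_mono (r::nat\<Rightarrow>nat)"
    "AE w in M. \<forall>j\<in>J. (\<lambda>k. Y j (r k) w) \<longlonglongrightarrow> Z j w" by auto
  have "conv_in_prob M (\<lambda>k. Y j (r k)) (Z j)"
    using insert.prems by (intro conv_in_prob_subseq[OF _ r(1)]) auto
  then obtain q where q: "strict_mono (q::nat\<Rightarrow>nat)" "AE w in M. (\<lambda>k. Y j (r (q k)) w) \<longlonglongrightarrow> Z j w"
    using conv_in_prob_AE_subseq[of "\<lambda>k. Y j (r k)" "Z j"] insert.prems by auto
  have "AE w in M. \<forall>j\<in>insert j J. (\<lambda>k. Y j (r (q k)) w) \<longlonglongrightarrow> Z j w"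
    using r(2) q(2)
  proof eventually_elim
    case (elim w)
    then show ?case
      using LIMSEQ_subseq_LIMSEQ[OF _ q(1)] unfolding comp_def by fast
  qed
  then show ?case
    using strict_mono_o[OF r(1) q(1)] by (auto simp: comp_def intro!: exI[of _ "\<lambda>k. r (q k)"])
qed

lemma (in prob_space) conv_in_prob_L1:
  assumes "\<And>k. integrable M (Y k)" "(\<lambda>k. \<integral>w. \<bar>Y k w\<bar> \<partial>M) \<longlonglongrightarrow> 0"
  shows "conv_in_prob M Y (\<lambda>_. 0)"
  unfolding conv_in_prob_def
proof (intro allI impI)
  fix e :: real assume e: "e > 0"
  have le: "measure M {w \<in> space M. e < \<bar>Y k w - 0\<bar>} \<le> (\<integral>w. \<bar>Y k w\<bar> \<partial>M) / e" for k
  proof -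
    have [measurable]: "Y k \<in> borel_measurable M" using assms(1) by auto
    have "measure M {w \<in> space M. e < \<bar>Y k w - 0\<bar>} \<le> measure M {w \<in> space M. e \<le> \<bar>Y k w\<bar>}"
      by (rule finite_measure_mono) auto
    also have "\<dots> \<le> (\<integral>w. \<bar>Y k w\<bar> \<partial>M) / e"
      using e assms(1) by (intro integral_Markov_inequality_measure[where A="{}"]) auto
    finally show ?thesis .
  qed
  have lim: "(\<lambda>k. (\<integral>w. \<bar>Y k w\<bar> \<partial>M) / e) \<longlonglongrightarrow> 0"
    using tendsto_divide[OF assms(2) tendsto_const, of e] e by simp
  show "(\<lambda>k. measure M {w \<in> space M. e < \<bar>Y k w - 0\<bar>}) \<longlonglongrightarrow> 0"
    by (rule Lim_null_comparison[OF always_eventually lim]) (use le in auto)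
qed

lemma (in prob_space) square_integrable_of_AE_limit:
  fixes W :: "nat \<Rightarrow> 'a \<Rightarrow> real"
  assumes [measurable]: "Z \<in> borel_measurable M" "\<And>k. W k \<in> borel_measurable M"
    and lim: "AE w in M. (\<lambda>k. W k w) \<longlonglongrightarrow> Z w"
    and int: "\<And>k. integrable M (\<lambda>w. (W k w)\<^sup>2)" and bd: "\<And>k. (\<integral>w. (W k w)\<^sup>2 \<partial>M) \<le> C"
  shows "integrable M (\<lambda>w. (Z w)\<^sup>2)"
proof -
  have "(\<integral>\<^sup>+w. ennreal ((Z w)\<^sup>2) \<partial>M) = (\<integral>\<^sup>+w. liminf (\<lambda>k. ennreal ((W k w)\<^sup>2)) \<partial>M)"
  proof (rule nn_integral_cong_AE, use lim in eventually_elim)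
    case (elim w)
    have "(\<lambda>k. ennreal ((W k w)\<^sup>2)) \<longlonglongrightarrow> ennreal ((Z w)\<^sup>2)"
      using elim by (intro tendsto_intros)
    then show ?case by (metis lim_imp_Liminf sequentially_bot)
  qed
  also have "\<dots> \<le> liminf (\<lambda>k. \<integral>\<^sup>+w. ennreal ((W k w)\<^sup>2) \<partial>M)"
    by (rule nn_integral_liminf) measurable
  also have "\<dots> \<le> ennreal C"
    by (rule Liminf_le) (auto simp: nn_integral_eq_integral int bd intro!: ennreal_leI always_eventually)
  finally show ?thesis
    by (intro integrableI_bounded) (auto simp: le_less_trans[OF _ ennreal_less_top])
qed

subsection \<open>Uniform partitions\<close>

text \<open>Dividing by \<open>Suc m\<close> leaves at least one interval for every
  \<open>m\<close>, so every index yields a genuine partition.\<close>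

definition upart :: "real \<Rightarrow> real \<Rightarrow> nat \<Rightarrow> real list" where
  "upart a b m = map (\<lambda>j. a + (b - a) * (real j / real (Suc m))) [0..<Suc (Suc m)]"

lemma length_upart [simp]: "length (upart a b m) = Suc (Suc m)"
  by (simp add: upart_def)

lemma nth_upart: "j \<le> Suc m \<Longrightarrow> upart a b m ! j = a + (b - a) * (real j / real (Suc m))"
  unfolding upart_def by (subst nth_map) (auto simp del: upt_Suc)

lemma nth_upart_bounds:
  assumes "a \<le> b" "j \<le> Suc m"
  shows "a \<le> upart a b m ! j" "upart a b m ! j \<le> b"
proof -
  have "real j / real (Suc m) \<le> 1" using assms(2) by simp
  then have "(b - a) * (real j / real (Suc m)) \<le> (b - a) * 1"
    using assms(1) by (intro mult_left_mono) auto
  then show "upart a b m ! j \<le> b" using assms by (simp add: nth_upart)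
  show "a \<le> upart a b m ! j" using assms by (simp add: nth_upart)
qed

lemma is_partition_upart:
  assumes "a < b" shows "is_partition a b (upart a b m)"
  unfolding is_partition_def
proof (intro conjI)
  show "last (upart a b m) = b"
    by (subst last_conv_nth) (auto simp: nth_upart simp flip: length_0_conv)
  show "sorted_wrt (<) (upart a b m)"
    using assms
    by (auto simp: sorted_wrt_iff_nth_less nth_upart intro!: mult_strict_left_mono divide_strict_right_mono)
qed (auto simp: nth_upart)

lemma mesh_le_iff:
  assumes "2 \<le> length p"
  shows "mesh p \<le> e \<longleftrightarrow> (\<forall>k<length p - 1. p ! Suc k - p ! k \<le> e)"
  using assms unfolding mesh_def by (subst Max_le_iff) (auto simp: lessThan_empty_iff)

lemma mesh_nonneg:
  assumes "is_partition a b p" shows "0 \<le> mesh p"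
proof -
  have l: "2 \<le> length p" using assms by (auto simp: is_partition_def)
  have "p ! 0 < p ! 1"
    using assms l by (auto simp: is_partition_def sorted_wrt_iff_nth_less)
  moreover have "p ! Suc 0 - p ! 0 \<le> mesh p"
    using mesh_le_iff[OF l, of "mesh p"] l by auto
  ultimately show ?thesis by simp
qed

lemma mesh_upart_le:
  assumes "a < b" shows "mesh (upart a b m) \<le> (b - a) / real (Suc m)"
proof (subst mesh_le_iff)
  have "upart a b m ! Suc k - upart a b m ! k = (b - a) / real (Suc m)" if "k < Suc m" for k
  proof -
    have "upart a b m ! Suc k - upart a b m ! k = (b - a) * (real (Suc k) / real (Suc m) - real k / real (Suc m))"
      using that by (simp add: nth_upart right_diff_distrib)
    also have "\<dots> = (b - a) / real (Suc m)"
      by (simp add: diff_divide_distrib[symmetric])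
    finally show ?thesis .
  qed
  then show "\<forall>k<length (upart a b m) - 1. upart a b m ! Suc k - upart a b m ! k \<le> (b - a) / real (Suc m)"
    by simp
qed simp

lemma LIMSEQ_over_Suc: "(\<lambda>m. c / real (Suc m)) \<longlonglongrightarrow> 0"
  using LIMSEQ_Suc[OF lim_const_over_n[of c]] by simp

lemma mesh_upart_tendsto:
  assumes "a < b" shows "(\<lambda>m. mesh (upart a b m)) \<longlonglongrightarrow> 0"
  by (rule Lim_null_comparison[OF always_eventually LIMSEQ_over_Suc[of "b - a"]])
    (use mesh_upart_le[OF assms] mesh_nonneg[OF is_partition_upart[OF assms]] in auto)

text \<open>\<open>tl q\<close> drops the shared point \<open>b\<close>. No interval of the joined
  partition straddles \<open>b\<close>, which is why the sums split exactly and not only in the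
  limit.\<close>

lemma
  assumes p: "is_partition a b p" and q: "is_partition b c q"
  shows is_partition_append: "is_partition a c (p @ tl q)"
    and mesh_append: "mesh (p @ tl q) \<le> max (mesh p) (mesh q)"
    and strat_sum_append: "strat_sum B Y (p @ tl q) v i w = strat_sum B Y p v i w + strat_sum B Y q v i w"
proof -
  have "p \<noteq> []" using p by (auto simp: is_partition_def)
  then have lp: "2 \<le> length p" and lq: "2 \<le> length q"
    and pb: "p ! (length p - 1) = b" and qb: "q ! 0 = b"
    using p q by (auto simp: is_partition_def last_conv_nth[of p])
  define m where "m = length p - 1"
  define n where "n = length q - 1"
  have m: "length p = Suc m" "0 < m" and n: "length q = Suc n" "0 < n"
    using lp lq by (auto simp: m_def n_def)
  have lo: "(p @ tl q) ! k = p ! k" if "k \<le> m" for k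
    using that m by (auto simp: nth_append)
  have hi: "(p @ tl q) ! (m + k) = q ! k" if "k \<le> n" for k
  proof (cases k)
    case 0 then show ?thesis using pb qb m by (auto simp: nth_append)
  next
    case (Suc j) then show ?thesis using that m n by (auto simp: nth_append nth_tl)
  qed
  have len: "length (p @ tl q) - 1 = m + n" using m n by simp
  show "strat_sum B Y (p @ tl q) v i w = strat_sum B Y p v i w + strat_sum B Y q v i w"
  proof -
    have "sum f {..<m + n} = sum f {..<m} + (\<Sum>k<n. f (m + k))" for f :: "nat \<Rightarrow> real"
      by (induction n) auto
    moreover have "(p @ tl q) ! Suc (m + k) = q ! Suc k" if "k < n" for k
      using hi[of "Suc k"] that by simp
    ultimately show ?thesis
      unfolding strat_sum_def len using m n lo hi by simp
  qed
  have dec: "k < m \<or> (\<exists>j<n. k = m + j)" if "k < m + n" for k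
    using that by (metis add_diff_inverse_nat nat_add_left_cancel_less)
  show "mesh (p @ tl q) \<le> max (mesh p) (mesh q)"
  proof (subst mesh_le_iff)
    show "2 \<le> length (p @ tl q)" using lp by simp
    show "\<forall>k<length (p @ tl q) - 1. (p @ tl q) ! Suc k - (p @ tl q) ! k \<le> max (mesh p) (mesh q)"
      unfolding len
    proof (intro allI impI)
      fix k assume "k < m + n"
      then consider "k < m" | j where "j < n" "k = m + j" using dec by blast
      then show "(p @ tl q) ! Suc k - (p @ tl q) ! k \<le> max (mesh p) (mesh q)"
      proof cases
        case 1
        then show ?thesis using mesh_le_iff[OF lp, of "mesh p"] m lo by (auto simp: le_max_iff_disj)
      next
        case 2
        then show ?thesis
          using mesh_le_iff[OF lq, of "mesh q"] n hi[of j] hi[of "Suc j"] by (auto simp: le_max_iff_disj)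
      qed
    qed
  qed
  show "is_partition a c (p @ tl q)"
    unfolding is_partition_def
  proof (intro conjI)
    have "last (p @ tl q) = last q"
      using n by (cases q) auto
    then show "last (p @ tl q) = c" using q by (auto simp: is_partition_def)
    have sq: "sorted_wrt (<) q" using q by (auto simp: is_partition_def)
    have sp: "sorted_wrt (<) p" using p by (auto simp: is_partition_def)
    have "x \<le> b" if xp: "x \<in> set p" for x
    proof -
      obtain k where "k < length p" "x = p ! k" using xp by (auto simp: in_set_conv_nth)
      then show ?thesis
        using sorted_wrt_nth_less[OF sp, of k m] pb m by (cases "k = m") auto
    qed
    moreover have "b < y" if "y \<in> set (tl q)" for y
      using that sq qb n by (cases q) auto
    ultimately show "sorted_wrt (<) (p @ tl q)"
      using sp sq n by (cases q) (auto simp: sorted_wrt_append intro: le_less_trans)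
  qed (use p lp m in \<open>auto simp: is_partition_def nth_append\<close>)
qed

lemma partition_nth_bounds:
  assumes "is_partition a b p" "k < length p"
  shows "a \<le> p ! k" "p ! k \<le> b"
proof -
  have s: "sorted_wrt (<) p" and a: "p ! 0 = a" and b: "p ! (length p - 1) = b"
    using assms by (auto simp: is_partition_def last_conv_nth[of p] simp flip: length_0_conv)
  show "a \<le> p ! k" using s a assms(2)
    by (cases "k = 0") (auto simp: sorted_wrt_iff_nth_less intro!: less_imp_le)
  show "p ! k \<le> b" using s b assms(2)
    by (cases "k = length p - 1") (auto simp: sorted_wrt_iff_nth_less intro!: less_imp_le)
qed

subsection \<open>Brownian signatures and Chen's identity\<close>

text \<open>The pair of motion and signature is packaged as a locale because several instances are
  compared on one probability space: restarted, rescaled and reflected ones.\<close>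

locale brownian_signature = prob_space M for M :: "'a measure" +
  fixes d :: nat and B :: "real \<Rightarrow> 'a \<Rightarrow> nat \<Rightarrow> real"
    and X :: "nat \<Rightarrow> real \<Rightarrow> real \<Rightarrow> 'a \<Rightarrow> nat list \<Rightarrow> real"
  assumes d_pos: "0 < d" and brownian: "std_brownian M d B" and signature: "strat_signature M d B X"
begin

lemma B_measurable: "0 \<le> t \<Longrightarrow> i < d \<Longrightarrow> (\<lambda>w. B t w i) \<in> borel_measurable M"
  using brownian by (auto simp: std_brownian_def)

lemma X_measurable [measurable]: "(\<lambda>w. X n s t w v) \<in> borel_measurable M"
  using signature by (auto simp: strat_signature_def)

lemma X_tens: "X n s t w \<in> tens d n"
  using signature by (auto simp: strat_signature_def)

lemma X_zero: "X 0 s t w v = (if v = [] then 1 else 0)"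
  using signature by (auto simp: strat_signature_def)

lemma X_refl: "X (Suc n) s s w v = 0"
  using signature by (auto simp: strat_signature_def)

lemma X_bad_letter: "\<not> set v \<subseteq> {..<d} \<Longrightarrow> X n s t w v = 0"
  using X_tens[of n s t w] by (auto simp: tens_def)

lemma X_conv:
  assumes "0 \<le> s" "s < t" "length v = n" "set v \<subseteq> {..<d}" "i < d" "\<And>k. is_partition s t (P k)"
    "(\<lambda>k. mesh (P k)) \<longlonglongrightarrow> 0"
  shows "conv_in_prob M (\<lambda>k. strat_sum B (X n s) (P k) v i) (\<lambda>w. X (Suc n) s t w (v @ [i]))"
  using signature assms unfolding strat_signature_def by blast

lemma strat_sum_measurable:
  assumes "0 \<le> s" "is_partition s t p" "i < d"
  shows "strat_sum B (X n r) p v i \<in> borel_measurable M"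
proof -
  have "(\<lambda>w. B (p ! k) w i) \<in> borel_measurable M" if "k < length p" for k
    using partition_nth_bounds[OF assms(2) that] assms(1,3) by (intro B_measurable) auto
  then show ?thesis unfolding strat_sum_def by (auto intro!: borel_measurable_sum borel_measurable_times)
qed

text \<open>Over a degenerate interval all positive levels vanish and a single summand survives.
  These cases are separate because convergence of Stratonovich sums is given only for
  \<open>s < t\<close>.\<close>

lemma chen_left_refl: "X (length v) a c w v = (\<Sum>j\<le>length v. X j a a w (take j v) * X (length v - j) a c w (drop j v))"
proof -
  have "X j a a w (take j v) = 0" if "j \<noteq> 0" for j using that by (cases j) (auto simp: X_refl)
  then have "(\<Sum>j\<le>length v. X j a a w (take j v) * X (length v - j) a c w (drop j v))
      = (\<Sum>j\<le>length v. if j = 0 then X (length v) a c w v else 0)"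
    by (intro sum.cong) (auto simp: X_zero)
  then show ?thesis by simp
qed

lemma chen_right_refl: "X (length v) a c w v = (\<Sum>j\<le>length v. X j a c w (take j v) * X (length v - j) c c w (drop j v))"
proof -
  have "X (length v - j) c c w (drop j v) = 0" if "j < length v" for j
    using that by (cases "length v - j") (auto simp: X_refl)
  then have "(\<Sum>j\<le>length v. X j a c w (take j v) * X (length v - j) c c w (drop j v))
      = (\<Sum>j\<le>length v. if j = length v then X (length v) a c w v else 0)"
    by (intro sum.cong) (auto simp: X_zero)
  then show ?thesis by simp
qed

text \<open>Induction on the last letter, with \<open>c\<close> general because the hypothesis is
  applied at every partition point of \<open>[b, c]\<close>. There the factors
  \<open>X j a b\<close> do not depend on the running time, so they come out of the sum and leave
  Stratonovich sums started at \<open>b\<close>.\<close>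

theorem chen:
  assumes "0 \<le> a" "a \<le> b" "b \<le> c"
  shows "AE w in M. X (length v) a c w v = (\<Sum>j\<le>length v. X j a b w (take j v) * X (length v - j) b c w (drop j v))"
proof (cases "set v \<subseteq> {..<d}")
  case False
  have zero: "X j a b w (take j v) * X (length v - j) b c w (drop j v) = 0" for j w
  proof -
    have "set v = set (take j v) \<union> set (drop j v)" by (metis append_take_drop_id set_append)
    then have "\<not> set (take j v) \<subseteq> {..<d} \<or> \<not> set (drop j v) \<subseteq> {..<d}" using False by auto
    then show ?thesis using X_bad_letter by (metis mult_zero_left mult_zero_right)
  qed
  show ?thesis unfolding zero X_bad_letter[OF False] by simp
next
  case True
  then show ?thesis using assms(3)
  proof (induction v arbitrary: c rule: rev_induct)
    case Nil
    then show ?case by (simp add: X_zero)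
  next
    case (snoc i v)
    consider "a = b" | "b = c" | "a < b" "b < c" using assms snoc.prems by fastforce
    then show ?case
    proof cases
      case 1
      then show ?thesis using chen_left_refl[of "v @ [i]" a c] by auto
    next
      case 2
      then show ?thesis using chen_right_refl[of "v @ [i]" a c] by auto
    next
      case 3
      define n where "n = length v"
      define P where "P k = upart a b k @ tl (upart b c k)" for k
      have v: "set v \<subseteq> {..<d}" "i < d" using snoc.prems by auto
      have pab: "is_partition a b (upart a b k)" and pbc: "is_partition b c (upart b c k)" for k
        using 3 by (auto intro: is_partition_upart)
      have pP: "is_partition a c (P k)" for k
        unfolding P_def by (rule is_partition_append[OF pab pbc])
      have "(\<lambda>k. max (mesh (upart a b k)) (mesh (upart b c k))) \<longlonglongrightarrow> max 0 0"
        using 3 by (intro tendsto_max mesh_upart_tendsto)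
      then have "(\<lambda>k. max (mesh (upart a b k)) (mesh (upart b c k))) \<longlonglongrightarrow> 0" by simp
      then have meshP: "(\<lambda>k. mesh (P k)) \<longlonglongrightarrow> 0"
        by (rule Lim_null_comparison[rotated])
          (use mesh_append[OF pab pbc] mesh_nonneg[OF pP] in \<open>auto simp: P_def\<close>)
      \<comment> \<open>One family holds all sums involved: \<open>j \<le> n\<close> for the
        suffixes of \<open>v\<close> over \<open>[b, c]\<close>, then the sum over
        \<open>[a, b]\<close>, then the one over \<open>[a, c]\<close>. They can thus share a
        subsequence.\<close>
      define Y where "Y j k = (if j \<le> n then strat_sum B (X (n - j) b) (upart b c k) (drop j v) i
        else if j = Suc n then strat_sum B (X n a) (upart a b k) v i
        else strat_sum B (X n a) (P k) v i)" for j k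
      define Z where "Z j w = (if j \<le> n then X (Suc (n - j)) b c w (drop j v @ [i])
        else if j = Suc n then X (Suc n) a b w (v @ [i]) else X (Suc n) a c w (v @ [i]))" for j w
      have "\<exists>r. strict_mono (r::nat\<Rightarrow>nat) \<and> (AE w in M. \<forall>j\<in>{..Suc (Suc n)}. (\<lambda>k. Y j (r k) w) \<longlonglongrightarrow> Z j w)"
      proof (rule conv_in_prob_AE_subseq_finite)
        fix j k
        show "Y j k \<in> borel_measurable M"
          unfolding Y_def using assms(1) 3 v strat_sum_measurable[OF _ pab] strat_sum_measurable[OF _ pbc]
            strat_sum_measurable[OF _ pP] by auto
        show "Z j \<in> borel_measurable M"
          unfolding Z_def by measurable
        have "set (drop j v) \<subseteq> {..<d}" using v(1) set_drop_subset[of j v] by auto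
        then have "conv_in_prob M (\<lambda>k. strat_sum B (X (n - j) b) (upart b c k) (drop j v) i)
            (\<lambda>w. X (Suc (n - j)) b c w (drop j v @ [i]))"
          using 3 assms(1) v by (intro X_conv pbc mesh_upart_tendsto) (auto simp: n_def)
        moreover have "conv_in_prob M (\<lambda>k. strat_sum B (X n a) (upart a b k) v i) (\<lambda>w. X (Suc n) a b w (v @ [i]))"
          using 3 assms(1) v by (intro X_conv pab mesh_upart_tendsto) (auto simp: n_def)
        moreover have "conv_in_prob M (\<lambda>k. strat_sum B (X n a) (P k) v i) (\<lambda>w. X (Suc n) a c w (v @ [i]))"
          using 3 assms(1) v by (intro X_conv pP meshP) (auto simp: n_def)
        ultimately show "conv_in_prob M (Y j) (Z j)"
          by (cases "j \<le> n"; cases "j = Suc n") (simp_all add: Y_def[abs_def] Z_def[abs_def])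
      qed auto
      then obtain r where lim: "AE w in M. \<forall>j\<in>{..Suc (Suc n)}. (\<lambda>k. Y j (r k) w) \<longlonglongrightarrow> Z j w"
        by blast
      \<comment> \<open>The hypothesis is used at all points of all partitions; these are countably
        many, so one null set serves.\<close>
      have "AE w in M. \<forall>k. \<forall>l\<in>{..Suc k}. X n a (upart b c k ! l) w v =
          (\<Sum>j\<le>n. X j a b w (take j v) * X (n - j) b (upart b c k ! l) w (drop j v))"
        unfolding n_def using nth_upart_bounds[of b c] 3 v
        by (intro AE_all_countable[THEN iffD2] allI AE_finite_all[THEN iffD2] ballI snoc.IH) auto
      with lim show ?thesis
      proof eventually_elim
        case (elim w)
        have split: "Y (Suc (Suc n)) k w = Y (Suc n) k w + (\<Sum>j\<le>n. X j a b w (take j v) * Y j k w)" for k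
        proof -
          have "strat_sum B (X n a) (upart b c k) v i w
            = (\<Sum>j\<le>n. X j a b w (take j v) * strat_sum B (X (n - j) b) (upart b c k) (drop j v) i w)"
            unfolding strat_sum_def sum_distrib_left
            apply (subst sum.swap)
            apply (rule sum.cong[OF refl])
            using elim(2)
            apply (auto simp: sum_distrib_left sum_distrib_right sum.distrib[symmetric] sum_divide_distrib
                algebra_simps simp del: sum.distrib intro!: sum.cong)
            done
          then show ?thesis
            by (simp add: Y_def P_def strat_sum_append[OF pab pbc])
        qed
        have "(\<lambda>k. Y (Suc (Suc n)) (r k) w) \<longlonglongrightarrow> Z (Suc n) w + (\<Sum>j\<le>n. X j a b w (take j v) * Z j w)"
          unfolding split using elim(1) by (intro tendsto_intros) auto
        then have "Z (Suc (Suc n)) w = Z (Suc n) w + (\<Sum>j\<le>n. X j a b w (take j v) * Z j w)"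
          using elim(1) LIMSEQ_unique[of "\<lambda>k. Y (Suc (Suc n)) (r k) w"] by auto
        \<comment> \<open>The term \<open>Z (Suc n)\<close> becomes the summand
          \<open>j = Suc n\<close> for the word \<open>v @ [i]\<close>, whose right factor is the
          level-zero value 1.\<close>
        then show ?case
          by (simp add: Z_def n_def X_zero Suc_diff_le)
      qed
    qed
  qed
qed

end

subsection \<open>Affine changes of time and signs\<close>

text \<open>Restart at \<open>a\<close>, Brownian scaling by \<open>l\<close> and reflection of
  coordinates in one map, so that shift, scaling and sign symmetries all follow from a single
  uniqueness statement for laws.\<close>

definition aff_path :: "(real \<Rightarrow> 'a \<Rightarrow> nat \<Rightarrow> real) \<Rightarrow> real \<Rightarrow> real \<Rightarrow> (nat \<Rightarrow> real) \<Rightarrow> real \<Rightarrow> 'a \<Rightarrow> nat \<Rightarrow> real" where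
  "aff_path B a l \<epsilon> t w i = \<epsilon> i / sqrt l * (B (a + l * t) w i - B a w i)"

text \<open>By multilinearity each letter \<open>i\<close> of the word contributes one factor
  \<open>\<epsilon> i / sqrt l\<close>.\<close>

definition aff_sig :: "(nat \<Rightarrow> real \<Rightarrow> real \<Rightarrow> 'a \<Rightarrow> nat list \<Rightarrow> real) \<Rightarrow> real \<Rightarrow> real \<Rightarrow> (nat \<Rightarrow> real)
    \<Rightarrow> nat \<Rightarrow> real \<Rightarrow> real \<Rightarrow> 'a \<Rightarrow> nat list \<Rightarrow> real" where
  "aff_sig X a l \<epsilon> n s t w v = prod_list (map \<epsilon> v) / sqrt l ^ n * X n (a + l * s) (a + l * t) w v"

lemma conv_in_prob_cmult:
  assumes "conv_in_prob M Y Z"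
  shows "conv_in_prob M (\<lambda>k w. c * Y k w) (\<lambda>w. c * Z w)"
proof (cases "c = 0")
  case True
  then show ?thesis by (simp add: conv_in_prob_def)
next
  case False
  have "e < \<bar>c * Y k w - c * Z w\<bar> \<longleftrightarrow> e / \<bar>c\<bar> < \<bar>Y k w - Z w\<bar>" for e k w
  proof -
    have "\<bar>c * Y k w - c * Z w\<bar> = \<bar>Y k w - Z w\<bar> * \<bar>c\<bar>"
      by (simp only: right_diff_distrib[symmetric] abs_mult mult.commute)
    then show ?thesis using False by (simp add: pos_divide_less_eq)
  qed
  then show ?thesis using assms False by (simp add: conv_in_prob_def)
qed

lemma (in brownian_signature) std_brownian_aff_path:
  assumes a: "0 \<le> a" and l: "0 < l" and \<epsilon>: "\<And>i. \<epsilon> i \<in> {1, -1}"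
  shows "std_brownian M d (aff_path B a l \<epsilon>)"
  unfolding std_brownian_def
proof (intro conjI allI impI)
  show "prob_space M" by unfold_locales
  fix t :: real and i assume t: "0 \<le> t" and i: "i < d"
  have "(\<lambda>w. B (a + l * t) w i) \<in> borel_measurable M" "(\<lambda>w. B a w i) \<in> borel_measurable M"
    using a l t i by (auto intro!: B_measurable)
  then show "(\<lambda>w. aff_path B a l \<epsilon> t w i) \<in> borel_measurable M"
    unfolding aff_path_def by measurable
next
  show "AE w in M. \<forall>i<d. aff_path B a l \<epsilon> 0 w i = 0"
    by (simp add: aff_path_def)
next
  have "AE w in M. \<forall>i<d. continuous_on {0..} (\<lambda>t. B t w i)"
    using brownian by (simp add: std_brownian_def)
  then show "AE w in M. \<forall>i<d. continuous_on {0..} (\<lambda>t. aff_path B a l \<epsilon> t w i)"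
  proof eventually_elim
    case (elim w)
    have "continuous_on {0..} (\<lambda>t. B (a + l * t) w i)" if "i < d" for i
      by (rule continuous_on_compose2[OF elim[rule_format, OF that]])
        (use a l in \<open>auto intro!: continuous_intros\<close>)
    then show ?case
      unfolding aff_path_def by (intro allI impI continuous_on_mult_left continuous_on_diff continuous_on_const)
  qed
next
  fix k :: nat and tt :: "nat \<Rightarrow> real"
  assume tt: "0 \<le> tt 0" "\<forall>j<k. tt j < tt (Suc j)"
  define t' where "t' j = a + l * tt j" for j
  have t': "0 \<le> t' 0" "\<forall>j<k. t' j < t' (Suc j)"
    using tt a l by (auto simp: t'_def)
  have inc: "aff_path B a l \<epsilon> (tt (Suc j)) w i - aff_path B a l \<epsilon> (tt j) w i
      = \<epsilon> i / sqrt l * (B (t' (Suc j)) w i - B (t' j) w i)" for j i w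
    by (simp add: aff_path_def t'_def algebra_simps)
  have "indep_vars (\<lambda>_. borel) (\<lambda>(j, i) w. B (t' (Suc j)) w i - B (t' j) w i) ({..<k} \<times> {..<d})"
    using brownian t' by (simp add: std_brownian_def)
  from indep_vars_compose2[OF this, of "\<lambda>(j, i) x. \<epsilon> i / sqrt l * x" "\<lambda>_. borel"]
  show "indep_vars (\<lambda>_. borel) (\<lambda>(j, i) w. aff_path B a l \<epsilon> (tt (Suc j)) w i - aff_path B a l \<epsilon> (tt j) w i)
      ({..<k} \<times> {..<d})"
    by (auto simp: inc case_prod_unfold)
  fix j i assume ji: "j < k" "i < d"
  have "distributed M lborel (\<lambda>w. B (t' (Suc j)) w i - B (t' j) w i) (normal_density 0 (sqrt (t' (Suc j) - t' j)))"
    using brownian t' ji by (simp add: std_brownian_def)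
  from normal_density_affine[OF this, of "\<epsilon> i / sqrt l" 0] t' ji l \<epsilon>[of i]
  have "distributed M lborel (\<lambda>w. \<epsilon> i / sqrt l * (B (t' (Suc j)) w i - B (t' j) w i))
      (normal_density 0 (\<bar>\<epsilon> i / sqrt l\<bar> * sqrt (t' (Suc j) - t' j)))"
    by auto
  moreover have "\<bar>\<epsilon> i / sqrt l\<bar> * sqrt (t' (Suc j) - t' j) = sqrt (tt (Suc j) - tt j)"
    using \<epsilon>[of i] l by (auto simp: t'_def real_sqrt_mult simp flip: right_diff_distrib)
  ultimately show "distributed M lborel (\<lambda>w. aff_path B a l \<epsilon> (tt (Suc j)) w i - aff_path B a l \<epsilon> (tt j) w i)
      (normal_density 0 (sqrt (tt (Suc j) - tt j)))"
    by (simp add: inc)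
qed

lemma (in brownian_signature) strat_signature_aff_sig:
  assumes a: "0 \<le> a" and l: "0 < l"
  shows "strat_signature M d (aff_path B a l \<epsilon>) (aff_sig X a l \<epsilon>)"
  unfolding strat_signature_def
proof (intro conjI allI impI)
  fix n s t w v
  show "aff_sig X a l \<epsilon> n s t w \<in> tens d n"
    using X_tens[of n "a + l * s" "a + l * t" w] by (simp add: tens_def aff_sig_def)
  show "(\<lambda>w. aff_sig X a l \<epsilon> n s t w v) \<in> borel_measurable M"
    unfolding aff_sig_def by measurable
  show "aff_sig X a l \<epsilon> 0 s t w = (\<lambda>v. if v = [] then 1 else 0)"
    by (auto simp: aff_sig_def X_zero)
  show "aff_sig X a l \<epsilon> (Suc n) s s w = (\<lambda>_. 0)"
    by (auto simp: aff_sig_def X_refl)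
next
  fix n and s t :: real and v i and P :: "nat \<Rightarrow> real list"
  assume st: "0 \<le> s" "s < t" and v: "length v = n" "set v \<subseteq> {..<d}" "i < d"
    and P: "\<forall>k. is_partition s t (P k)" and mesh: "(\<lambda>k. mesh (P k)) \<longlonglongrightarrow> 0"
  define Q where "Q k = map (\<lambda>x. a + l * x) (P k)" for k
  have len: "2 \<le> length (P k)" for k using P by (auto simp: is_partition_def)
  have Qnth: "Q k ! j = a + l * P k ! j" if "j < length (P k)" for j k
    using that by (simp add: Q_def)
  have PQ: "is_partition (a + l * s) (a + l * t) (Q k)" for k
  proof -
    have "P k \<noteq> []" using len[of k] by auto
    then show ?thesis
      using P l by (auto simp: is_partition_def Q_def last_map sorted_wrt_iff_nth_less)
  qed
  have "mesh (Q k) \<le> l * mesh (P k)" for k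
  proof (subst mesh_le_iff)
    show "\<forall>j<length (Q k) - 1. Q k ! Suc j - Q k ! j \<le> l * mesh (P k)"
      using mesh_le_iff[OF len, of k "mesh (P k)"] l
      by (auto simp: Q_def simp flip: right_diff_distrib)
  qed (use len in \<open>simp add: Q_def\<close>)
  moreover have "(\<lambda>k. l * mesh (P k)) \<longlonglongrightarrow> 0"
    using tendsto_mult[OF tendsto_const mesh, of l] by simp
  ultimately have meshQ: "(\<lambda>k. mesh (Q k)) \<longlonglongrightarrow> 0"
    by (intro Lim_null_comparison[of "\<lambda>k. mesh (Q k)" "\<lambda>k. l * mesh (P k)"])
      (auto intro!: always_eventually simp: mesh_nonneg[OF PQ])
  define c where "c = prod_list (map \<epsilon> v) / sqrt l ^ n * (\<epsilon> i / sqrt l)"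
  have "strat_sum (aff_path B a l \<epsilon>) (aff_sig X a l \<epsilon> n s) (P k) v i w
      = c * strat_sum B (X n (a + l * s)) (Q k) v i w" for k w
  proof -
    have alg: "(c1 * x + c1 * y) / 2 * (c2 * (p - q) - c2 * (r - q)) = c1 * c2 * ((x + y) / 2 * (p - r))"
      for c1 c2 x y p q r :: real by (simp add: field_simps)
    have "length (Q k) = length (P k)" by (simp add: Q_def)
    moreover have "Q k ! j = a + l * P k ! j" "Q k ! Suc j = a + l * P k ! Suc j" if "j < length (P k) - 1" for j
      using Qnth that by auto
    ultimately show ?thesis
      unfolding strat_sum_def sum_distrib_left
      by (intro sum.cong) (simp_all only: aff_path_def aff_sig_def c_def alg lessThan_iff)
  qed
  moreover have "aff_sig X a l \<epsilon> (Suc n) s t w (v @ [i]) = c * X (Suc n) (a + l * s) (a + l * t) w (v @ [i])" for w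
    by (simp add: aff_sig_def c_def)
  moreover have "conv_in_prob M (\<lambda>k. strat_sum B (X n (a + l * s)) (Q k) v i)
      (\<lambda>w. X (Suc n) (a + l * s) (a + l * t) w (v @ [i]))"
    using st v l a by (intro X_conv PQ meshQ) auto
  ultimately show "conv_in_prob M (\<lambda>k. strat_sum (aff_path B a l \<epsilon>) (aff_sig X a l \<epsilon> n s) (P k) v i)
      (\<lambda>w. aff_sig X a l \<epsilon> (Suc n) s t w (v @ [i]))"
    using conv_in_prob_cmult[of M "\<lambda>k. strat_sum B (X n (a + l * s)) (Q k) v i" _ c] by presburger
qed

lemma (in brownian_signature) brownian_signature_aff:
  assumes "0 \<le> a" "0 < l" "\<And>i. \<epsilon> i \<in> {1, -1}"
  shows "brownian_signature M d (aff_path B a l \<epsilon>) (aff_sig X a l \<epsilon>)"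
  by (intro brownian_signature.intro brownian_signature_axioms.intro prob_space_axioms d_pos
      std_brownian_aff_path[OF assms] strat_signature_aff_sig[OF assms(1,2)])

subsection \<open>The law of the path\<close>

abbreviation path_space :: "nat \<Rightarrow> real \<Rightarrow> (real \<times> nat \<Rightarrow> real) measure" where
  "path_space d T \<equiv> PiM ({0..T} \<times> {..<d}) (\<lambda>_. borel)"

text \<open>The value at 0 is subtracted because it vanishes only almost surely; path values are
  then sums of increments for every \<open>w\<close>.\<close>

definition path_of :: "nat \<Rightarrow> (real \<Rightarrow> 'a \<Rightarrow> nat \<Rightarrow> real) \<Rightarrow> real \<Rightarrow> 'a \<Rightarrow> real \<times> nat \<Rightarrow> real" where
  "path_of d B T w = restrict (\<lambda>(r, i). B r w i - B 0 w i) ({0..T} \<times> {..<d})"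

definition incs :: "nat \<Rightarrow> (real \<Rightarrow> 'a \<Rightarrow> nat \<Rightarrow> real) \<Rightarrow> (nat \<Rightarrow> real) \<Rightarrow> nat \<Rightarrow> 'a \<Rightarrow> nat \<times> nat \<Rightarrow> real" where
  "incs d B tt k w = restrict (\<lambda>(j, i). B (tt (Suc j)) w i - B (tt j) w i) ({..<k} \<times> {..<d})"

lemma finite_times_grid:
  assumes "finite K" "K \<noteq> {}"
  obtains k and tt :: "nat \<Rightarrow> real" where "tt 0 = Min K" "\<And>j. j < k \<Longrightarrow> tt j < tt (Suc j)" "K = tt ` {..k}"
proof -
  let ?xs = "sorted_list_of_set K"
  have l: "0 < length ?xs" using assms by (simp add: card_gt_0_iff)
  have K: "K = (!) ?xs ` {..length ?xs - 1}"
  proof -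
    have "K = set ?xs" using assms by simp
    also have "\<dots> = (!) ?xs ` {..<length ?xs}" by (auto simp: set_conv_nth)
    also have "{..<length ?xs} = {..length ?xs - 1}" using l by auto
    finally show ?thesis .
  qed
  have "?xs ! 0 = Min K" using assms l by (metis hd_conv_nth length_greater_0_conv sorted_list_of_set_nonempty list.sel(1))
  moreover have "?xs ! j < ?xs ! Suc j" if "j < length ?xs - 1" for j
    using that strict_sorted_list_of_set[of K] sorted_wrt_nth_less[of "(<)" ?xs j "Suc j"] by auto
  ultimately show ?thesis using that[of "(!) ?xs" "length ?xs - 1"] K by auto
qed

text \<open>The set \<open>G\<close> does not depend on the process, so a cylinder event has the same probability
  for all Brownian motions.\<close>

lemma cylinder_as_increment_event:
  assumes J: "finite J" "J \<subseteq> {0..T} \<times> {..<d}" and E: "\<And>p. p \<in> J \<Longrightarrow> E p \<in> sets borel"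
    and tt: "tt 0 = 0" "fst ` J \<subseteq> tt ` {..m}"
  obtains G where "G \<in> sets (PiM ({..<m} \<times> {..<d}) (\<lambda>_. borel :: real measure))"
    "\<And>B w. path_of d B T w \<in> prod_emb ({0..T} \<times> {..<d}) (\<lambda>_. borel) J (Pi\<^sub>E J E) \<longleftrightarrow> incs d B tt m w \<in> G"
proof -
  let ?S = "{..<m} \<times> {..<d}"
  let ?N = "PiM ?S (\<lambda>_. borel :: real measure)"
  have "\<forall>r\<in>fst ` J. \<exists>j\<le>m. tt j = r"
  proof
    fix r assume "r \<in> fst ` J"
    then have "r \<in> tt ` {..m}" using tt(2) by (rule rev_subsetD)
    then show "\<exists>j\<le>m. tt j = r" by auto
  qed
  from bchoice[OF this] obtain l where l: "\<And>r. r \<in> fst ` J \<Longrightarrow> l r \<le> m \<and> tt (l r) = r" by blast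
  \<comment> \<open>The value at time \<open>r\<close> is the sum of the first \<open>l r\<close>
    increments, since the grid starts at 0 and the path is measured from its value there.\<close>
  define G where "G = space ?N \<inter> (\<Inter>p\<in>J. (\<lambda>y. \<Sum>j<l (fst p). y (j, snd p)) -` E p \<inter> space ?N)"
  have sumM: "(\<lambda>y. \<Sum>j<l (fst p). y (j, snd p)) \<in> borel_measurable ?N" if "p \<in> J" for p
  proof (rule borel_measurable_sum)
    fix j assume "j \<in> {..<l (fst p)}"
    then have "(j, snd p) \<in> ?S" using l[of "fst p"] that J by (cases p) (fastforce simp: image_iff)
    then show "(\<lambda>y. y (j, snd p)) \<in> borel_measurable ?N"
      using measurable_component_singleton[of "(j, snd p)" ?S "\<lambda>_. borel"] by simp
  qed
  have cyl: "(\<lambda>y. \<Sum>j<l (fst p). y (j, snd p)) -` E p \<inter> space ?N \<in> sets ?N" if "p \<in> J" for p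
    by (rule measurable_sets[OF sumM[OF that] E[OF that]])
  have GM: "G \<in> sets ?N"
  proof (cases "J = {}")
    case False
    show ?thesis unfolding G_def by (intro sets.Int sets.top sets.finite_INT[OF J(1) False] cyl)
  qed (simp add: G_def)
  have "path_of d B T w \<in> prod_emb ({0..T} \<times> {..<d}) (\<lambda>_. borel) J (Pi\<^sub>E J E) \<longleftrightarrow> incs d B tt m w \<in> G" for B :: "real \<Rightarrow> 'a \<Rightarrow> nat \<Rightarrow> real" and w
  proof -
    have val: "path_of d B T w p = (\<Sum>j<l (fst p). incs d B tt m w (j, snd p))" if "p \<in> J" for p
    proof -
      obtain r i where p: "p = (r, i)" by (cases p)
      have ri: "r \<in> {0..T}" "i < d" and r: "l r \<le> m" "tt (l r) = r"
        using subsetD[OF J(2) that] l[OF imageI[OF that, of fst]] p by auto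
      have "(\<Sum>j<l r. incs d B tt m w (j, i)) = (\<Sum>j<l r. B (tt (Suc j)) w i - B (tt j) w i)"
        using r ri by (intro sum.cong) (auto simp: incs_def)
      also have "\<dots> = B r w i - B 0 w i"
        using sum_lessThan_telescope[of "\<lambda>j. B (tt j) w i" "l r"] r tt by simp
      finally show ?thesis using ri p by (simp add: path_of_def)
    qed
    have "path_of d B T w \<in> prod_emb ({0..T} \<times> {..<d}) (\<lambda>_. borel) J (Pi\<^sub>E J E) \<longleftrightarrow> (\<forall>p\<in>J. path_of d B T w p \<in> E p)"
      using J(2) by (auto simp: prod_emb_def path_of_def space_PiM PiE_iff)
    also have "\<dots> \<longleftrightarrow> incs d B tt m w \<in> G"
      using val by (auto simp: G_def space_PiM incs_def)
    finally show ?thesis .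
  qed
  with GM that show ?thesis by blast
qed

context brownian_signature
begin

lemma path_of_measurable [measurable]: "path_of d B T \<in> measurable M (path_space d T)"
  unfolding path_of_def 
proof (rule measurable_restrict)
  fix p :: "real \<times> nat" assume "p \<in> {0..T} \<times> {..<d}"
  then show "(\<lambda>w. case p of (r, i) \<Rightarrow> B r w i - B 0 w i) \<in> borel_measurable M"
    by (cases p) (simp add: borel_measurable_diff B_measurable)
qed

lemma
  assumes tt: "0 \<le> tt 0" "\<And>j. j < k \<Longrightarrow> tt j < tt (Suc j)"
  shows indep_increments: "indep_vars (\<lambda>_. borel) (\<lambda>(j, i) w. B (tt (Suc j)) w i - B (tt j) w i) ({..<k} \<times> {..<d})"
    and distributed_increment: "\<And>j i. j < k \<Longrightarrow> i < d \<Longrightarrow> distributed M lborel (\<lambda>w. B (tt (Suc j)) w i - B (tt j) w i)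
       (normal_density 0 (sqrt (tt (Suc j) - tt j)))"
proof -
  note * = brownian[unfolded std_brownian_def, THEN conjunct2, THEN conjunct2, THEN conjunct2, THEN conjunct2,
      THEN spec[of _ k], THEN spec[of _ tt]]
  show "indep_vars (\<lambda>_. borel) (\<lambda>(j, i) w. B (tt (Suc j)) w i - B (tt j) w i) ({..<k} \<times> {..<d})"
    using * tt by blast
  show "distributed M lborel (\<lambda>w. B (tt (Suc j)) w i - B (tt j) w i)
       (normal_density 0 (sqrt (tt (Suc j) - tt j)))" if "j < k" "i < d" for j i
    using * tt that by blast
qed

text \<open>Independence and the normal marginals identify the joint law with a product measure that
  depends on the grid alone. This is the source of uniqueness of the path law.\<close>

lemma increments_law:
  assumes tt: "0 \<le> tt 0" "\<And>j. j < k \<Longrightarrow> tt j < tt (Suc j)" and k: "0 < k"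
  shows "incs d B tt k \<in> measurable M (PiM ({..<k} \<times> {..<d}) (\<lambda>_. borel))"
    and "distr M (PiM ({..<k} \<times> {..<d}) (\<lambda>_. borel)) (incs d B tt k) =
      PiM ({..<k} \<times> {..<d}) (\<lambda>(j, i). density lborel (normal_density 0 (sqrt (tt (Suc j) - tt j))))"
proof -
  let ?S = "{..<k} \<times> {..<d}"
  let ?D = "\<lambda>(j, i) w. B (tt (Suc j)) w i - B (tt j) w i"
  have rv: "?D p \<in> borel_measurable M" if "p \<in> ?S" for p
    using distributed_measurable[OF distributed_increment[OF tt, of k]] that by (cases p) auto
  have eq: "incs d B tt k = (\<lambda>w. \<lambda>p\<in>?S. ?D p w)"
    by (simp add: incs_def fun_eq_iff case_prod_unfold restrict_def)
  show "incs d B tt k \<in> measurable M (PiM ({..<k} \<times> {..<d}) (\<lambda>_. borel))"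
    unfolding eq by (rule measurable_restrict) (rule rv)
  have "distr M (PiM ?S (\<lambda>_. borel)) (incs d B tt k) = PiM ?S (\<lambda>p. distr M borel (?D p))"
    unfolding eq using indep_vars_iff_distr_eq_PiM'[of ?S ?D "\<lambda>_. borel"] rv indep_increments[OF tt, of k] k d_pos
    by auto
  also have "\<dots> = PiM ?S (\<lambda>(j, i). density lborel (normal_density 0 (sqrt (tt (Suc j) - tt j))))"
  proof (rule PiM_cong)
    fix p assume p: "p \<in> ?S"
    obtain j i where ji: "p = (j, i)" by (cases p)
    have "distr M borel (?D p) = distr M lborel (?D p)"
      by (rule distr_cong) auto
    also have "\<dots> = density lborel (normal_density 0 (sqrt (tt (Suc j) - tt j)))"
      using distributed_distr_eq_density[OF distributed_increment[OF tt, of k j i]] p ji by auto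
    finally show "distr M borel (?D p) = (case p of (j, i) \<Rightarrow> density lborel (normal_density 0 (sqrt (tt (Suc j) - tt j))))"
      using ji by simp
  qed simp
  finally show "distr M (PiM ({..<k} \<times> {..<d}) (\<lambda>_. borel)) (incs d B tt k) =
      PiM ({..<k} \<times> {..<d}) (\<lambda>(j, i). density lborel (normal_density 0 (sqrt (tt (Suc j) - tt j))))" .
qed

end

text \<open>Two finite measures on the product space agree once they agree on cylinders, and the
  probability of a cylinder is a Gaussian integral over the increments of a grid through its
  times.\<close>

lemma brownian_path_law_unique:
  fixes M M' :: "'a measure"
  assumes "brownian_signature M d B X" "brownian_signature M' d B' X'"
  shows "distr M (path_space d T) (path_of d B T) = distr M' (path_space d T) (path_of d B' T)"
proof -
  interpret b: brownian_signature M d B X by fact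
  interpret b': brownian_signature M' d B' X' by fact
  show ?thesis
  proof (rule measure_eqI_PiM_infinite)
    fix J E
    assume J: "finite J" "J \<subseteq> {0..T} \<times> {..<d}" and E: "\<And>p. p \<in> J \<Longrightarrow> E p \<in> sets (borel :: real measure)"
    \<comment> \<open>The point 0 makes the grid start there; the point 1 guarantees at least one
      increment even if \<open>J\<close> mentions no positive time.\<close>
    define K where "K = {0, 1} \<union> fst ` J"
    have K: "finite K" "K \<noteq> {}" "Min K = 0"
    proof -
      show "Min K = 0" using J by (intro Min_eqI) (auto simp: K_def)
    qed (use J in \<open>auto simp: K_def\<close>)
    obtain k and tt :: "nat \<Rightarrow> real" where tt: "tt 0 = 0" "\<And>j. j < k \<Longrightarrow> tt j < tt (Suc j)" "K = tt ` {..k}"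
      using finite_times_grid[OF K(1,2)] K(3) by metis
    have k: "0 < k"
    proof (rule ccontr)
      assume "\<not> 0 < k"
      then have "K = {0}" using tt by auto
      then show False by (auto simp: K_def)
    qed
    let ?A = "prod_emb ({0..T} \<times> {..<d}) (\<lambda>_. borel) J (Pi\<^sub>E J E)"
    have A: "?A \<in> sets (path_space d T)"
      by (rule sets_PiM_I) (use J E in auto)
    obtain G where G: "G \<in> sets (PiM ({..<k} \<times> {..<d}) (\<lambda>_. borel :: real measure))"
      and GB: "\<And>(B :: real \<Rightarrow> 'a \<Rightarrow> nat \<Rightarrow> real) w. path_of d B T w \<in> ?A \<longleftrightarrow> incs d B tt k w \<in> G"
    proof (rule cylinder_as_increment_event[of J T d E tt k])
      show "fst ` J \<subseteq> tt ` {..k}" unfolding tt(3)[symmetric] K_def by blast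
    qed (use J E tt(1) in auto)
    have law: "emeasure (distr N (path_space d T) (path_of d C T)) ?A
        = emeasure (PiM ({..<k} \<times> {..<d}) (\<lambda>(j, i). density lborel (normal_density 0 (sqrt (tt (Suc j) - tt j))))) G"
      if "brownian_signature N d C Y" for N :: "'a measure" and C Y
    proof -
      interpret c: brownian_signature N d C Y by fact
      have inc: "incs d C tt k \<in> measurable N (PiM ({..<k} \<times> {..<d}) (\<lambda>_. borel))"
        and dst: "distr N (PiM ({..<k} \<times> {..<d}) (\<lambda>_. borel)) (incs d C tt k) =
          PiM ({..<k} \<times> {..<d}) (\<lambda>(j, i). density lborel (normal_density 0 (sqrt (tt (Suc j) - tt j))))"
        using c.increments_law[of tt k] tt k by auto
      have "emeasure (distr N (path_space d T) (path_of d C T)) ?A = emeasure N (path_of d C T -` ?A \<inter> space N)"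
        by (rule emeasure_distr[OF c.path_of_measurable A])
      also have "path_of d C T -` ?A \<inter> space N = incs d C tt k -` G \<inter> space N"
        using GB by auto
      also have "emeasure N \<dots> = emeasure (distr N (PiM ({..<k} \<times> {..<d}) (\<lambda>_. borel)) (incs d C tt k)) G"
        by (rule emeasure_distr[OF inc G, symmetric])
      finally show ?thesis unfolding dst .
    qed
    show "emeasure (distr M (path_space d T) (path_of d B T)) ?A = emeasure (distr M' (path_space d T) (path_of d B' T)) ?A"
      using law[OF assms(1)] law[OF assms(2)] by simp
  next
    show "finite_measure (distr M (path_space d T) (path_of d B T))"
      by (rule prob_space.finite_measure[OF b.prob_space_distr[OF b.path_of_measurable]])
  qed simp_all
qed

subsection \<open>Independence of past and future\<close>

text \<open>Cylinders form an intersection-stable generator of the product sigma-algebra, so the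
  product rule extends from them to all events. Uncountably many times are thereby reduced to
  finitely many.\<close>

lemma (in prob_space) indep_var_PiM_cylinders:
  fixes X Y :: "'a \<Rightarrow> 'e \<Rightarrow> 'f"
  assumes X: "X \<in> measurable M (PiM I P)" and Y: "Y \<in> measurable M (PiM J Q)"
    and indep: "\<And>A C. A \<in> prod_algebra I P \<Longrightarrow> C \<in> prod_algebra J Q \<Longrightarrow>
      prob ((X -` A \<inter> space M) \<inter> (Y -` C \<inter> space M)) = prob (X -` A \<inter> space M) * prob (Y -` C \<inter> space M)"
  shows "indep_var (PiM I P) X (PiM J Q) Y"
proof -
  have gen: "sigma_sets (space M) {Z -` A \<inter> space M |A. A \<in> sets (PiM L R)}
      = sigma_sets (space M) {Z -` A \<inter> space M |A. A \<in> prod_algebra L R}"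
    if Z: "Z \<in> measurable M (PiM L R)" for Z :: "'a \<Rightarrow> 'e \<Rightarrow> 'f" and L R
  proof -
    have "Z \<in> space M \<rightarrow> (\<Pi>\<^sub>E i\<in>L. space (R i))"
      using measurable_space[OF Z] by (auto simp: space_PiM)
    from sigma_sets_vimage_commute[OF this, of "prod_algebra L R"]
    show ?thesis unfolding sets_PiM
      by (subst sigma_sets_sigma_sets_eq[symmetric, of "{Z -` A \<inter> space M |A. A \<in> prod_algebra L R}"]) auto
  qed
  have stable: "Int_stable {Z -` A \<inter> space M |A. A \<in> prod_algebra L R}" for Z :: "'a \<Rightarrow> 'e \<Rightarrow> 'f" and L R
  proof (rule Int_stableI, safe)
    fix A C assume "A \<in> prod_algebra L R" "C \<in> prod_algebra L R"
    then have "A \<inter> C \<in> prod_algebra L R" using Int_stable_prod_algebra[of L R] by (auto simp: Int_stable_def)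
    then show "\<exists>D. Z -` A \<inter> space M \<inter> (Z -` C \<inter> space M) = Z -` D \<inter> space M \<and> D \<in> prod_algebra L R"
      by (intro exI[of _ "A \<inter> C"]) auto
  qed
  have "indep_set {X -` A \<inter> space M |A. A \<in> prod_algebra I P} {Y -` A \<inter> space M |A. A \<in> prod_algebra J Q}"
    unfolding indep_sets2_eq
  proof (intro conjI ballI)
    show "{X -` A \<inter> space M |A. A \<in> prod_algebra I P} \<subseteq> events"
      using measurable_sets[OF X] sigma_sets.Basic[of _ "prod_algebra I P"] by (auto simp: sets_PiM)
    show "{Y -` A \<inter> space M |A. A \<in> prod_algebra J Q} \<subseteq> events"
      using measurable_sets[OF Y] sigma_sets.Basic[of _ "prod_algebra J Q"] by (auto simp: sets_PiM)
  qed (use indep in blast)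
  from indep_set_sigma_sets[OF this] have "indep_set
      (sigma_sets (space M) {X -` A \<inter> space M |A. A \<in> prod_algebra I P})
      (sigma_sets (space M) {Y -` A \<inter> space M |A. A \<in> prod_algebra J Q})"
    using stable by blast
  then show ?thesis
    unfolding indep_var_eq gen[OF X] gen[OF Y] using X Y by blast
qed

abbreviation shift_path :: "(real \<Rightarrow> 'a \<Rightarrow> nat \<Rightarrow> real) \<Rightarrow> real \<Rightarrow> real \<Rightarrow> 'a \<Rightarrow> nat \<Rightarrow> real" where
  "shift_path B a \<equiv> aff_path B a 1 (\<lambda>_. 1)"

abbreviation shift_sig :: "(nat \<Rightarrow> real \<Rightarrow> real \<Rightarrow> 'a \<Rightarrow> nat list \<Rightarrow> real) \<Rightarrow> real
    \<Rightarrow> nat \<Rightarrow> real \<Rightarrow> real \<Rightarrow> 'a \<Rightarrow> nat list \<Rightarrow> real" where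
  "shift_sig X a \<equiv> aff_sig X a 1 (\<lambda>_. 1)"

lemma prod_list_map_one [simp]: "prod_list (map (\<lambda>_. 1) v) = (1::real)"
  by (induction v) auto

lemma shift_sig_eq [simp]: "shift_sig X a n s t w v = X n (a + s) (a + t) w v"
  by (simp add: aff_sig_def)

lemma (in brownian_signature) shift: "0 \<le> a \<Longrightarrow> brownian_signature M d (shift_path B a) (shift_sig X a)"
  by (rule brownian_signature_aff) auto

text \<open>A past and a future cylinder involve finitely many times. Once \<open>a\<close> itself
  is put into the grid, every increment lies on one side of \<open>a\<close>, and the two events
  depend on disjoint blocks of independent increments.\<close>

lemma (in brownian_signature) past_future_indep:
  assumes a: "0 \<le> a"
  shows "indep_var (path_space d a) (path_of d B a) (path_space d T) (path_of d (shift_path B a) T)"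
proof (rule indep_var_PiM_cylinders)
  interpret s: brownian_signature M d "shift_path B a" "shift_sig X a" by (rule shift[OF a])
  show "path_of d B a \<in> measurable M (path_space d a)" by measurable
  show "path_of d (shift_path B a) T \<in> measurable M (path_space d T)" by measurable
  fix A C
  assume A: "A \<in> prod_algebra ({0..a} \<times> {..<d}) (\<lambda>_. borel :: real measure)"
    and C: "C \<in> prod_algebra ({0..T} \<times> {..<d}) (\<lambda>_. borel :: real measure)"
  obtain J1 E1 where A_eq: "A = prod_emb ({0..a} \<times> {..<d}) (\<lambda>_. borel) J1 (Pi\<^sub>E J1 E1)"
    and J1: "finite J1" "J1 \<subseteq> {0..a} \<times> {..<d}" and E1: "\<And>p. p \<in> J1 \<Longrightarrow> E1 p \<in> sets (borel :: real measure)"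
    using prod_algebraE[OF A] by metis
  obtain J2 E2 where C_eq: "C = prod_emb ({0..T} \<times> {..<d}) (\<lambda>_. borel) J2 (Pi\<^sub>E J2 E2)"
    and J2: "finite J2" "J2 \<subseteq> {0..T} \<times> {..<d}" and E2: "\<And>p. p \<in> J2 \<Longrightarrow> E2 p \<in> sets (borel :: real measure)"
    using prod_algebraE[OF C] by metis
  define K1 where "K1 = {0, a} \<union> fst ` J1"
  define K2 where "K2 = insert a ((+) a ` fst ` J2)"
  have K1: "finite K1" "K1 \<subseteq> {0..a}" using J1 a by (auto simp: K1_def)
  have K2: "finite K2" "K2 \<subseteq> {a..}" using J2 by (auto simp: K2_def)
  have Min: "Min (K1 \<union> K2) = 0"
    using K1 K2 a by (intro Min_eqI) (auto simp: K1_def)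
  have "K1 \<union> K2 \<noteq> {}" "finite (K1 \<union> K2)" using K1 K2 by (auto simp: K1_def)
  then obtain k and tt :: "nat \<Rightarrow> real" where tt: "tt 0 = 0" "\<And>j. j < k \<Longrightarrow> tt j < tt (Suc j)"
    and ttK: "K1 \<union> K2 = tt ` {..k}"
    using finite_times_grid[of "K1 \<union> K2"] Min by metis
  have mono: "tt i < tt j" if "i < j" "j \<le> k" for i j
    using that
  proof (induction j)
    case (Suc j)
    then show ?case using tt(2)[of j] by (cases "i = j") auto
  qed simp
  have "a \<in> K1 \<union> K2" by (simp add: K1_def)
  then obtain m where m: "m \<le> k" "tt m = a" unfolding ttK by auto
  define S where "S = {..<k} \<times> {..<d}"
  define S1 where "S1 = {..<m} \<times> {..<d}"
  define S2 where "S2 = {m..<k} \<times> {..<d}"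
  define tt2 where "tt2 j = tt (m + j) - a" for j
  have f1: "fst ` J1 \<subseteq> tt ` {..m}"
  proof
    fix r assume "r \<in> fst ` J1"
    then have r: "r \<in> K1" by (simp add: K1_def)
    then obtain j where j: "j \<le> k" "r = tt j" using ttK by auto
    have "j \<le> m" using mono[of m j] j m K1(2) r by force
    then show "r \<in> tt ` {..m}" using j by auto
  qed
  have f2: "fst ` J2 \<subseteq> tt2 ` {..k - m}"
  proof
    fix r assume "r \<in> fst ` J2"
    then have r: "a + r \<in> K2" by (simp add: K2_def)
    then obtain j where j: "j \<le> k" "a + r = tt j" using ttK by auto
    have "m \<le> j" using mono[of j m] j m K2(2) r by force
    then show "r \<in> tt2 ` {..k - m}" using j by (auto simp: tt2_def intro!: image_eqI[of _ _ "j - m"])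
  qed
  have tt2_0: "tt2 0 = 0" using m by (simp add: tt2_def)
  obtain G1 where G1: "G1 \<in> sets (PiM S1 (\<lambda>_. borel :: real measure))"
    and G1_iff: "\<And>(B :: real \<Rightarrow> 'a \<Rightarrow> nat \<Rightarrow> real) w. path_of d B a w \<in> A \<longleftrightarrow> incs d B tt m w \<in> G1"
    unfolding A_eq S1_def by (rule cylinder_as_increment_event[of J1 a d E1 tt m]) (use J1 E1 tt(1) f1 in auto)
  obtain G2 where G2: "G2 \<in> sets (PiM ({..<k - m} \<times> {..<d}) (\<lambda>_. borel :: real measure))"
    and G2_iff: "\<And>(B :: real \<Rightarrow> 'a \<Rightarrow> nat \<Rightarrow> real) w. path_of d B T w \<in> C \<longleftrightarrow> incs d B tt2 (k - m) w \<in> G2"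
    unfolding C_eq by (rule cylinder_as_increment_event[of J2 T d E2 tt2 "k - m"]) (use J2 E2 tt2_0 f2 in auto)
  let ?D = "\<lambda>(j, i) w. B (tt (Suc j)) w i - B (tt j) w i"
  have "indep_vars (\<lambda>_. borel) ?D S"
    using indep_increments[of tt k] tt by (simp add: S_def)
  then have ind: "indep_var (PiM S1 (\<lambda>_. borel)) (\<lambda>w. restrict (\<lambda>p. ?D p w) S1)
      (PiM S2 (\<lambda>_. borel)) (\<lambda>w. restrict (\<lambda>p. ?D p w) S2)"
    by (rule indep_var_restrict) (use m in \<open>auto simp: S_def S1_def S2_def\<close>)
  \<comment> \<open>Renumbers the increments from index \<open>m\<close> on, so that they become
    those of the shifted process on its own grid \<open>tt2\<close>.\<close>
  define R where "R y = restrict (\<lambda>(j, i). y (m + j, i)) ({..<k - m} \<times> {..<d})" for y :: "nat \<times> nat \<Rightarrow> real"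
  have R: "R \<in> measurable (PiM S2 (\<lambda>_. borel)) (PiM ({..<k - m} \<times> {..<d}) (\<lambda>_. borel))"
    unfolding R_def
  proof (rule measurable_restrict)
    fix p :: "nat \<times> nat" assume "p \<in> {..<k - m} \<times> {..<d}"
    then obtain j i where "p = (j, i)" "(m + j, i) \<in> S2" by (cases p) (auto simp: S2_def)
    then show "(\<lambda>y. case p of (j, i) \<Rightarrow> y (m + j, i)) \<in> borel_measurable (PiM S2 (\<lambda>_. borel))"
      using measurable_component_singleton[of "(m + j, i)" S2 "\<lambda>_. borel"] by simp
  qed
  have e1: "(\<lambda>w. restrict (\<lambda>p. ?D p w) S1) w = incs d B tt m w" for w
    by (simp add: incs_def S1_def case_prod_unfold)
  have e2: "R (restrict (\<lambda>p. ?D p w) S2) = incs d (shift_path B a) tt2 (k - m) w" for w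
    using m by (auto simp: incs_def R_def S2_def restrict_def fun_eq_iff aff_path_def tt2_def)
  have ind2: "indep_var (PiM S1 (\<lambda>_. borel)) (incs d B tt m)
      (PiM ({..<k - m} \<times> {..<d}) (\<lambda>_. borel)) (incs d (shift_path B a) tt2 (k - m))"
    using indep_var_compose[OF ind measurable_ident R] by (simp add: comp_def e1 e2)
  have "prob ((\<lambda>w. (incs d B tt m w, incs d (shift_path B a) tt2 (k - m) w)) -` (G1 \<times> G2) \<inter> space M)
    = prob (incs d B tt m -` G1 \<inter> space M) * prob (incs d (shift_path B a) tt2 (k - m) -` G2 \<inter> space M)"
    by (rule indep_varD[OF ind2 G1 G2])
  moreover have "(\<lambda>w. (incs d B tt m w, incs d (shift_path B a) tt2 (k - m) w)) -` (G1 \<times> G2) \<inter> space M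
      = path_of d B a -` A \<inter> space M \<inter> (path_of d (shift_path B a) T -` C \<inter> space M)"
    using G1_iff G2_iff by auto
  moreover have "incs d B tt m -` G1 \<inter> space M = path_of d B a -` A \<inter> space M"
    using G1_iff by auto
  moreover have "incs d (shift_path B a) tt2 (k - m) -` G2 \<inter> space M = path_of d (shift_path B a) T -` C \<inter> space M"
    using G2_iff by auto
  ultimately show "prob (path_of d B a -` A \<inter> space M \<inter> (path_of d (shift_path B a) T -` C \<inter> space M))
      = prob (path_of d B a -` A \<inter> space M) * prob (path_of d (shift_path B a) T -` C \<inter> space M)"
    by simp
qed

subsection \<open>The signature as a functional of the path\<close>

text \<open>The same functional \<open>\<Phi>\<close> serves both systems: the subsequence along which the Stratonovich sums
  converge almost surely can be refined to work for both at once.\<close>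

lemma signature_functional:
  fixes M M' :: "'a measure"
  assumes "brownian_signature M d B X" "brownian_signature M' d B' X'" and "0 \<le> r" "r \<le> T"
  shows "\<exists>\<Phi>\<in>borel_measurable (path_space d T).
    (AE w in M. X (length v) 0 r w v = \<Phi> (path_of d B T w)) \<and>
    (AE w in M'. X' (length v) 0 r w v = \<Phi> (path_of d B' T w))"
proof -
  interpret b: brownian_signature M d B X by fact
  interpret b': brownian_signature M' d B' X' by fact
  show ?thesis
  proof (cases "set v \<subseteq> {..<d}")
    case False
    then show ?thesis by (intro bexI[of _ "\<lambda>_. 0"]) (auto simp: b.X_bad_letter b'.X_bad_letter)
  next
    case True
    then show ?thesis using assms(3,4)
    proof (induction v arbitrary: r rule: rev_induct)
      case Nil
      then show ?case by (intro bexI[of _ "\<lambda>_. 1"]) (auto simp: b.X_zero b'.X_zero)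
    next
      case (snoc i v)
      show ?case
      proof (cases "r = 0")
        case True
        then show ?thesis by (intro bexI[of _ "\<lambda>_. 0"]) (auto simp: b.X_refl b'.X_refl)
      next
        case False
        with snoc.prems have r: "0 < r" by simp
        define n where "n = length v"
        have v: "set v \<subseteq> {..<d}" "i < d" using snoc.prems by auto
        have "\<forall>q\<in>{0..r}. \<exists>\<Phi>. \<Phi> \<in> borel_measurable (path_space d T) \<and>
            (AE w in M. X n 0 q w v = \<Phi> (path_of d B T w)) \<and> (AE w in M'. X' n 0 q w v = \<Phi> (path_of d B' T w))"
        proof
          fix q assume "q \<in> {0..r}"
          then show "\<exists>\<Phi>. \<Phi> \<in> borel_measurable (path_space d T) \<and>
            (AE w in M. X n 0 q w v = \<Phi> (path_of d B T w)) \<and> (AE w in M'. X' n 0 q w v = \<Phi> (path_of d B' T w))"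
            using snoc.IH[OF v(1), of q] snoc.prems(3) unfolding n_def by auto
        qed
        from bchoice[OF this] obtain \<Psi> where \<Psi>: "\<forall>q\<in>{0..r}. \<Psi> q \<in> borel_measurable (path_space d T) \<and>
            (AE w in M. X n 0 q w v = \<Psi> q (path_of d B T w)) \<and> (AE w in M'. X' n 0 q w v = \<Psi> q (path_of d B' T w))"
          by blast
        define P where "P k = upart 0 r k" for k
        have P: "is_partition 0 r (P k)" for k unfolding P_def by (rule is_partition_upart[OF r])
        have meshP: "(\<lambda>k. mesh (P k)) \<longlonglongrightarrow> 0" unfolding P_def by (rule mesh_upart_tendsto[OF r])
        have Pin: "P k ! l \<in> {0..r}" if "l \<le> Suc k" for k l
          using nth_upart_bounds[of 0 r l k] r that by (auto simp: P_def)
        \<comment> \<open>The Stratonovich sum written on path space: the integrand is replaced by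
          the functionals \<open>\<Psi>\<close>, and the subtracted starting value cancels in the
          increments.\<close>
        define \<Sigma> where "\<Sigma> k y = (\<Sum>l<Suc k. (\<Psi> (P k ! l) y + \<Psi> (P k ! Suc l) y) / 2
            * (y (P k ! Suc l, i) - y (P k ! l, i)))" for k y
        have comp: "(\<lambda>y. y (q, i)) \<in> borel_measurable (path_space d T)" if "q \<in> {0..r}" for q
          using measurable_component_singleton[of "(q, i)" "{0..T} \<times> {..<d}" "\<lambda>_. borel"] that v snoc.prems by auto
        have \<Sigma>M: "\<Sigma> k \<in> borel_measurable (path_space d T)" for k
          unfolding \<Sigma>_def
        proof (rule borel_measurable_sum)
          fix l assume "l \<in> {..<Suc k}"
          then have "P k ! l \<in> {0..r}" "P k ! Suc l \<in> {0..r}" using Pin by auto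
          then show "(\<lambda>y. (\<Psi> (P k ! l) y + \<Psi> (P k ! Suc l) y) / 2 * (y (P k ! Suc l, i) - y (P k ! l, i)))
              \<in> borel_measurable (path_space d T)"
            using \<Psi> comp by (intro borel_measurable_times borel_measurable_divide borel_measurable_add borel_measurable_diff borel_measurable_const) auto
        qed
        have sums: "AE w in N. \<forall>k. strat_sum C (Y n 0) (P k) v i w = \<Sigma> k (path_of d C T w)"
          if "brownian_signature N d C Y" "\<forall>q\<in>{0..r}. AE w in N. Y n 0 q w v = \<Psi> q (path_of d C T w)"
          for N :: "'a measure" and C Y
        proof -
          have "AE w in N. \<forall>k. \<forall>l\<in>{..Suc k}. Y n 0 (P k ! l) w v = \<Psi> (P k ! l) (path_of d C T w)"
            using that(2) Pin by (intro AE_all_countable[THEN iffD2] allI AE_finite_all[THEN iffD2] ballI) auto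
          then show ?thesis
          proof eventually_elim
            case (elim w)
            show ?case
            proof
              fix k
              show "strat_sum C (Y n 0) (P k) v i w = \<Sigma> k (path_of d C T w)"
                unfolding strat_sum_def \<Sigma>_def
              proof (rule sum.cong)
                show "{..<length (P k) - 1} = {..<Suc k}" by (simp add: P_def)
                fix l assume "l \<in> {..<Suc k}"
                then have l: "l \<le> Suc k" "Suc l \<le> Suc k" by auto
                have "P k ! l \<in> {0..T}" "P k ! Suc l \<in> {0..T}"
                  using Pin[OF l(1)] Pin[OF l(2)] snoc.prems(3) by auto
                then show "(Y n 0 (P k ! l) w v + Y n 0 (P k ! Suc l) w v) / 2 * (C (P k ! Suc l) w i - C (P k ! l) w i) =
                  (\<Psi> (P k ! l) (path_of d C T w) + \<Psi> (P k ! Suc l) (path_of d C T w)) / 2 *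
                  (path_of d C T w (P k ! Suc l, i) - path_of d C T w (P k ! l, i))"
                  using elim l v by (simp add: path_of_def)
              qed
            qed
          qed
        qed
        have c: "conv_in_prob M (\<lambda>k. strat_sum B (X n 0) (P k) v i) (\<lambda>w. X (Suc n) 0 r w (v @ [i]))"
          using r v by (intro b.X_conv P meshP) (auto simp: n_def)
        have "\<exists>\<rho>. strict_mono (\<rho>::nat\<Rightarrow>nat) \<and> (AE w in M. (\<lambda>k. strat_sum B (X n 0) (P (\<rho> k)) v i w) \<longlonglongrightarrow> X (Suc n) 0 r w (v @ [i]))"
          by (rule b.conv_in_prob_AE_subseq[OF _ _ c]) (auto intro: b.strat_sum_measurable[OF _ P v(2)])
        then obtain \<rho> where \<rho>: "strict_mono (\<rho>::nat\<Rightarrow>nat)"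
          "AE w in M. (\<lambda>k. strat_sum B (X n 0) (P (\<rho> k)) v i w) \<longlonglongrightarrow> X (Suc n) 0 r w (v @ [i])" by blast
        have c': "conv_in_prob M' (\<lambda>k. strat_sum B' (X' n 0) (P (\<rho> k)) v i) (\<lambda>w. X' (Suc n) 0 r w (v @ [i]))"
          by (rule conv_in_prob_subseq[OF _ \<rho>(1)]) (use r v in \<open>intro b'.X_conv P meshP; auto simp: n_def\<close>)
        have "\<exists>\<kappa>. strict_mono (\<kappa>::nat\<Rightarrow>nat) \<and> (AE w in M'. (\<lambda>k. strat_sum B' (X' n 0) (P (\<rho> (\<kappa> k))) v i w) \<longlonglongrightarrow> X' (Suc n) 0 r w (v @ [i]))"
          by (rule b'.conv_in_prob_AE_subseq[OF _ _ c']) (auto intro: b'.strat_sum_measurable[OF _ P v(2)])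
        then obtain \<kappa> where \<kappa>: "strict_mono (\<kappa>::nat\<Rightarrow>nat)"
          "AE w in M'. (\<lambda>k. strat_sum B' (X' n 0) (P (\<rho> (\<kappa> k))) v i w) \<longlonglongrightarrow> X' (Suc n) 0 r w (v @ [i])" by blast
        \<comment> \<open>\<open>lim\<close> has a value also where the sums diverge, so this is a
          measurable function on the whole path space.\<close>
        define \<Phi> where "\<Phi> y = lim (\<lambda>k. \<Sigma> (\<rho> (\<kappa> k)) y)" for y
        show ?thesis
        proof (intro bexI[of _ \<Phi>] conjI)
          show "\<Phi> \<in> borel_measurable (path_space d T)"
            unfolding \<Phi>_def using \<Sigma>M by (intro borel_measurable_lim_metric)
          have "AE w in M. \<forall>k. strat_sum B (X n 0) (P k) v i w = \<Sigma> k (path_of d B T w)"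
            using \<Psi> by (intro sums[OF assms(1)]) blast
          with \<rho>(2) show "AE w in M. X (length (v @ [i])) 0 r w (v @ [i]) = \<Phi> (path_of d B T w)"
          proof eventually_elim
            case (elim w)
            have "(\<lambda>k. \<Sigma> (\<rho> k) (path_of d B T w)) \<longlonglongrightarrow> X (Suc n) 0 r w (v @ [i])"
              using elim by simp
            from LIMSEQ_subseq_LIMSEQ[OF this \<kappa>(1)] show ?case
              by (simp add: \<Phi>_def n_def limI comp_def)
          qed
          have "AE w in M'. \<forall>k. strat_sum B' (X' n 0) (P k) v i w = \<Sigma> k (path_of d B' T w)"
            using \<Psi> by (intro sums[OF assms(2)]) blast
          with \<kappa>(2) show "AE w in M'. X' (length (v @ [i])) 0 r w (v @ [i]) = \<Phi> (path_of d B' T w)"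
            by eventually_elim (simp add: \<Phi>_def n_def limI)
        qed
      qed
    qed
  qed
qed

abbreviation word_space :: "(nat list \<Rightarrow> real) measure" where
  "word_space \<equiv> PiM UNIV (\<lambda>_. borel)"

text \<open>All levels in one function on words. Nothing is lost, because level \<open>n\<close>
  vanishes on words of any other length; and there are only countably many words.\<close>

definition sig_coeffs :: "(nat \<Rightarrow> real \<Rightarrow> real \<Rightarrow> 'a \<Rightarrow> nat list \<Rightarrow> real) \<Rightarrow> real \<Rightarrow> real \<Rightarrow> 'a \<Rightarrow> nat list \<Rightarrow> real" where
  "sig_coeffs X s t w v = X (length v) s t w v"

lemma (in brownian_signature) sig_coeffs_measurable [measurable]: "sig_coeffs X s t \<in> measurable M word_space"
proof -
  have "(\<lambda>w. \<lambda>v\<in>UNIV. X (length v) s t w v) \<in> measurable M word_space"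
    by (rule measurable_restrict) measurable
  then show ?thesis by (simp add: sig_coeffs_def[abs_def] restrict_UNIV)
qed

lemma sig_coeffs_functional:
  fixes M M' :: "'a measure"
  assumes "brownian_signature M d B X" "brownian_signature M' d B' X'" and "0 \<le> r" "r \<le> T"
  shows "\<exists>\<Phi>\<in>measurable (path_space d T) word_space.
    (AE w in M. sig_coeffs X 0 r w = \<Phi> (path_of d B T w)) \<and> (AE w in M'. sig_coeffs X' 0 r w = \<Phi> (path_of d B' T w))"
proof -
  have "\<forall>v. \<exists>\<Phi>. \<Phi> \<in> borel_measurable (path_space d T) \<and>
    (AE w in M. X (length v) 0 r w v = \<Phi> (path_of d B T w)) \<and> (AE w in M'. X' (length v) 0 r w v = \<Phi> (path_of d B' T w))"
    using signature_functional[OF assms] by blast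
  from choice[OF this] obtain \<Phi> where \<Phi>: "\<And>v. \<Phi> v \<in> borel_measurable (path_space d T)"
    "\<And>v. AE w in M. X (length v) 0 r w v = \<Phi> v (path_of d B T w)"
    "\<And>v. AE w in M'. X' (length v) 0 r w v = \<Phi> v (path_of d B' T w)" by blast
  have "(\<lambda>y. \<lambda>v\<in>UNIV. \<Phi> v y) \<in> measurable (path_space d T) word_space"
    by (rule measurable_restrict) (rule \<Phi>(1))
  then have "(\<lambda>y v. \<Phi> v y) \<in> measurable (path_space d T) word_space" by (simp add: restrict_UNIV)
  moreover have "AE w in M. sig_coeffs X 0 r w = (\<lambda>v. \<Phi> v (path_of d B T w))"
    unfolding sig_coeffs_def fun_eq_iff using \<Phi>(2) by (simp add: AE_all_countable)
  moreover have "AE w in M'. sig_coeffs X' 0 r w = (\<lambda>v. \<Phi> v (path_of d B' T w))"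
    unfolding sig_coeffs_def fun_eq_iff using \<Phi>(3) by (simp add: AE_all_countable)
  ultimately show ?thesis by (intro bexI[of _ "\<lambda>y v. \<Phi> v y"] conjI)
qed

text \<open>Both laws are images of the common path law under one functional, which is why the
  functional had to be found for two systems simultaneously.\<close>

lemma sig_coeffs_law_unique:
  fixes M M' :: "'a measure"
  assumes "brownian_signature M d B X" "brownian_signature M' d B' X'" and "0 \<le> r"
  shows "distr M word_space (sig_coeffs X 0 r) = distr M' word_space (sig_coeffs X' 0 r)"
proof -
  interpret b: brownian_signature M d B X by fact
  interpret b': brownian_signature M' d B' X' by fact
  obtain \<Phi> where \<Phi>[measurable]: "\<Phi> \<in> measurable (path_space d r) word_space"
    and ae: "AE w in M. sig_coeffs X 0 r w = \<Phi> (path_of d B r w)" "AE w in M'. sig_coeffs X' 0 r w = \<Phi> (path_of d B' r w)"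
    using sig_coeffs_functional[OF assms order_refl] by blast
  have "distr M word_space (sig_coeffs X 0 r) = distr M word_space (\<lambda>w. \<Phi> (path_of d B r w))"
    by (rule distr_cong_AE[OF refl refl ae(1)]) measurable
  also have "\<dots> = distr (distr M (path_space d r) (path_of d B r)) word_space \<Phi>"
    by (subst distr_distr) (auto simp: comp_def)
  also have "\<dots> = distr (distr M' (path_space d r) (path_of d B' r)) word_space \<Phi>"
    by (simp add: brownian_path_law_unique[OF assms(1,2)])
  also have "\<dots> = distr M' word_space (\<lambda>w. \<Phi> (path_of d B' r w))"
    by (subst distr_distr) (auto simp: comp_def)
  also have "\<dots> = distr M' word_space (sig_coeffs X' 0 r)"
    by (rule distr_cong_AE[symmetric, OF refl refl ae(2)]) measurable
  finally show ?thesis .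
qed

subsection \<open>Random variables determined by the past\<close>

text \<open>Measurability with respect to the path up to \<open>T\<close>, in factorised form. The
  factorisation is required only almost surely, since the signature is a functional of the path only
  up to null sets.\<close>

definition determined :: "'a measure \<Rightarrow> nat \<Rightarrow> (real \<Rightarrow> 'a \<Rightarrow> nat \<Rightarrow> real) \<Rightarrow> real \<Rightarrow> ('a \<Rightarrow> real) \<Rightarrow> bool" where
  "determined M d B T f \<longleftrightarrow> f \<in> borel_measurable M \<and>
    (\<exists>\<Phi>\<in>borel_measurable (path_space d T). AE w in M. f w = \<Phi> (path_of d B T w))"

lemma determined_const: "determined M d B T (\<lambda>_. c)"
  unfolding determined_def by (intro conjI bexI[of _ "\<lambda>_. c"]) auto

lemma determined_binop:
  assumes "determined M d B T f" "determined M d B T g" "case_prod h \<in> borel_measurable (borel \<Otimes>\<^sub>M borel)"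
  shows "determined M d B T (\<lambda>w. h (f w) (g w))"
proof -
  obtain \<Phi> \<Psi> where [measurable]: "\<Phi> \<in> borel_measurable (path_space d T)" "\<Psi> \<in> borel_measurable (path_space d T)"
    and ae: "AE w in M. f w = \<Phi> (path_of d B T w)" "AE w in M. g w = \<Psi> (path_of d B T w)"
    using assms(1,2) unfolding determined_def by blast
  have [measurable]: "f \<in> borel_measurable M" "g \<in> borel_measurable M" "case_prod h \<in> borel_measurable (borel \<Otimes>\<^sub>M borel)"
    using assms by (simp_all add: determined_def)
  have "(\<lambda>y. case_prod h (\<Phi> y, \<Psi> y)) \<in> borel_measurable (path_space d T)" by measurable
  moreover have "(\<lambda>w. case_prod h (f w, g w)) \<in> borel_measurable M" by measurable
  moreover have "AE w in M. h (f w) (g w) = h (\<Phi> (path_of d B T w)) (\<Psi> (path_of d B T w))"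
    using ae by eventually_elim simp
  ultimately show ?thesis
    unfolding determined_def by (intro conjI bexI[of _ "\<lambda>y. h (\<Phi> y) (\<Psi> y)"]) auto
qed

lemma determined_add: "determined M d B T f \<Longrightarrow> determined M d B T g \<Longrightarrow> determined M d B T (\<lambda>w. f w + g w)"
  by (rule determined_binop) measurable

lemma determined_diff: "determined M d B T f \<Longrightarrow> determined M d B T g \<Longrightarrow> determined M d B T (\<lambda>w. f w - g w)"
  by (rule determined_binop) measurable

lemma determined_mult: "determined M d B T f \<Longrightarrow> determined M d B T g \<Longrightarrow> determined M d B T (\<lambda>w. f w * g w)"
  by (rule determined_binop) measurable

lemma determined_sum: "(\<And>j. j \<in> J \<Longrightarrow> determined M d B T (f j)) \<Longrightarrow> determined M d B T (\<lambda>w. \<Sum>j\<in>J. f j w)"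
  by (induction J rule: infinite_finite_induct) (auto intro: determined_const determined_add)

lemma determined_comp:
  assumes "determined M d C T f" "h \<in> borel_measurable borel"
  shows "determined M d C T (\<lambda>w. h (f w))"
  using determined_binop[OF assms(1) assms(1), of "\<lambda>x _. h x"] assms(2) by simp

lemma determined_cong_AE:
  assumes "determined M d C T f" "AE w in M. g w = f w" "g \<in> borel_measurable M"
  shows "determined M d C T g"
proof -
  obtain \<Phi> where \<Phi>: "\<Phi> \<in> borel_measurable (path_space d T)" "AE w in M. f w = \<Phi> (path_of d C T w)"
    using assms(1) unfolding determined_def by blast
  have "AE w in M. g w = \<Phi> (path_of d C T w)"
    using assms(2) \<Phi>(2) by eventually_elim simp
  with \<Phi>(1) assms(3) show ?thesis unfolding determined_def by blast
qed

context brownian_signature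
begin

lemma determined_path:
  assumes "0 \<le> r" "r \<le> T" "i < d"
  shows "determined M d B T (\<lambda>w. B r w i - B 0 w i)"
  unfolding determined_def
proof (intro conjI bexI[of _ "\<lambda>y. y (r, i)"])
  show "(\<lambda>w. B r w i - B 0 w i) \<in> borel_measurable M"
    using assms by (intro borel_measurable_diff B_measurable) auto
  show "(\<lambda>y. y (r, i)) \<in> borel_measurable (path_space d T)"
    using measurable_component_singleton[of "(r, i)" "{0..T} \<times> {..<d}" "\<lambda>_. borel"] assms by auto
  show "AE w in M. B r w i - B 0 w i = path_of d B T w (r, i)"
    using assms by (simp add: path_of_def)
qed

lemma determined_sig_coeffs:
  assumes "0 \<le> r" "r \<le> T" and [measurable]: "F \<in> borel_measurable word_space"
  shows "determined M d B T (\<lambda>w. F (sig_coeffs X 0 r w))"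
proof -
  obtain \<Phi> where [measurable]: "\<Phi> \<in> measurable (path_space d T) word_space"
    and ae: "AE w in M. sig_coeffs X 0 r w = \<Phi> (path_of d B T w)"
    using sig_coeffs_functional[OF brownian_signature_axioms brownian_signature_axioms assms(1,2)] by blast
  have "AE w in M. F (sig_coeffs X 0 r w) = F (\<Phi> (path_of d B T w))"
    using ae by eventually_elim simp
  then show ?thesis
    unfolding determined_def by (intro conjI bexI[of _ "\<lambda>y. F (\<Phi> y)"]) measurable
qed

lemma determined_X:
  assumes "0 \<le> r" "r \<le> T"
  shows "determined M d B T (\<lambda>w. X (length v) 0 r w v)"
  using determined_sig_coeffs[OF assms, of "\<lambda>x. x v"] by (simp add: sig_coeffs_def)

lemma determined_future_sig_coeffs:
  assumes "0 \<le> a" "0 \<le> h" "h \<le> T" "F \<in> borel_measurable word_space"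
  shows "determined M d (shift_path B a) T (\<lambda>w. F (sig_coeffs X a (a + h) w))"
proof -
  interpret s: brownian_signature M d "shift_path B a" "shift_sig X a" by (rule shift[OF assms(1)])
  have "sig_coeffs (shift_sig X a) 0 h w = sig_coeffs X a (a + h) w" for w
    by (simp add: sig_coeffs_def fun_eq_iff)
  then show ?thesis using s.determined_sig_coeffs[OF assms(2-4)] by simp
qed

lemma determined_future_X:
  assumes "0 \<le> a" "0 \<le> h" "h \<le> T"
  shows "determined M d (shift_path B a) T (\<lambda>w. X (length v) a (a + h) w v)"
  using determined_future_sig_coeffs[OF assms, of "\<lambda>x. x v"] by (simp add: sig_coeffs_def)

text \<open>Almost surely \<open>f\<close> and \<open>g\<close> are functionals of the independent
  past and future paths. Independence makes the product of two merely integrable variables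
  integrable, so products of squares can be handled without fourth moments of the past
  factor.\<close>

lemma
  assumes a: "0 \<le> a" and f: "determined M d B a f" and g: "determined M d (shift_path B a) T g"
    and int: "integrable M f" "integrable M g"
  shows integrable_past_future: "integrable M (\<lambda>w. f w * g w)"
    and integral_past_future: "(\<integral>w. f w * g w \<partial>M) = (\<integral>w. f w \<partial>M) * (\<integral>w. g w \<partial>M)"
proof -
  interpret s: brownian_signature M d "shift_path B a" "shift_sig X a" by (rule shift[OF a])
  obtain \<Phi> where [measurable]: "\<Phi> \<in> borel_measurable (path_space d a)" and aef: "AE w in M. f w = \<Phi> (path_of d B a w)"
    using f by (auto simp: determined_def)
  obtain \<Psi> where [measurable]: "\<Psi> \<in> borel_measurable (path_space d T)" and aeg: "AE w in M. g w = \<Psi> (path_of d (shift_path B a) T w)"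
    using g by (auto simp: determined_def)
  have [measurable]: "f \<in> borel_measurable M" "g \<in> borel_measurable M"
    using f g by (auto simp: determined_def)
  let ?f = "\<lambda>w. \<Phi> (path_of d B a w)" and ?g = "\<lambda>w. \<Psi> (path_of d (shift_path B a) T w)"
  have ind: "indep_var borel ?f borel ?g"
    using indep_var_compose[OF past_future_indep[OF a, of T], of \<Phi> borel \<Psi> borel] by (simp add: comp_def)
  have int': "integrable M ?f" "integrable M ?g"
    using int integrable_cong_AE[OF _ _ aef] integrable_cong_AE[OF _ _ aeg] by auto
  have ae: "AE w in M. f w * g w = ?f w * ?g w"
    using aef aeg by eventually_elim simp
  show "integrable M (\<lambda>w. f w * g w)"
    using indep_var_integrable[OF ind int'] integrable_cong_AE[OF _ _ ae] by auto
  have "(\<integral>w. f w * g w \<partial>M) = (\<integral>w. ?f w * ?g w \<partial>M)"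
    by (rule integral_cong_AE[OF _ _ ae]) measurable
  also have "\<dots> = (\<integral>w. ?f w \<partial>M) * (\<integral>w. ?g w \<partial>M)"
    by (rule indep_var_lebesgue_integral[OF ind int'])
  also have "(\<integral>w. ?f w \<partial>M) = (\<integral>w. f w \<partial>M)"
    by (rule integral_cong_AE[symmetric, OF _ _ aef]) measurable
  also have "(\<integral>w. ?g w \<partial>M) = (\<integral>w. g w \<partial>M)"
    by (rule integral_cong_AE[symmetric, OF _ _ aeg]) measurable
  finally show "(\<integral>w. f w * g w \<partial>M) = (\<integral>w. f w \<partial>M) * (\<integral>w. g w \<partial>M)" .
qed

end

subsection \<open>The first two levels\<close>

lemma (in prob_space) conv_in_prob_const_AE:
  assumes "Y \<in> borel_measurable M" "Z \<in> borel_measurable M" "conv_in_prob M (\<lambda>_. Y) Z"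
  shows "AE w in M. Y w = Z w"
proof -
  obtain r where "AE w in M. (\<lambda>k::nat. Y w) \<longlonglongrightarrow> Z w"
    using conv_in_prob_AE_subseq[of "\<lambda>_. Y" Z] assms by blast
  then show ?thesis
    by eventually_elim (simp add: LIMSEQ_const_iff)
qed

lemma partition_telescope:
  assumes "is_partition s t p"
  shows "(\<Sum>k<length p - 1. f (p ! Suc k) - f (p ! k)) = (f t - f s :: real)"
proof -
  have "p \<noteq> []" using assms by (auto simp: is_partition_def)
  then have "p ! (length p - 1) = t" "p ! 0 = s"
    using assms by (auto simp: is_partition_def last_conv_nth)
  then show ?thesis
    using sum_lessThan_telescope[of "\<lambda>k. f (p ! k)" "length p - 1"] by simp
qed

lemma integrable_mult_of_squares:
  fixes f g :: "'a \<Rightarrow> real"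
  assumes [measurable]: "f \<in> borel_measurable M" "g \<in> borel_measurable M"
    and int: "integrable M (\<lambda>w. (f w)\<^sup>2)" "integrable M (\<lambda>w. (g w)\<^sup>2)"
  shows "integrable M (\<lambda>w. f w * g w)"
proof (rule Bochner_Integration.integrable_bound)
  show "integrable M (\<lambda>w. (f w)\<^sup>2 + (g w)\<^sup>2)" using int by simp
  have "\<bar>f w * g w\<bar> \<le> (f w)\<^sup>2 + (g w)\<^sup>2" for w
  proof -
    have "2 * (\<bar>f w\<bar> * \<bar>g w\<bar>) \<le> (f w)\<^sup>2 + (g w)\<^sup>2" "0 \<le> \<bar>f w\<bar> * \<bar>g w\<bar>"
      using sum_squares_bound[of "\<bar>f w\<bar>" "\<bar>g w\<bar>"] by (simp_all add: mult.assoc)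
    then show ?thesis unfolding abs_mult by linarith
  qed
  then show "AE w in M. norm (f w * g w) \<le> norm ((f w)\<^sup>2 + (g w)\<^sup>2)"
    by (auto intro!: AE_I2)
qed measurable

lemma (in prob_space) integrable_of_square:
  fixes f :: "'a \<Rightarrow> real"
  assumes "f \<in> borel_measurable M" "integrable M (\<lambda>w. (f w)\<^sup>2)"
  shows "integrable M f"
  using integrable_mult_of_squares[of f M "\<lambda>_. 1"] assms by simp

context brownian_signature
begin

text \<open>At level one the integrand is the constant 1, so every approximating sum already
  telescopes to the increment.\<close>

lemma X_one:
  assumes "0 \<le> s" "s \<le> t" "i < d"
  shows "AE w in M. X 1 s t w [i] = B t w i - B s w i"
proof (cases "s = t")
  case True
  then show ?thesis by (simp add: X_refl[of 0, simplified])
next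
  case False
  with assms have st: "s < t" by simp
  have [measurable]: "(\<lambda>w. B s w i) \<in> borel_measurable M" "(\<lambda>w. B t w i) \<in> borel_measurable M"
    using assms by (auto intro: B_measurable)
  have eq: "strat_sum B (X 0 s) (upart s t k) [] i = (\<lambda>w. B t w i - B s w i)" for k
    using partition_telescope[OF is_partition_upart[OF st, of k], of "\<lambda>t. B t _ i"]
    by (simp add: strat_sum_def X_zero fun_eq_iff)
  have "conv_in_prob M (\<lambda>k. strat_sum B (X 0 s) (upart s t k) [] i) (\<lambda>w. X (Suc 0) s t w ([] @ [i]))"
    using assms st by (intro X_conv is_partition_upart mesh_upart_tendsto) auto
  then have "conv_in_prob M (\<lambda>_. (\<lambda>w. B t w i - B s w i)) (\<lambda>w. X 1 s t w [i])"
    by (simp add: eq)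
  then have "AE w in M. B t w i - B s w i = X 1 s t w [i]"
    by (rule conv_in_prob_const_AE[rotated 2]) measurable
  then show ?thesis by eventually_elim simp
qed

text \<open>The averaged endpoint rule is exact here: \<open>(x + y) / 2 * (y - x)\<close> is a
  difference of halved squares, so the sums telescope and no Ito correction appears.\<close>

lemma X_two_diag:
  assumes "0 \<le> s" "s < t" "i < d"
  shows "AE w in M. X 2 s t w [i, i] = (X 1 s t w [i])\<^sup>2 / 2"
proof -
  let ?P = "\<lambda>k. upart s t k"
  have "conv_in_prob M (\<lambda>k. strat_sum B (X 1 s) (?P k) [i] i) (\<lambda>w. X (Suc 1) s t w ([i] @ [i]))"
    using assms by (intro X_conv is_partition_upart mesh_upart_tendsto) auto
  then have c: "conv_in_prob M (\<lambda>k. strat_sum B (X 1 s) (?P k) [i] i) (\<lambda>w. X 2 s t w [i, i])"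
    by (simp add: numeral_2_eq_2)
  have m: "strat_sum B (X 1 s) (?P k) [i] i \<in> borel_measurable M" for k
    using assms by (intro strat_sum_measurable[OF _ is_partition_upart]) auto
  obtain r where r: "AE w in M. (\<lambda>k. strat_sum B (X 1 s) (?P (r k)) [i] i w) \<longlonglongrightarrow> X 2 s t w [i, i]"
    using conv_in_prob_AE_subseq[OF m _ c] by auto
  have "AE w in M. \<forall>k. \<forall>l\<in>{..Suc k}. X 1 s (?P k ! l) w [i] = B (?P k ! l) w i - B s w i"
    using assms nth_upart_bounds[of s t]
    by (intro AE_all_countable[THEN iffD2] allI AE_finite_all[THEN iffD2] ballI X_one) auto
  with r X_one[OF assms(1) less_imp_le[OF assms(2)] assms(3)] show ?thesis
  proof eventually_elim
    case (elim w)
    have ss: "strat_sum B (X 1 s) (?P k) [i] i w = (B t w i - B s w i)\<^sup>2 / 2" for k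
    proof -
      have "strat_sum B (X 1 s) (?P k) [i] i w
        = (\<Sum>l<length (?P k) - 1. (B (?P k ! Suc l) w i - B s w i)\<^sup>2 / 2 - (B (?P k ! l) w i - B s w i)\<^sup>2 / 2)"
        unfolding strat_sum_def
      proof (rule sum.cong[OF refl])
        fix l assume "l \<in> {..<length (?P k) - 1}"
        then have e: "X 1 s (?P k ! l) w [i] = B (?P k ! l) w i - B s w i"
          "X 1 s (?P k ! Suc l) w [i] = B (?P k ! Suc l) w i - B s w i" using elim(3) by auto
        have alg: "((x - z) + (y - z)) / 2 * (y - x) = (y - z)\<^sup>2 / 2 - (x - z)\<^sup>2 / 2" for x y z :: real
          by (simp add: power2_eq_square field_simps)
        show "(X 1 s (?P k ! l) w [i] + X 1 s (?P k ! Suc l) w [i]) / 2 * (B (?P k ! Suc l) w i - B (?P k ! l) w i)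
            = (B (?P k ! Suc l) w i - B s w i)\<^sup>2 / 2 - (B (?P k ! l) w i - B s w i)\<^sup>2 / 2"
          unfolding e by (rule alg)
      qed
      also have "\<dots> = (B t w i - B s w i)\<^sup>2 / 2"
        using partition_telescope[OF is_partition_upart[OF assms(2), of k], of "\<lambda>u. (B u w i - B s w i)\<^sup>2 / 2"] by simp
      finally show ?thesis .
    qed
    show ?case using elim(1) unfolding elim(2) ss LIMSEQ_const_iff by simp
  qed
qed

subsection \<open>Scaling and sign changes\<close>

text \<open>The restarted and rescaled motion with its rescaled signature is another system of the
  same kind, so uniqueness of the law applies; scaling back costs \<open>sqrt h\<close> per
  letter.\<close>

lemma sig_coeffs_scaling_law:
  assumes "0 \<le> a" "0 < h"
  shows "distr M word_space (sig_coeffs X a (a + h))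
    = distr M word_space (\<lambda>w v. sqrt h ^ length v * X (length v) 0 1 w v)"
proof -
  interpret s: brownian_signature M d "aff_path B a h (\<lambda>_. 1)" "aff_sig X a h (\<lambda>_. 1)"
    by (rule brownian_signature_aff) (use assms in auto)
  define S where "S x v = sqrt h ^ length v * x v" for x :: "nat list \<Rightarrow> real" and v
  have "(\<lambda>x. \<lambda>v\<in>UNIV. sqrt h ^ length v * x v) \<in> measurable word_space word_space"
    by (rule measurable_restrict) measurable
  then have S[measurable]: "S \<in> measurable word_space word_space"
    by (simp add: S_def[abs_def] restrict_UNIV)
  have "sig_coeffs X a (a + h) w = S (sig_coeffs (aff_sig X a h (\<lambda>_. 1)) 0 1 w)" for w
    using assms by (simp add: S_def sig_coeffs_def aff_sig_def fun_eq_iff)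
  then have "distr M word_space (sig_coeffs X a (a + h)) = distr M word_space (S \<circ> sig_coeffs (aff_sig X a h (\<lambda>_. 1)) 0 1)"
    by (intro arg_cong[of _ _ "distr M word_space"]) (simp add: fun_eq_iff)
  also have "\<dots> = distr (distr M word_space (sig_coeffs (aff_sig X a h (\<lambda>_. 1)) 0 1)) word_space S"
    by (subst distr_distr) auto
  also have "\<dots> = distr (distr M word_space (sig_coeffs X 0 1)) word_space S"
    using sig_coeffs_law_unique[OF s.brownian_signature_axioms brownian_signature_axioms, of 1] by simp
  also have "\<dots> = distr M word_space (S \<circ> sig_coeffs X 0 1)"
    by (subst distr_distr) auto
  also have "S \<circ> sig_coeffs X 0 1 = (\<lambda>w v. sqrt h ^ length v * X (length v) 0 1 w v)"
    by (simp add: S_def sig_coeffs_def fun_eq_iff)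
  finally show ?thesis .
qed

lemma scaled_measurable [measurable]: "(\<lambda>w v. c v * X (length v) s t w v) \<in> measurable M word_space"
proof -
  have "(\<lambda>w. \<lambda>v\<in>UNIV. c v * X (length v) s t w v) \<in> measurable M word_space"
    by (rule measurable_restrict) measurable
  then show ?thesis by (simp add: restrict_UNIV)
qed

lemma
  fixes F :: "(nat list \<Rightarrow> real) \<Rightarrow> real"
  assumes "0 \<le> a" "0 < h" and F[measurable]: "F \<in> borel_measurable word_space"
  shows integrable_scaling: "integrable M (\<lambda>w. F (sig_coeffs X a (a + h) w))
      \<longleftrightarrow> integrable M (\<lambda>w. F (\<lambda>v. sqrt h ^ length v * X (length v) 0 1 w v))"
    and integral_scaling: "(\<integral>w. F (sig_coeffs X a (a + h) w) \<partial>M) = (\<integral>w. F (\<lambda>v. sqrt h ^ length v * X (length v) 0 1 w v) \<partial>M)"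
proof -
  note law = sig_coeffs_scaling_law[OF assms(1,2)]
  show "integrable M (\<lambda>w. F (sig_coeffs X a (a + h) w))
      \<longleftrightarrow> integrable M (\<lambda>w. F (\<lambda>v. sqrt h ^ length v * X (length v) 0 1 w v))"
    using integrable_distr_eq[of "sig_coeffs X a (a + h)" M word_space F]
      integrable_distr_eq[of "\<lambda>w v. sqrt h ^ length v * X (length v) 0 1 w v" M word_space F] law by simp
  show "(\<integral>w. F (sig_coeffs X a (a + h) w) \<partial>M) = (\<integral>w. F (\<lambda>v. sqrt h ^ length v * X (length v) 0 1 w v) \<partial>M)"
    using integral_distr[of "sig_coeffs X a (a + h)" M word_space F]
      integral_distr[of "\<lambda>w v. sqrt h ^ length v * X (length v) 0 1 w v" M word_space F] law by simp
qed

lemma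
  fixes n m :: nat
  assumes "0 \<le> a" "0 < h" "length u = n" "length v = m"
  shows integrable_X_prod_scaling: "integrable M (\<lambda>w. X n 0 1 w u * X m 0 1 w v) \<Longrightarrow>
      integrable M (\<lambda>w. X n a (a + h) w u * X m a (a + h) w v)"
    and integral_X_prod_scaling: "(\<integral>w. X n a (a + h) w u * X m a (a + h) w v \<partial>M)
      = sqrt h ^ (n + m) * (\<integral>w. X n 0 1 w u * X m 0 1 w v \<partial>M)"
    and integral_abs_X_prod_scaling: "(\<integral>w. \<bar>X n a (a + h) w u * X m a (a + h) w v\<bar> \<partial>M)
      = sqrt h ^ (n + m) * (\<integral>w. \<bar>X n 0 1 w u * X m 0 1 w v\<bar> \<partial>M)"
proof -
  have M1: "(\<lambda>x. x u * x v) \<in> borel_measurable word_space"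
    and M2: "(\<lambda>x. \<bar>x u * x v\<bar>) \<in> borel_measurable word_space" by measurable
  have eq: "sqrt h ^ n * X n 0 1 w u * (sqrt h ^ m * X m 0 1 w v) = sqrt h ^ (n + m) * (X n 0 1 w u * X m 0 1 w v)" for w
    by (simp add: power_add)
  have nn: "\<bar>sqrt h ^ (n + m)\<bar> = sqrt h ^ (n + m)" using assms by simp
  show "integrable M (\<lambda>w. X n a (a + h) w u * X m a (a + h) w v)" if "integrable M (\<lambda>w. X n 0 1 w u * X m 0 1 w v)"
    using integrable_scaling[OF assms(1,2) M1] that by (simp add: sig_coeffs_def assms(3,4) eq)
  show "(\<integral>w. X n a (a + h) w u * X m a (a + h) w v \<partial>M)
      = sqrt h ^ (n + m) * (\<integral>w. X n 0 1 w u * X m 0 1 w v \<partial>M)"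
    using integral_scaling[OF assms(1,2) M1] by (simp add: sig_coeffs_def assms(3,4) eq)
  show "(\<integral>w. \<bar>X n a (a + h) w u * X m a (a + h) w v\<bar> \<partial>M)
      = sqrt h ^ (n + m) * (\<integral>w. \<bar>X n 0 1 w u * X m 0 1 w v\<bar> \<partial>M)"
    using integral_scaling[OF assms(1,2) M2] by (simp add: sig_coeffs_def assms(3,4) eq abs_mult[of "sqrt h ^ _"] nn del: abs_mult)
qed

text \<open>Reflecting coordinates preserves the law. Whenever the product of signs is
  \<open>-1\<close>, the correlation equals its own negative and vanishes.\<close>

lemma integral_sign_flip:
  assumes "\<And>i. \<epsilon> i \<in> {1, -1}"
  shows "(\<integral>w. X (length u) 0 1 w u * X (length v) 0 1 w v \<partial>M)
    = prod_list (map \<epsilon> u) * prod_list (map \<epsilon> v) * (\<integral>w. X (length u) 0 1 w u * X (length v) 0 1 w v \<partial>M)"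
proof -
  interpret s: brownian_signature M d "aff_path B 0 1 \<epsilon>" "aff_sig X 0 1 \<epsilon>"
    by (rule brownian_signature_aff) (use assms in auto)
  have "(\<integral>x. x u * x v \<partial>distr M word_space (sig_coeffs X 0 1)) = (\<integral>x. x u * x v \<partial>distr M word_space (sig_coeffs (aff_sig X 0 1 \<epsilon>) 0 1))"
    using sig_coeffs_law_unique[OF s.brownian_signature_axioms brownian_signature_axioms, of 1] by simp
  then have "(\<integral>w. X (length u) 0 1 w u * X (length v) 0 1 w v \<partial>M)
      = (\<integral>w. prod_list (map \<epsilon> u) * prod_list (map \<epsilon> v) * (X (length u) 0 1 w u * X (length v) 0 1 w v) \<partial>M)"
    by (subst (asm) (1 2) integral_distr) (simp_all add: sig_coeffs_def aff_sig_def mult_ac)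
  then show ?thesis by simp
qed

subsection \<open>Gaussian moments of the first level\<close>

lemma X_one_distributed:
  assumes "i < d"
  shows "distributed M lborel (\<lambda>w. X 1 0 1 w [i]) std_normal_density"
proof -
  \<comment> \<open>The embedding \<open>real\<close> serves as the time grid 0, 1, of which the
    only increment is used.\<close>
  have "distributed M lborel (\<lambda>w. B (real (Suc 0)) w i - B (real 0) w i) (normal_density 0 (sqrt (real (Suc 0) - real 0)))"
    using assms by (intro distributed_increment[of real 1]) auto
  then have "distributed M lborel (\<lambda>w. B 1 w i - B 0 w i) std_normal_density" by simp
  then have "distr M lborel (\<lambda>w. B 1 w i - B 0 w i) = density lborel std_normal_density"
    by (rule distributed_distr_eq_density)
  moreover have "distr M lborel (\<lambda>w. X 1 0 1 w [i]) = distr M lborel (\<lambda>w. B 1 w i - B 0 w i)"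
    using X_one[of 0 1 i] assms
    by (intro distr_cong_AE) (auto intro!: borel_measurable_diff B_measurable)
  ultimately show ?thesis by (auto simp: distributed_def)
qed

lemma integrable_X_one_power:
  assumes "i < d" shows "integrable M (\<lambda>w. X 1 0 1 w [i] ^ k)"
  using distributed_integrable[OF X_one_distributed[OF assms], of "\<lambda>x. x ^ k"] integrable_std_normal_moment[of k] by simp

lemma integral_X_one: assumes "i < d" shows "(\<integral>w. X 1 0 1 w [i] \<partial>M) = 0"
  using distributed_integral[OF X_one_distributed[OF assms], of "\<lambda>x. x"] integral_std_normal_moment_odd[of 0] by simp

lemma integral_X_one_square: assumes "i < d" shows "(\<integral>w. (X 1 0 1 w [i])\<^sup>2 \<partial>M) = 1"
  using distributed_integral[OF X_one_distributed[OF assms], of "\<lambda>x. x\<^sup>2"] integral_std_normal_moment_even[of 1] by simp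

end

subsection \<open>Finiteness of second moments\<close>

context brownian_signature
begin

text \<open>Scaling multiplies the second moment by \<open>r ^ n\<close>, which is at most 1. The
  time \<open>r = 0\<close> lies outside the range of scaling and is read off from the definition of
  a signature.\<close>

lemma
  assumes "0 \<le> r" "r \<le> 1" "length v = n" and int: "integrable M (\<lambda>w. (X n 0 1 w v)\<^sup>2)"
  shows integrable_X_square_at: "integrable M (\<lambda>w. (X n 0 r w v)\<^sup>2)"
    and integral_X_square_at_le: "(\<integral>w. (X n 0 r w v)\<^sup>2 \<partial>M) \<le> 1 + (\<integral>w. (X n 0 1 w v)\<^sup>2 \<partial>M)"
proof -
  have nn: "0 \<le> (\<integral>w. (X n 0 1 w v)\<^sup>2 \<partial>M)" by simp
  have "integrable M (\<lambda>w. (X n 0 r w v)\<^sup>2) \<and> (\<integral>w. (X n 0 r w v)\<^sup>2 \<partial>M) \<le> 1 + (\<integral>w. (X n 0 1 w v)\<^sup>2 \<partial>M)"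
  proof (cases "r = 0")
    case True
    then show ?thesis using nn by (cases n) (simp_all add: X_zero X_refl prob_space)
  next
    case False
    then have r: "0 < r" using assms by simp
    have "(\<integral>w. (X n 0 r w v)\<^sup>2 \<partial>M) = sqrt r ^ (n + n) * (\<integral>w. (X n 0 1 w v)\<^sup>2 \<partial>M)"
      using integral_X_prod_scaling[of 0 r v n v n] r assms by (simp add: power2_eq_square)
    also have "\<dots> \<le> 1 * (\<integral>w. (X n 0 1 w v)\<^sup>2 \<partial>M)"
      using assms by (intro mult_right_mono power_le_one) auto
    finally have "(\<integral>w. (X n 0 r w v)\<^sup>2 \<partial>M) \<le> 1 + (\<integral>w. (X n 0 1 w v)\<^sup>2 \<partial>M)" by simp
    moreover have "integrable M (\<lambda>w. (X n 0 r w v)\<^sup>2)"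
      using integrable_X_prod_scaling[of 0 r v n v n] r assms by (simp add: power2_eq_square)
    ultimately show ?thesis by simp
  qed
  then show "integrable M (\<lambda>w. (X n 0 r w v)\<^sup>2)"
    "(\<integral>w. (X n 0 r w v)\<^sup>2 \<partial>M) \<le> 1 + (\<integral>w. (X n 0 1 w v)\<^sup>2 \<partial>M)" by auto
qed

lemma
  assumes "0 \<le> r" "r \<le> 1" "length v = n" and int: "integrable M (\<lambda>w. (X n 0 1 w v)\<^sup>2)"
  shows integrable_X_at: "integrable M (\<lambda>w. X n 0 r w v)"
    and integral_abs_X_at_le: "(\<integral>w. \<bar>X n 0 r w v\<bar> \<partial>M) \<le> 2 + (\<integral>w. (X n 0 1 w v)\<^sup>2 \<partial>M)"
proof -
  note sq = integrable_X_square_at[OF assms]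
  show i1: "integrable M (\<lambda>w. X n 0 r w v)"
    by (rule integrable_of_square[OF _ sq]) measurable
  have le: "\<bar>x\<bar> \<le> 1 + x\<^sup>2" for x :: real
    using sum_squares_bound[of "\<bar>x\<bar>" 1] by (simp; linarith)
  have "(\<integral>w. \<bar>X n 0 r w v\<bar> \<partial>M) \<le> (\<integral>w. 1 + (X n 0 r w v)\<^sup>2 \<partial>M)"
    using sq i1 le by (intro integral_mono) auto
  also have "\<dots> = 1 + (\<integral>w. (X n 0 r w v)\<^sup>2 \<partial>M)"
    using sq by (simp add: prob_space)
  finally show "(\<integral>w. \<bar>X n 0 r w v\<bar> \<partial>M) \<le> 2 + (\<integral>w. (X n 0 1 w v)\<^sup>2 \<partial>M)"
    using integral_X_square_at_le[OF assms] by simp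
qed

lemma determined_future_X':
  assumes "0 \<le> a" "0 \<le> h" "length v = n"
  shows "determined M d (shift_path B a) h (\<lambda>w. X n a (a + h) w v)"
  using determined_future_X[of a h h v] assms by simp

lemma determined_X':
  assumes "0 \<le> r" "r \<le> T" "length v = n"
  shows "determined M d B T (\<lambda>w. X n 0 r w v)"
  using determined_X[of r T v] assms by simp

text \<open>By Chen's identity the Stratonovich sums over uniform partitions are Ito-type sums plus a
  second-order term, both bounded in \<open>L\<^sup>2\<close>, plus a remainder that vanishes in \<open>L\<^sup>1\<close>.\<close>

lemma square_integrable_snoc:
  assumes IH: "\<And>v. length v \<le> Suc N \<Longrightarrow> integrable M (\<lambda>w. (X (length v) 0 1 w v)\<^sup>2)"
    and u: "u = u' @ [l]" "length u' = N" "set u \<subseteq> {..<d}" and i: "i < d"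
  shows "integrable M (\<lambda>w. (X (Suc (Suc N)) 0 1 w (u @ [i]))\<^sup>2)"
proof -
  have l: "l < d" and lu: "length u = Suc N" using u by auto
  define \<delta> where "\<delta> m = 1 / real (Suc m)" for m
  define q where "q m k = real k / real (Suc m)" for m k
  have \<delta>: "0 < \<delta> m" "\<delta> m \<le> 1" for m by (auto simp: \<delta>_def)
  have q: "0 \<le> q m k" for m k by (simp add: q_def)
  have q1: "q m k \<le> 1" if "k \<le> m" for m k using that by (simp add: q_def)
  have qS: "q m (Suc k) = q m k + \<delta> m" for m k by (simp add: q_def \<delta>_def add_divide_distrib)
  have up: "upart 0 1 m ! k = q m k" if "k \<le> Suc m" for m k
    using nth_upart[of k m 0 1] that by (simp add: q_def)
  define A where "A m k w = X (Suc N) 0 (q m k) w u" for m k w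
  define A' where "A' m k w = X N 0 (q m k) w u'" for m k w
  define D where "D m k w = X 1 (q m k) (q m k + \<delta> m) w [i]" for m k w
  define D' where "D' m k w = X 1 (q m k) (q m k + \<delta> m) w [l]" for m k w
  define f where "f j m k w = X j 0 (q m k) w (take j u)" for j m k w
  define g where "g j m k w = X (Suc N - j) (q m k) (q m k + \<delta> m) w (drop j u) * D m k w" for j m k w
  \<comment> \<open>Chen's identity at the right endpoint sorts the integrand by the number of
    letters of \<open>u\<close> falling into the short interval: none gives the Ito-type term
    \<open>U\<close>, one gives the correction \<open>V\<close>, two or more give \<open>R\<close>.
    The halves come from averaging with the left endpoint, which contributes to \<open>U\<close>
    only.\<close>
  define U where "U m k w = A m k w * D m k w" for m k w
  define V where "V m k w = A' m k w * (D' m k w * D m k w) / 2" for m k w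
  define R where "R m k w = (\<Sum>j<N. f j m k w * g j m k w) / 2" for m k w
  have [measurable]: "A m k \<in> borel_measurable M" "A' m k \<in> borel_measurable M" "D m k \<in> borel_measurable M"
    "D' m k \<in> borel_measurable M" "f j m k \<in> borel_measurable M" "g j m k \<in> borel_measurable M" for j m k
    unfolding A_def A'_def D_def D'_def f_def g_def by measurable
  have [measurable]: "U m k \<in> borel_measurable M" "V m k \<in> borel_measurable M" "R m k \<in> borel_measurable M" for m k
    unfolding U_def V_def R_def by measurable

  have decomp: "AE w in M. \<forall>m. strat_sum B (X (Suc N) 0) (upart 0 1 m) u i w = (\<Sum>k<Suc m. U m k w + V m k w + R m k w)"
  proof -
    have "AE w in M. \<forall>m. \<forall>k\<in>{..<Suc m}. X (length u) 0 (q m k + \<delta> m) w u =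
        (\<Sum>j\<le>length u. X j 0 (q m k) w (take j u) * X (length u - j) (q m k) (q m k + \<delta> m) w (drop j u))"
      using q \<delta> by (intro AE_all_countable[THEN iffD2] allI AE_finite_all[THEN iffD2] ballI chen) (auto simp: less_imp_le)
    moreover have "AE w in M. \<forall>m. \<forall>k\<in>{..<Suc m}. D m k w = B (q m k + \<delta> m) w i - B (q m k) w i"
      unfolding D_def
      using q \<delta> i by (intro AE_all_countable[THEN iffD2] allI AE_finite_all[THEN iffD2] ballI X_one) (auto simp: less_imp_le)
    ultimately show ?thesis
    proof eventually_elim
      case (elim w)
      show ?case
      proof
        fix m
        show "strat_sum B (X (Suc N) 0) (upart 0 1 m) u i w = (\<Sum>k<Suc m. U m k w + V m k w + R m k w)"
          unfolding strat_sum_def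
        proof (rule sum.cong)
          show "{..<length (upart 0 1 m) - 1} = {..<Suc m}" by simp
          fix k assume "k \<in> {..<Suc m}"
          then have k: "k < Suc m" by simp
          have "X (Suc N) 0 (q m k + \<delta> m) w u = (\<Sum>j\<le>Suc N. f j m k w * X (Suc N - j) (q m k) (q m k + \<delta> m) w (drop j u))"
            using elim(1) k lu by (simp add: f_def)
          also have "{..Suc N} = insert (Suc N) (insert N {..<N})" by auto
          also have "(\<Sum>j\<in>\<dots>. f j m k w * X (Suc N - j) (q m k) (q m k + \<delta> m) w (drop j u))
              = A m k w + A' m k w * D' m k w + (\<Sum>j<N. f j m k w * X (Suc N - j) (q m k) (q m k + \<delta> m) w (drop j u))"
            using u lu by (simp add: f_def A_def A'_def D'_def X_zero)
          finally have "X (Suc N) 0 (q m k + \<delta> m) w u = A m k w + A' m k w * D' m k w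
              + (\<Sum>j<N. f j m k w * X (Suc N - j) (q m k) (q m k + \<delta> m) w (drop j u))" (is "_ = _ + ?S") .
          moreover have "(A m k w + (A m k w + A' m k w * D' m k w + ?S)) / 2 * D m k w = U m k w + V m k w + ?S * D m k w / 2"
            by (simp add: U_def V_def field_simps)
          moreover have "?S * D m k w = (\<Sum>j<N. f j m k w * g j m k w)"
            by (simp add: sum_distrib_right g_def mult.assoc)
          moreover have "B (q m k + \<delta> m) w i - B (q m k) w i = D m k w"
            using elim(2) k by simp
          ultimately show "(X (Suc N) 0 (upart 0 1 m ! k) w u + X (Suc N) 0 (upart 0 1 m ! Suc k) w u) / 2
              * (B (upart 0 1 m ! Suc k) w i - B (upart 0 1 m ! k) w i) = U m k w + V m k w + R m k w"
            using k by (simp add: up qS R_def A_def)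
        qed
      qed
    qed
  qed

  note c1 = integrable_X_one_power
  have sq1: "integrable M (\<lambda>w. (X 1 0 1 w [j])\<^sup>2)" if "j < d" for j using c1[OF that, of 2] by simp
  have iD: "integrable M (D m k)" and iD2: "integrable M (\<lambda>w. (D m k w)\<^sup>2)" and ED: "(\<integral>w. D m k w \<partial>M) = 0"
    and ED2: "(\<integral>w. (D m k w)\<^sup>2 \<partial>M) = \<delta> m" for m k
  proof -
    note s = integrable_X_prod_scaling[OF q \<delta>(1)] integral_X_prod_scaling[OF q \<delta>(1)]
    show D2: "integrable M (\<lambda>w. (D m k w)\<^sup>2)"
      using s(1)[of "[i]" 1 "[i]" 1 m k m] sq1[OF i] by (simp add: D_def power2_eq_square)
    show "integrable M (D m k)" by (rule integrable_of_square[OF _ D2]) measurable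
    show "(\<integral>w. (D m k w)\<^sup>2 \<partial>M) = \<delta> m"
      using s(2)[of "[i]" 1 "[i]" 1 m k m] integral_X_one_square[OF i] \<delta>(1)[of m]
      by (simp add: D_def power2_eq_square)
    \<comment> \<open>The empty word has coefficient 1, so the scaling rule for products also yields
      means.\<close>
    show "(\<integral>w. D m k w \<partial>M) = 0"
      using s(2)[of "[i]" 1 "[]" 0 m k m] integral_X_one[OF i]
      by (simp add: D_def X_zero)
  qed

  have detf: "determined M d B (q m k) (f j m k)" if "j \<le> Suc N" for j m k
    unfolding f_def using that lu by (intro determined_X' q) auto
  have detA: "determined M d B (q m k) (A m k)" and detA': "determined M d B (q m k) (A' m k)" for m k
    unfolding A_def A'_def using u lu by (auto intro!: determined_X' q)
  have detD: "determined M d (shift_path B (q m k)) (\<delta> m) (D m k)"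
    and detD': "determined M d (shift_path B (q m k)) (\<delta> m) (D' m k)" for m k
    unfolding D_def D'_def by (intro determined_future_X' q less_imp_le[OF \<delta>(1)]; simp)+
  have detg: "determined M d (shift_path B (q m k)) (\<delta> m) (g j m k)" for j m k
    unfolding g_def using lu by (intro determined_mult detD determined_future_X' q less_imp_le[OF \<delta>(1)]) auto

  define CR where "CR = (\<Sum>j<N. (2 + (\<integral>w. (X j 0 1 w (take j u))\<^sup>2 \<partial>M)) * (\<integral>w. \<bar>X (Suc N - j) 0 1 w (drop j u) * X 1 0 1 w [i]\<bar> \<partial>M))"
  have R: "integrable M (R m k) \<and> (\<integral>w. \<bar>R m k w\<bar> \<partial>M) \<le> sqrt (\<delta> m) ^ 3 * CR" if k: "k < Suc m" for m k
  proof -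
    have fg: "integrable M (\<lambda>w. f j m k w * g j m k w) \<and> (\<integral>w. \<bar>f j m k w * g j m k w\<bar> \<partial>M)
        \<le> sqrt (\<delta> m) ^ 3 * ((2 + (\<integral>w. (X j 0 1 w (take j u))\<^sup>2 \<partial>M)) * (\<integral>w. \<bar>X (Suc N - j) 0 1 w (drop j u) * X 1 0 1 w [i]\<bar> \<partial>M))"
      if j: "j < N" for j
    proof -
      have ltake: "length (take j u) = j" and ldrop: "length (drop j u) = Suc N - j" using j lu by auto
      have sqj: "integrable M (\<lambda>w. (X j 0 1 w (take j u))\<^sup>2)"
        using IH[of "take j u"] ltake j by simp
      have sqd: "integrable M (\<lambda>w. (X (Suc N - j) 0 1 w (drop j u))\<^sup>2)"
        using IH[of "drop j u"] ldrop j by simp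
      have qk: "q m k \<le> 1" using k q1 by simp
      have intf: "integrable M (f j m k)" and absf: "(\<integral>w. \<bar>f j m k w\<bar> \<partial>M) \<le> 2 + (\<integral>w. (X j 0 1 w (take j u))\<^sup>2 \<partial>M)"
        unfolding f_def using integrable_X_at[OF q qk ltake sqj] integral_abs_X_at_le[OF q qk ltake sqj] by auto
      have "integrable M (\<lambda>w. X (Suc N - j) 0 1 w (drop j u) * X 1 0 1 w [i])"
        by (rule integrable_mult_of_squares[OF _ _ sqd sq1[OF i]]) measurable
      then have intg: "integrable M (g j m k)"
        unfolding g_def D_def using ldrop by (intro integrable_X_prod_scaling[OF q \<delta>(1)]) auto
      have absg: "(\<integral>w. \<bar>g j m k w\<bar> \<partial>M) = sqrt (\<delta> m) ^ (Suc N - j + 1) * (\<integral>w. \<bar>X (Suc N - j) 0 1 w (drop j u) * X 1 0 1 w [i]\<bar> \<partial>M)"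
        unfolding g_def D_def using ldrop by (intro integral_abs_X_prod_scaling[OF q \<delta>(1)]) auto
      \<comment> \<open>For \<open>j < N\<close> at least two letters of \<open>u\<close> fall into
        the short interval and \<open>D\<close> adds a third, whence the cube of
        \<open>sqrt (\<delta> m)\<close>. Summed over \<open>Suc m\<close> intervals this is still
        of order \<open>sqrt (\<delta> m)\<close>.\<close>
      have pw: "sqrt (\<delta> m) ^ (Suc N - j + 1) \<le> sqrt (\<delta> m) ^ 3"
        using \<delta>[of m] j by (intro power_decreasing) auto
      have "(\<integral>w. \<bar>f j m k w * g j m k w\<bar> \<partial>M) = (\<integral>w. \<bar>f j m k w\<bar> * \<bar>g j m k w\<bar> \<partial>M)"
        by (simp add: abs_mult)
      also have "\<dots> = (\<integral>w. \<bar>f j m k w\<bar> \<partial>M) * (\<integral>w. \<bar>g j m k w\<bar> \<partial>M)"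
      proof (rule integral_past_future[OF q])
        show "determined M d B (q m k) (\<lambda>w. \<bar>f j m k w\<bar>)"
          by (rule determined_comp[OF detf]) (use j in auto)
        show "determined M d (shift_path B (q m k)) (\<delta> m) (\<lambda>w. \<bar>g j m k w\<bar>)"
          by (rule determined_comp[OF detg]) auto
      qed (use intf intg in auto)
      also have "\<dots> \<le> (2 + (\<integral>w. (X j 0 1 w (take j u))\<^sup>2 \<partial>M)) * (sqrt (\<delta> m) ^ 3 * (\<integral>w. \<bar>X (Suc N - j) 0 1 w (drop j u) * X 1 0 1 w [i]\<bar> \<partial>M))"
        unfolding absg using \<delta>[of m] by (intro mult_mono absf mult_right_mono pw) (auto intro!: add_nonneg_nonneg)
      finally show ?thesis
        using integrable_past_future[OF q detf detg intf intg] j by (simp add: mult_ac)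
    qed
    have "integrable M (R m k)" unfolding R_def using fg by (intro integrable_divide Bochner_Integration.integrable_sum) auto
    moreover have "(\<integral>w. \<bar>R m k w\<bar> \<partial>M) \<le> (\<integral>w. (\<Sum>j<N. \<bar>f j m k w * g j m k w\<bar>) \<partial>M)"
    proof (rule integral_mono)
      show "integrable M (\<lambda>w. \<bar>R m k w\<bar>)" using \<open>integrable M (R m k)\<close> by simp
      show "integrable M (\<lambda>w. \<Sum>j<N. \<bar>f j m k w * g j m k w\<bar>)" using fg by (intro Bochner_Integration.integrable_sum Bochner_Integration.integrable_abs) auto
      fix w
      have "\<bar>R m k w\<bar> \<le> \<bar>\<Sum>j<N. f j m k w * g j m k w\<bar>" by (simp add: R_def)
      also have "\<dots> \<le> (\<Sum>j<N. \<bar>f j m k w * g j m k w\<bar>)" by (rule sum_abs)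
      finally show "\<bar>R m k w\<bar> \<le> (\<Sum>j<N. \<bar>f j m k w * g j m k w\<bar>)" .
    qed
    moreover have "\<dots> = (\<Sum>j<N. \<integral>w. \<bar>f j m k w * g j m k w\<bar> \<partial>M)"
      using fg by (intro Bochner_Integration.integral_sum Bochner_Integration.integrable_abs) auto
    moreover have "\<dots> \<le> sqrt (\<delta> m) ^ 3 * CR"
      unfolding CR_def sum_distrib_left using fg by (intro sum_mono) auto
    ultimately show ?thesis by linarith
  qed
  have sumR_int: "integrable M (\<lambda>w. \<Sum>k<Suc m. R m k w)" for m
    using R by (intro Bochner_Integration.integrable_sum) auto
  have CR0: "0 \<le> CR" unfolding CR_def by (intro sum_nonneg mult_nonneg_nonneg) (auto intro!: add_nonneg_nonneg)
  have sumR_le: "(\<integral>w. \<bar>\<Sum>k<Suc m. R m k w\<bar> \<partial>M) \<le> sqrt (\<delta> m) * CR" for m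
  proof -
    have "(\<integral>w. \<bar>\<Sum>k<Suc m. R m k w\<bar> \<partial>M) \<le> (\<integral>w. (\<Sum>k<Suc m. \<bar>R m k w\<bar>) \<partial>M)"
      using R by (intro integral_mono Bochner_Integration.integrable_abs sumR_int Bochner_Integration.integrable_sum sum_abs) auto
    also have "\<dots> = (\<Sum>k<Suc m. \<integral>w. \<bar>R m k w\<bar> \<partial>M)"
      using R by (intro Bochner_Integration.integral_sum Bochner_Integration.integrable_abs) auto
    also have "\<dots> \<le> (\<Sum>k<Suc m. sqrt (\<delta> m) ^ 3 * CR)"
      using R by (intro sum_mono) auto
    also have "\<dots> = real (Suc m) * sqrt (\<delta> m) ^ 3 * CR" by simp
    also have "real (Suc m) * sqrt (\<delta> m) ^ 3 = (real (Suc m) * \<delta> m) * sqrt (\<delta> m)"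
      using \<delta>(1)[of m] by (simp add: power3_eq_cube)
    also have "\<dots> = sqrt (\<delta> m)" by (simp add: \<delta>_def)
    finally show ?thesis .
  qed
  have \<delta>_lim: "\<delta> \<longlonglongrightarrow> 0" unfolding \<delta>_def by (rule LIMSEQ_over_Suc)
  have "(\<lambda>m. sqrt (\<delta> m) * CR) \<longlonglongrightarrow> sqrt 0 * CR"
    by (intro tendsto_intros \<delta>_lim)
  then have "(\<lambda>m. sqrt (\<delta> m) * CR) \<longlonglongrightarrow> 0" by simp
  then have "(\<lambda>m. \<integral>w. \<bar>\<Sum>k<Suc m. R m k w\<bar> \<partial>M) \<longlonglongrightarrow> 0"
    by (rule Lim_null_comparison[rotated]) (use sumR_le in \<open>auto intro!: always_eventually\<close>)
  then have convR: "conv_in_prob M (\<lambda>m w. \<Sum>k<Suc m. R m k w) (\<lambda>_. 0)"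
    by (intro conv_in_prob_L1 sumR_int)

  define CA where "CA = 1 + (\<integral>w. (X (Suc N) 0 1 w u)\<^sup>2 \<partial>M)"
  define CA' where "CA' = 1 + (\<integral>w. (X N 0 1 w u')\<^sup>2 \<partial>M)"
  have A2: "integrable M (\<lambda>w. (A m k w)\<^sup>2) \<and> (\<integral>w. (A m k w)\<^sup>2 \<partial>M) \<le> CA" if "k \<le> m" for m k
    unfolding A_def CA_def
    using integrable_X_square_at[OF q q1[OF that] lu] integral_X_square_at_le[OF q q1[OF that] lu] IH[of u] lu by auto
  have A'2: "integrable M (\<lambda>w. (A' m k w)\<^sup>2) \<and> (\<integral>w. (A' m k w)\<^sup>2 \<partial>M) \<le> CA'" if "k \<le> m" for m k
    unfolding A'_def CA'_def
    using integrable_X_square_at[OF q q1[OF that] u(2)] integral_X_square_at_le[OF q q1[OF that] u(2)] IH[of u'] u(2) by auto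

  have U2: "integrable M (\<lambda>w. (U m k w)\<^sup>2) \<and> (\<integral>w. (U m k w)\<^sup>2 \<partial>M) \<le> CA * \<delta> m" if "k \<le> m" for m k
  proof -
    have da: "determined M d B (q m k) (\<lambda>w. (A m k w)\<^sup>2)" by (rule determined_comp[OF detA]) measurable
    have db: "determined M d (shift_path B (q m k)) (\<delta> m) (\<lambda>w. (D m k w)\<^sup>2)" by (rule determined_comp[OF detD]) measurable
    show ?thesis
      using integrable_past_future[OF q da db _ iD2] integral_past_future[OF q da db _ iD2] A2[OF that] ED2 \<delta>(1)[of m]
      by (simp add: U_def power_mult_distrib)
  qed
  \<comment> \<open>The summands are orthogonal, because \<open>D\<close> is centred and independent
    of the path up to \<open>q m K\<close>. The induction therefore also carries that the partial
    sum is determined by that path. At \<open>K = Suc m\<close> the bound is \<open>CA\<close>, free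
    of \<open>m\<close>.\<close>
  have sumU: "integrable M (\<lambda>w. (\<Sum>k<K. U m k w)\<^sup>2) \<and> (\<integral>w. (\<Sum>k<K. U m k w)\<^sup>2 \<partial>M) \<le> real K * (CA * \<delta> m)
      \<and> determined M d B (q m K) (\<lambda>w. \<Sum>k<K. U m k w)"
    if "K \<le> Suc m" for m K
    using that
  proof (induction K)
    case 0
    then show ?case by (simp add: determined_const)
  next
    case (Suc K)
    let ?S = "\<lambda>w. \<Sum>k<K. U m k w"
    have K: "K \<le> m" using Suc.prems by simp
    have IS: "integrable M (\<lambda>w. (?S w)\<^sup>2)" "(\<integral>w. (?S w)\<^sup>2 \<partial>M) \<le> real K * (CA * \<delta> m)" "determined M d B (q m K) ?S"
      using Suc by auto
    have SA: "integrable M (\<lambda>w. ?S w * A m K w)"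
      using IS(1) A2[OF K] by (intro integrable_mult_of_squares) auto
    have dSA: "determined M d B (q m K) (\<lambda>w. ?S w * A m K w)"
      by (rule determined_mult[OF IS(3) detA])
    have SU: "integrable M (\<lambda>w. ?S w * U m K w)" "(\<integral>w. ?S w * U m K w \<partial>M) = 0"
      using integrable_past_future[OF q dSA detD SA iD] integral_past_future[OF q dSA detD SA iD]
      by (auto simp: U_def ED mult.assoc)
    have eq: "(\<Sum>k<Suc K. U m k w)\<^sup>2 = (?S w)\<^sup>2 + (2 * (?S w * U m K w) + (U m K w)\<^sup>2)" for w
      by (simp add: power2_eq_square algebra_simps)
    have "integrable M (\<lambda>w. (\<Sum>k<Suc K. U m k w)\<^sup>2)"
      unfolding eq using IS(1) SU U2[OF K] by simp
    moreover have "(\<integral>w. (\<Sum>k<Suc K. U m k w)\<^sup>2 \<partial>M) = (\<integral>w. (?S w)\<^sup>2 \<partial>M) + (\<integral>w. (U m K w)\<^sup>2 \<partial>M)"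
      unfolding eq using IS(1) SU U2[OF K] by simp
    moreover have "\<dots> \<le> real (Suc K) * (CA * \<delta> m)"
      using IS(2) U2[OF K] by (simp add: algebra_simps)
    moreover have "determined M d B (q m (Suc K)) (\<lambda>w. \<Sum>k<Suc K. U m k w)"
    proof (rule determined_sum)
      fix k assume "k \<in> {..<Suc K}"
      then have qk: "q m k \<le> q m (Suc K)" "q m k + \<delta> m \<le> q m (Suc K)"
        unfolding qS[symmetric] by (auto simp: q_def intro!: divide_right_mono)
      have "determined M d B (q m (Suc K)) (A m k)"
        unfolding A_def by (rule determined_X'[OF q qk(1) lu])
      \<comment> \<open>\<open>D\<close> is known to be determined by the shifted path; as a
        difference of path values it is also determined by the original path up to the right
        endpoint.\<close>
      have dB: "determined M d B (q m (Suc K)) (\<lambda>w. (B (q m k + \<delta> m) w i - B 0 w i) - (B (q m k) w i - B 0 w i))"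
        using q qk \<delta>(1)[of m] i by (intro determined_diff determined_path) (auto intro: add_nonneg_nonneg less_imp_le)
      have "AE w in M. D m k w = B (q m k + \<delta> m) w i - B (q m k) w i"
        unfolding D_def using q \<delta>(1)[of m] i by (intro X_one) auto
      then have "determined M d B (q m (Suc K)) (D m k)"
        by (intro determined_cong_AE[OF dB]) auto
      then show "determined M d B (q m (Suc K)) (U m k)"
        unfolding U_def using \<open>determined M d B (q m (Suc K)) (A m k)\<close> by (intro determined_mult)
    qed
    ultimately show ?case by simp
  qed

  define c4 where "c4 = (\<integral>w. X 1 0 1 w [l] ^ 2 * X 1 0 1 w [i] ^ 2 \<partial>M)"
  have i4: "integrable M (\<lambda>w. X 1 0 1 w [l] ^ 2 * X 1 0 1 w [i] ^ 2)"
    using c1[OF l, of 4] c1[OF i, of 4] by (intro integrable_mult_of_squares) (auto simp flip: power_mult)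
  have DD: "integrable M (\<lambda>w. (D' m k w * D m k w)\<^sup>2) \<and> (\<integral>w. (D' m k w * D m k w)\<^sup>2 \<partial>M) = (\<delta> m)\<^sup>2 * c4" for m k
  proof -
    have F: "(\<lambda>x::nat list \<Rightarrow> real. (x [l] * x [i])\<^sup>2) \<in> borel_measurable word_space" by measurable
    have e: "(sqrt (\<delta> m) * x * (sqrt (\<delta> m) * y))\<^sup>2 = (\<delta> m)\<^sup>2 * (x\<^sup>2 * y\<^sup>2)" for x y
      using \<delta>(1)[of m] by (simp add: power_mult_distrib power2_eq_square)
    show ?thesis
      using integrable_scaling[OF q[of m k] \<delta>(1)[of m] F] integral_scaling[OF q[of m k] \<delta>(1)[of m] F] i4
      by (simp add: sig_coeffs_def D_def D'_def e c4_def)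
  qed
  have V2: "integrable M (\<lambda>w. (V m k w)\<^sup>2) \<and> (\<integral>w. (V m k w)\<^sup>2 \<partial>M) \<le> CA' * ((\<delta> m)\<^sup>2 * c4)" if "k \<le> m" for m k
  proof -
    have da: "determined M d B (q m k) (\<lambda>w. (A' m k w)\<^sup>2)" by (rule determined_comp[OF detA']) measurable
    have "determined M d (shift_path B (q m k)) (\<delta> m) (\<lambda>w. D' m k w * D m k w)" by (rule determined_mult[OF detD' detD])
    then have db: "determined M d (shift_path B (q m k)) (\<delta> m) (\<lambda>w. (D' m k w * D m k w)\<^sup>2)" by (rule determined_comp) measurable
    have ia: "integrable M (\<lambda>w. (A' m k w)\<^sup>2)" and ib: "integrable M (\<lambda>w. (D' m k w * D m k w)\<^sup>2)"
      using A'2[OF that] DD by auto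
    note p = integrable_past_future[OF q da db ia ib] integral_past_future[OF q da db ia ib]
    have e: "(V m k w)\<^sup>2 = ((A' m k w)\<^sup>2 * (D' m k w * D m k w)\<^sup>2) / 4" for w
      by (simp add: V_def power_mult_distrib power_divide)
    have "0 \<le> c4" unfolding c4_def by simp
    then have "(\<integral>w. (A' m k w)\<^sup>2 \<partial>M) * ((\<delta> m)\<^sup>2 * c4) \<le> CA' * ((\<delta> m)\<^sup>2 * c4)"
      using A'2[OF that] by (intro mult_right_mono) auto
    moreover have "0 \<le> (\<integral>w. (A' m k w)\<^sup>2 \<partial>M) * ((\<delta> m)\<^sup>2 * c4)" using \<open>0 \<le> c4\<close> by simp
    ultimately show ?thesis unfolding e using p DD by simp
  qed
  have sumV: "integrable M (\<lambda>w. (\<Sum>k<Suc m. V m k w)\<^sup>2) \<and> (\<integral>w. (\<Sum>k<Suc m. V m k w)\<^sup>2 \<partial>M) \<le> CA' * c4" for m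
  proof -
    have le: "(\<Sum>k<Suc m. V m k w)\<^sup>2 \<le> real (Suc m) * (\<Sum>k<Suc m. (V m k w)\<^sup>2)" for w
      using Cauchy_Schwarz_ineq_sum[of "\<lambda>_. 1" "\<lambda>k. V m k w" "{..<Suc m}"] by simp
    have ir: "integrable M (\<lambda>w. real (Suc m) * (\<Sum>k<Suc m. (V m k w)\<^sup>2))"
      using V2 by (intro integrable_mult_right Bochner_Integration.integrable_sum) auto
    have il: "integrable M (\<lambda>w. (\<Sum>k<Suc m. V m k w)\<^sup>2)"
    proof (rule Bochner_Integration.integrable_bound[OF ir])
      show "AE w in M. norm ((\<Sum>k<Suc m. V m k w)\<^sup>2) \<le> norm (real (Suc m) * (\<Sum>k<Suc m. (V m k w)\<^sup>2))"
        unfolding real_norm_def abs_power2 by (intro AE_I2 order_trans[OF le abs_ge_self])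
    qed measurable
    have "(\<integral>w. (\<Sum>k<Suc m. V m k w)\<^sup>2 \<partial>M) \<le> (\<integral>w. real (Suc m) * (\<Sum>k<Suc m. (V m k w)\<^sup>2) \<partial>M)"
      by (rule integral_mono[OF il ir le])
    also have "\<dots> = real (Suc m) * (\<Sum>k<Suc m. \<integral>w. (V m k w)\<^sup>2 \<partial>M)"
      using V2 by (subst integral_mult_right_zero, subst Bochner_Integration.integral_sum) auto
    also have "\<dots> \<le> real (Suc m) * (\<Sum>k<Suc m. CA' * ((\<delta> m)\<^sup>2 * c4))"
      using V2 by (intro mult_left_mono sum_mono) auto
    also have "\<dots> = (real (Suc m) * \<delta> m)\<^sup>2 * (CA' * c4)"
      by (simp add: power2_eq_square mult_ac)
    also have "\<dots> = CA' * c4" by (simp add: \<delta>_def)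
    finally show ?thesis using il by simp
  qed

  define W where "W m w = (\<Sum>k<Suc m. U m k w) + (\<Sum>k<Suc m. V m k w)" for m w
  have W2: "integrable M (\<lambda>w. (W m w)\<^sup>2) \<and> (\<integral>w. (W m w)\<^sup>2 \<partial>M) \<le> 2 * CA + 2 * (CA' * c4)" for m
  proof -
    let ?U = "\<lambda>w. \<Sum>k<Suc m. U m k w" and ?V = "\<lambda>w. \<Sum>k<Suc m. V m k w"
    have mU: "?U \<in> borel_measurable M" and mV: "?V \<in> borel_measurable M" by measurable
    have su: "integrable M (\<lambda>w. (?U w)\<^sup>2)" "(\<integral>w. (?U w)\<^sup>2 \<partial>M) \<le> CA"
      using sumU[of "Suc m" m] by (auto simp: \<delta>_def)
    note sv = sumV[of m]
    have le: "(W m w)\<^sup>2 \<le> 2 * (?U w)\<^sup>2 + 2 * (?V w)\<^sup>2" for w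
      unfolding W_def power2_sum using sum_squares_bound[of "?U w" "?V w"] by linarith
    have ir: "integrable M (\<lambda>w. 2 * (?U w)\<^sup>2 + 2 * (?V w)\<^sup>2)" using su sv by simp
    have il: "integrable M (\<lambda>w. (W m w)\<^sup>2)"
    proof (rule Bochner_Integration.integrable_bound[OF ir])
      show "(\<lambda>w. (W m w)\<^sup>2) \<in> borel_measurable M" unfolding W_def using mU mV by measurable
      show "AE w in M. norm ((W m w)\<^sup>2) \<le> norm (2 * (?U w)\<^sup>2 + 2 * (?V w)\<^sup>2)"
        unfolding real_norm_def abs_power2 by (intro AE_I2 order_trans[OF le abs_ge_self])
    qed
    have "(\<integral>w. (W m w)\<^sup>2 \<partial>M) \<le> (\<integral>w. 2 * (?U w)\<^sup>2 + 2 * (?V w)\<^sup>2 \<partial>M)"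
      by (rule integral_mono[OF il ir le])
    also have "\<dots> = 2 * (\<integral>w. (?U w)\<^sup>2 \<partial>M) + 2 * (\<integral>w. (?V w)\<^sup>2 \<partial>M)"
      using su sv by (simp del: sum.lessThan_Suc)
    finally show ?thesis using su sv il by linarith
  qed

  \<comment> \<open>The Stratonovich sums and the remainder are indexed by a Boolean to obtain a
    common subsequence; along it their difference \<open>W\<close> converges to the
    coefficient.\<close>
  define Y where "Y b m = (if b then strat_sum B (X (Suc N) 0) (upart 0 1 m) u i else (\<lambda>w. \<Sum>k<Suc m. R m k w))" for b m
  define Z where "Z b = (if b then (\<lambda>w. X (Suc (Suc N)) 0 1 w (u @ [i])) else (\<lambda>_. 0))" for b
  have "\<exists>r. strict_mono (r::nat\<Rightarrow>nat) \<and> (AE w in M. \<forall>b\<in>UNIV. (\<lambda>m. Y b (r m) w) \<longlonglongrightarrow> Z b w)"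
  proof (rule conv_in_prob_AE_subseq_finite)
    fix b m
    have "strat_sum B (X (Suc N) 0) (upart 0 1 m) u i \<in> borel_measurable M"
      using i by (intro strat_sum_measurable[OF order_refl is_partition_upart]) auto
    moreover have "(\<lambda>w. \<Sum>k<Suc m. R m k w) \<in> borel_measurable M" by measurable
    ultimately show "Y b m \<in> borel_measurable M" by (simp add: Y_def)
    show "Z b \<in> borel_measurable M" by (simp add: Z_def)
    have "conv_in_prob M (\<lambda>m. strat_sum B (X (Suc N) 0) (upart 0 1 m) u i) (\<lambda>w. X (Suc (Suc N)) 0 1 w (u @ [i]))"
      using lu u(3) i by (intro X_conv is_partition_upart mesh_upart_tendsto) auto
    then show "conv_in_prob M (Y b) (Z b)"
      using convR by (cases b) (simp_all add: Y_def[abs_def] Z_def)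
  qed simp
  then obtain r where r: "AE w in M. \<forall>b\<in>UNIV. (\<lambda>m. Y b (r m) w) \<longlonglongrightarrow> Z b w" by blast
  have lim: "AE w in M. (\<lambda>m. W (r m) w) \<longlonglongrightarrow> X (Suc (Suc N)) 0 1 w (u @ [i])"
    using r decomp
  proof eventually_elim
    case (elim w)
    have "W m w = Y True m w - Y False m w" for m
      using elim(2) by (simp add: Y_def W_def sum.distrib del: sum.lessThan_Suc)
    moreover have "(\<lambda>m. Y True (r m) w - Y False (r m) w) \<longlonglongrightarrow> Z True w - Z False w"
      using elim(1) by (intro tendsto_diff) auto
    ultimately show ?case by (simp add: Z_def)
  qed
  have WM: "W m \<in> borel_measurable M" for m unfolding W_def by measurable
  show ?thesis
    by (rule square_integrable_of_AE_limit[OF X_measurable WM lim]) (rule W2[THEN conjunct1], rule W2[THEN conjunct2])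
qed

theorem square_integrable_X: "integrable M (\<lambda>w. (X (length v) 0 1 w v)\<^sup>2)"
proof (induction "length v" arbitrary: v rule: less_induct)
  case less
  show ?case
  proof (cases "set v \<subseteq> {..<d}")
    case False
    then show ?thesis by (simp add: X_bad_letter)
  next
    case True
    consider "v = []" | i where "v = [i]" | u' l i where "v = (u' @ [l]) @ [i]"
      by (metis append_butlast_last_id append_Nil)
    then show ?thesis
    proof cases
      case 1
      then show ?thesis by (simp add: X_zero)
    next
      case 2
      then show ?thesis using integrable_X_one_power[of i 2] True by simp
    next
      case 3
      have "integrable M (\<lambda>w. (X (Suc (Suc (length u'))) 0 1 w ((u' @ [l]) @ [i]))\<^sup>2)"
        by (rule square_integrable_snoc[OF less refl refl]) (use True 3 in auto)
      then show ?thesis using 3 by simp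
    qed
  qed
qed

end

subsection \<open>Second moments of the coefficients\<close>

text \<open>For even \<open>n + m\<close> this is the exact correlation in dimension one, where the
  coefficients are \<open>Z ^ n / fact n\<close> with \<open>Z\<close> standard normal.\<close>

definition moment_bound :: "nat \<Rightarrow> nat \<Rightarrow> real" where
  "moment_bound n m = real ((n + m) choose n) / (2 ^ ((n + m) div 2) * fact ((n + m) div 2))"

lemma moment_bound_nonneg: "0 \<le> moment_bound n m"
  by (simp add: moment_bound_def)

text \<open>Pascal's rule applied twice. The guards counter truncated subtraction: for
  \<open>n < 2\<close> the term \<open>k choose (n - 2)\<close> would be 1 instead of 0.\<close>

lemma choose_two_steps:
  assumes "n + m = Suc (Suc k)"
  shows "(n + m) choose n = (if 2 \<le> n then k choose (n - 2) else 0)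
    + 2 * (if 1 \<le> n \<and> 1 \<le> m then k choose (n - 1) else 0) + (if 2 \<le> m then k choose n else 0)"
proof -
  consider "n = 0" | "n = 1" | j where "n = Suc (Suc j)" by (metis One_nat_def not0_implies_Suc)
  then show ?thesis
  proof cases
    case 3
    have "k choose Suc j = 0" if "\<not> 1 \<le> m" using that assms 3 by (intro binomial_eq_0) auto
    moreover have "k choose n = 0" if "\<not> 2 \<le> m" using that assms 3 by (intro binomial_eq_0) auto
    ultimately show ?thesis unfolding assms using 3 by auto
  qed (use assms in \<open>auto simp: binomial_eq_0\<close>)
qed

text \<open>There are three ways to remove two letters from the ends of two words: both from the
  first, one from each, both from the second.\<close>

lemma pairs_at_distance_two:
  fixes n m :: nat
  shows "{(i, j). i \<le> n \<and> j \<le> m \<and> n - i + (m - j) = 2} = (if 2 \<le> n then {(n - 2, m)} else {})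
    \<union> (if 1 \<le> n \<and> 1 \<le> m then {(n - 1, m - 1)} else {}) \<union> (if 2 \<le> m then {(n, m - 2)} else {})"
proof -
  have "i \<le> n \<and> j \<le> m \<and> n - i + (m - j) = 2 \<longleftrightarrow>
      (2 \<le> n \<and> i = n - 2 \<and> j = m) \<or> (1 \<le> n \<and> 1 \<le> m \<and> i = n - 1 \<and> j = m - 1) \<or> (2 \<le> m \<and> i = n \<and> j = m - 2)" for i j
  proof
    assume L: "i \<le> n \<and> j \<le> m \<and> n - i + (m - j) = 2"
    then obtain a b where ab: "n = i + a" "m = j + b" by (metis le_iff_add)
    with L have "a + b = 2" by simp
    then have "a = 2 \<and> b = 0 \<or> a = 1 \<and> b = 1 \<or> a = 0 \<and> b = 2" by linarith
    then show "(2 \<le> n \<and> i = n - 2 \<and> j = m) \<or> (1 \<le> n \<and> 1 \<le> m \<and> i = n - 1 \<and> j = m - 1) \<or> (2 \<le> m \<and> i = n \<and> j = m - 2)"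
      using ab by auto
  qed auto
  then show ?thesis by auto
qed

text \<open>The recursion of the correlations, with weights 1/2, 1, 1/2 in place of the correlations
  of two letters. It is Pascal's double step, since these weights are proportional to 1, 2,
  1.\<close>

lemma moment_bound_recursion:
  assumes "n + m = 2 * Suc p"
  shows "(if 2 \<le> n then moment_bound (n - 2) m / 2 else 0) + (if 1 \<le> n \<and> 1 \<le> m then moment_bound (n - 1) (m - 1) else 0)
    + (if 2 \<le> m then moment_bound n (m - 2) / 2 else 0) = real (Suc p) * moment_bound n m"
proof -
  define D :: real where "D = 2 ^ p * fact p"
  have D: "D > 0" by (simp add: D_def)
  have d: "(n + m) div 2 = Suc p" using assms by simp
  have b1: "moment_bound (n - 2) m = real ((2 * p) choose (n - 2)) / D" if "2 \<le> n"
  proof -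
    have "n - 2 + m = 2 * p" using assms that by simp
    then show ?thesis by (simp add: moment_bound_def D_def)
  qed
  have b2: "moment_bound (n - 1) (m - 1) = real ((2 * p) choose (n - 1)) / D" if "1 \<le> n" "1 \<le> m"
  proof -
    have "n - 1 + (m - 1) = 2 * p" using assms that by simp
    then show ?thesis by (simp add: moment_bound_def D_def)
  qed
  have b3: "moment_bound n (m - 2) = real ((2 * p) choose n) / D" if "2 \<le> m"
  proof -
    have "n + (m - 2) = 2 * p" using assms that by simp
    then show ?thesis by (simp add: moment_bound_def D_def)
  qed
  have "2 ^ Suc p * fact (Suc p) = 2 * real (Suc p) * D" by (simp add: D_def)
  then have "real (Suc p) * moment_bound n m = real (Suc p) * (real ((n + m) choose n) / (2 * real (Suc p) * D))"
    unfolding moment_bound_def d by (simp only:)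
  also have "\<dots> = real ((n + m) choose n) / (2 * D)"
    by (simp del: of_nat_Suc)
  also have "(n + m) choose n = (if 2 \<le> n then (2 * p) choose (n - 2) else 0)
    + 2 * (if 1 \<le> n \<and> 1 \<le> m then (2 * p) choose (n - 1) else 0) + (if 2 \<le> m then (2 * p) choose n else 0)"
    by (rule choose_two_steps) (use assms in simp)
  finally have *: "real (Suc p) * moment_bound n m = real (\<dots>) / (2 * D)" .
  have e1: "(if 2 \<le> n then moment_bound (n - 2) m / 2 else 0) = real (if 2 \<le> n then (2 * p) choose (n - 2) else 0) / (2 * D)"
    using b1 by simp
  have e2: "(if 1 \<le> n \<and> 1 \<le> m then moment_bound (n - 1) (m - 1) else 0)
      = 2 * real (if 1 \<le> n \<and> 1 \<le> m then (2 * p) choose (n - 1) else 0) / (2 * D)"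
    using b2 by (cases "1 \<le> n \<and> 1 \<le> m") auto
  have e3: "(if 2 \<le> m then moment_bound n (m - 2) / 2 else 0) = real (if 2 \<le> m then (2 * p) choose n else 0) / (2 * D)"
    using b3 by simp
  show ?thesis unfolding * e1 e2 e3 of_nat_add of_nat_mult add_divide_distrib by (simp only: of_nat_numeral)
qed

text \<open>The polynomial variable stands for \<open>sqrt h\<close>, so the coefficient of
  \<open>h\<close> has index 2; the lower ones keep the induction going.\<close>

lemma coeff_one_plus_square_power:
  "coeff ([:1, 0, 1::real:] ^ p) 0 = 1 \<and> coeff ([:1, 0, 1:] ^ p) 1 = (0::real) \<and> coeff ([:1, 0, 1:] ^ p) 2 = real p"
proof (induction p)
  case (Suc p)
  then show ?case by (simp add: numeral_2_eq_2 coeff_pCons)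
qed (simp add: numeral_2_eq_2)

context brownian_signature
begin

definition corr :: "nat list \<Rightarrow> nat list \<Rightarrow> real" where
  "corr u v = (\<integral>w. X (length u) 0 1 w u * X (length v) 0 1 w v \<partial>M)"

lemma integrable_corr: "integrable M (\<lambda>w. X (length u) 0 1 w u * X (length v) 0 1 w v)"
  by (rule integrable_mult_of_squares[OF _ _ square_integrable_X square_integrable_X]) measurable

lemma corr_odd: assumes "odd (length u + length v)" shows "corr u v = 0"
proof -
  have "prod_list (map (\<lambda>_. - 1) w) = (- 1 :: real) ^ length w" for w :: "nat list" by (induction w) auto
  then have "corr u v = (- 1) ^ (length u + length v) * corr u v"
    using integral_sign_flip[of "\<lambda>_. - 1" u v] by (simp add: corr_def power_add)
  then show ?thesis using assms by simp
qed

lemma corr_one_one: assumes "i < d" "j < d" shows "corr [i] [j] = (if i = j then 1 else 0)"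
proof (cases "i = j")
  case True
  then show ?thesis using integral_X_one_square[OF assms(1)] by (simp add: corr_def power2_eq_square)
next
  case False
  then show ?thesis
    using integral_sign_flip[of "\<lambda>k. if k = i then - 1 else 1" "[i]" "[j]"] by (simp add: corr_def)
qed

text \<open>The value 1/2 on the diagonal is the Stratonovich correction over unit time; off the
  diagonal, reflecting the single coordinate \<open>i\<close> gives 0.\<close>

lemma corr_two: assumes "i < d" "j < d" shows "corr [i, j] [] = (if i = j then 1 / 2 else 0)"
proof (cases "i = j")
  case True
  have "(\<integral>w. X 2 0 1 w [i, i] \<partial>M) = (\<integral>w. (X 1 0 1 w [i])\<^sup>2 / 2 \<partial>M)"
    using X_two_diag[of 0 1 i] assms by (intro integral_cong_AE) auto
  then show ?thesis using integral_X_one_square[OF assms(1)] True by (simp add: corr_def X_zero numeral_2_eq_2)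
next
  case False
  then show ?thesis
    using integral_sign_flip[of "\<lambda>k. if k = i then - 1 else 1" "[i, j]" "[]"] by (simp add: corr_def)
qed

lemma corr_commute: "corr u v = corr v u"
  by (simp add: corr_def mult.commute)

text \<open>The left side is Brownian scaling of \<open>[0, 1 + h]\<close>. On the right the parts
  over \<open>[0, 1]\<close> and \<open>[1, 1 + h]\<close> are independent, and the second is scaled
  back to unit length.\<close>

lemma corr_chen:
  assumes h: "0 < h"
  shows "sqrt (1 + h) ^ (length u + length v) * corr u v =
    (\<Sum>i\<le>length u. \<Sum>j\<le>length v. corr (take i u) (take j v) * corr (drop i u) (drop j v)
      * sqrt h ^ (length u - i + (length v - j)))"
proof -
  define f where "f i j w = X i 0 1 w (take i u) * X j 0 1 w (take j v)" for i j w
  define g where "g i j w = X (length u - i) 1 (1 + h) w (drop i u) * X (length v - j) 1 (1 + h) w (drop j v)" for i j w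
  have [measurable]: "f i j \<in> borel_measurable M" "g i j \<in> borel_measurable M" for i j
    unfolding f_def g_def by measurable
  have fg: "integrable M (\<lambda>w. f i j w * g i j w) \<and> (\<integral>w. f i j w * g i j w \<partial>M)
      = corr (take i u) (take j v) * corr (drop i u) (drop j v) * sqrt h ^ (length u - i + (length v - j))"
    if ij: "i \<le> length u" "j \<le> length v" for i j
  proof -
    have lt: "length (take i u) = i" "length (take j v) = j" using ij by auto
    have fi: "integrable M (f i j)" and fE: "(\<integral>w. f i j w \<partial>M) = corr (take i u) (take j v)"
      using integrable_corr[of "take i u" "take j v"] by (simp_all only: f_def[abs_def] lt corr_def)
    have gi: "integrable M (g i j)" and gE: "(\<integral>w. g i j w \<partial>M) = sqrt h ^ (length u - i + (length v - j)) * corr (drop i u) (drop j v)"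
      using integrable_X_prod_scaling[of 1 h "drop i u" "length u - i" "drop j v" "length v - j"]
        integral_X_prod_scaling[of 1 h "drop i u" "length u - i" "drop j v" "length v - j"]
        integrable_corr[of "drop i u" "drop j v"] h by (simp_all add: g_def[abs_def] corr_def)
    have df: "determined M d B 1 (f i j)" unfolding f_def using lt by (intro determined_mult determined_X') auto
    have dg: "determined M d (shift_path B 1) h (g i j)" unfolding g_def using h by (intro determined_mult determined_future_X') auto
    show ?thesis
      using integrable_past_future[OF _ df dg fi gi] integral_past_future[OF _ df dg fi gi] fE gE by simp
  qed
  have "sqrt (1 + h) ^ (length u + length v) * corr u v = (\<integral>w. X (length u) 0 (1 + h) w u * X (length v) 0 (1 + h) w v \<partial>M)"
    using integral_X_prod_scaling[of 0 "1 + h" u "length u" v "length v"] h by (simp add: corr_def)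
  also have "\<dots> = (\<integral>w. (\<Sum>i\<le>length u. \<Sum>j\<le>length v. f i j w * g i j w) \<partial>M)"
  proof (rule integral_cong_AE)
    have "AE w in M. X (length u) 0 (1 + h) w u = (\<Sum>i\<le>length u. X i 0 1 w (take i u) * X (length u - i) 1 (1 + h) w (drop i u))"
      by (rule chen) (use h in auto)
    moreover have "AE w in M. X (length v) 0 (1 + h) w v = (\<Sum>i\<le>length v. X i 0 1 w (take i v) * X (length v - i) 1 (1 + h) w (drop i v))"
      by (rule chen) (use h in auto)
    ultimately show "AE w in M. X (length u) 0 (1 + h) w u * X (length v) 0 (1 + h) w v = (\<Sum>i\<le>length u. \<Sum>j\<le>length v. f i j w * g i j w)"
      by eventually_elim (simp add: sum_product f_def g_def mult_ac)
  qed measurable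
  also have "\<dots> = (\<Sum>i\<le>length u. \<Sum>j\<le>length v. \<integral>w. f i j w * g i j w \<partial>M)"
    using fg by (subst Bochner_Integration.integral_sum)
      (auto intro!: Bochner_Integration.integrable_sum sum.cong Bochner_Integration.integral_sum)
  also have "\<dots> = (\<Sum>i\<le>length u. \<Sum>j\<le>length v. corr (take i u) (take j v) * corr (drop i u) (drop j v)
      * sqrt h ^ (length u - i + (length v - j)))"
    using fg by (intro sum.cong) auto
  finally show ?thesis .
qed

text \<open>Comparing the coefficients of \<open>h\<close> in the two expressions for the correlation over \<open>[0, 1 + h]\<close>.\<close>

lemma corr_recursion:
  assumes "length u + length v = 2 * p"
  shows "real p * corr u v = (\<Sum>(i, j)\<in>{(i, j). i \<le> length u \<and> j \<le> length v \<and> length u - i + (length v - j) = 2}.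
      corr (take i u) (take j v) * corr (drop i u) (drop j v))"
proof -
  let ?n = "length u" and ?m = "length v"
  define a where "a i j = corr (take i u) (take j v) * corr (drop i u) (drop j v)" for i j
  \<comment> \<open>In the variable \<open>x = sqrt h\<close> both sides are polynomials, odd powers
    included, and agreement at infinitely many points forces equality of coefficients.\<close>
  define P where "P = (\<Sum>i\<le>?n. \<Sum>j\<le>?m. monom (a i j) (?n - i + (?m - j)))"
  define Q where "Q = smult (corr u v) ([:1, 0, 1:] ^ p)"
  have "poly P x = poly Q x" if "x > 0" for x
  proof -
    have "poly Q x = corr u v * (1 + x\<^sup>2) ^ p" by (simp add: Q_def power2_eq_square)
    also have "(1 + x\<^sup>2) ^ p = sqrt (1 + x\<^sup>2) ^ (?n + ?m)"
      unfolding assms power_mult by simp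
    also have "corr u v * \<dots> = (\<Sum>i\<le>?n. \<Sum>j\<le>?m. a i j * sqrt (x\<^sup>2) ^ (?n - i + (?m - j)))"
      using corr_chen[of "x\<^sup>2" u v] that by (simp add: a_def mult.commute)
    also have "\<dots> = poly P x"
      using that by (simp add: P_def poly_sum poly_monom)
    finally show ?thesis by simp
  qed
  then have "{0<..} \<subseteq> {x. poly (P - Q) x = 0}" by auto
  then have "infinite {x. poly (P - Q) x = 0}"
    using infinite_Ioi finite_subset by blast
  then have "P - Q = 0" using poly_roots_finite by blast
  then have "coeff P 2 = coeff Q 2" by simp
  moreover have "coeff Q 2 = real p * corr u v"
    using coeff_one_plus_square_power[of p] by (simp add: Q_def)
  moreover have "coeff P 2 = (\<Sum>i\<le>?n. \<Sum>j\<le>?m. if ?n - i + (?m - j) = 2 then a i j else 0)"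
    by (simp add: P_def coeff_sum)
  moreover have "\<dots> = (\<Sum>(i, j)\<in>{..?n} \<times> {..?m}. if ?n - i + (?m - j) = 2 then a i j else 0)"
    by (rule sum.cartesian_product)
  moreover have "\<dots> = (\<Sum>(i, j)\<in>{(i, j). i \<le> ?n \<and> j \<le> ?m \<and> ?n - i + (?m - j) = 2}. a i j)"
    by (rule sum.mono_neutral_cong_right) (auto split: if_splits)
  ultimately show ?thesis by (simp add: a_def)
qed

text \<open>Each summand of the recursion pairs a correlation of total length smaller by two with
  one of total length two, which is at most 1/2 in modulus if both letters sit in one word and at
  most 1 otherwise. \<open>moment_bound\<close> satisfies the recursion with exactly these weights,
  so division by \<open>p\<close> closes the induction.\<close>

theorem abs_corr_le:
  assumes "set u \<subseteq> {..<d}" "set v \<subseteq> {..<d}"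
  shows "\<bar>corr u v\<bar> \<le> moment_bound (length u) (length v)"
  using assms
proof (induction "length u + length v" arbitrary: u v rule: less_induct)
  case less
  let ?n = "length u" and ?m = "length v"
  show ?case
  proof (cases "odd (?n + ?m)")
    case True
    then show ?thesis by (simp add: corr_odd moment_bound_nonneg)
  next
    case False
    then obtain p where p: "?n + ?m = 2 * p" by (metis evenE)
    show ?thesis
    proof (cases p)
      case 0
      then show ?thesis using p by (simp add: corr_def X_zero moment_bound_def prob_space)
    next
      case (Suc p')
      define a where "a i j = corr (take i u) (take j v) * corr (drop i u) (drop j v)" for i j
      have st: "set (take i u) \<subseteq> {..<d}" "set (take i v) \<subseteq> {..<d}" "set (drop i u) \<subseteq> {..<d}" "set (drop i v) \<subseteq> {..<d}" for i
        using less.prems set_take_subset[of i u] set_take_subset[of i v] set_drop_subset[of i u] set_drop_subset[of i v] by blast+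
      have len2: "\<bar>corr x []\<bar> \<le> 1 / 2" if "length x = 2" "set x \<subseteq> {..<d}" for x
      proof -
        obtain i j where "x = [i, j]" using \<open>length x = 2\<close> by (auto simp: numeral_2_eq_2 length_Suc_conv)
        then show ?thesis using corr_two[of i j] \<open>set x \<subseteq> {..<d}\<close> by auto
      qed
      have len1: "\<bar>corr x y\<bar> \<le> 1" if lxy: "length x = 1" "length y = 1" and sxy: "set x \<subseteq> {..<d}" "set y \<subseteq> {..<d}" for x y
      proof -
        obtain i j where "x = [i]" "y = [j]" using lxy by (auto simp: length_Suc_conv)
        then show ?thesis using corr_one_one[of i j] sxy by auto
      qed
      have a1: "\<bar>a (?n - 2) ?m\<bar> \<le> moment_bound (?n - 2) ?m / 2" if "2 \<le> ?n"
      proof -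
        have "\<bar>corr (take (?n - 2) u) v\<bar> \<le> moment_bound (?n - 2) ?m"
          using less.hyps[of "take (?n - 2) u" v] st that less.prems by simp
        moreover have "\<bar>corr (drop (?n - 2) u) []\<bar> \<le> 1 / 2" using that st by (intro len2) auto
        ultimately have "\<bar>corr (take (?n - 2) u) v\<bar> * \<bar>corr (drop (?n - 2) u) []\<bar> \<le> moment_bound (?n - 2) ?m * (1 / 2)"
          by (intro mult_mono) (auto simp: moment_bound_nonneg)
        then show ?thesis by (simp add: a_def abs_mult)
      qed
      have a3: "\<bar>a ?n (?m - 2)\<bar> \<le> moment_bound ?n (?m - 2) / 2" if "2 \<le> ?m"
      proof -
        have "\<bar>corr u (take (?m - 2) v)\<bar> \<le> moment_bound ?n (?m - 2)"
          using less.hyps[of u "take (?m - 2) v"] st that less.prems by simp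
        moreover have "\<bar>corr [] (drop (?m - 2) v)\<bar> \<le> 1 / 2" unfolding corr_commute[of "[]"] using that st by (intro len2) auto
        ultimately have "\<bar>corr u (take (?m - 2) v)\<bar> * \<bar>corr [] (drop (?m - 2) v)\<bar> \<le> moment_bound ?n (?m - 2) * (1 / 2)"
          by (intro mult_mono) (auto simp: moment_bound_nonneg)
        then show ?thesis by (simp add: a_def abs_mult)
      qed
      have a2: "\<bar>a (?n - 1) (?m - 1)\<bar> \<le> moment_bound (?n - 1) (?m - 1)" if "1 \<le> ?n" "1 \<le> ?m"
      proof -
        have "\<bar>corr (take (?n - 1) u) (take (?m - 1) v)\<bar> \<le> moment_bound (?n - 1) (?m - 1)"
          using less.hyps[of "take (?n - 1) u" "take (?m - 1) v"] st that by simp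
        moreover have "\<bar>corr (drop (?n - 1) u) (drop (?m - 1) v)\<bar> \<le> 1" using that st by (intro len1) auto
        ultimately have "\<bar>corr (take (?n - 1) u) (take (?m - 1) v)\<bar> * \<bar>corr (drop (?n - 1) u) (drop (?m - 1) v)\<bar> \<le> moment_bound (?n - 1) (?m - 1) * 1"
          by (intro mult_mono) (auto simp: moment_bound_nonneg)
        then show ?thesis by (simp add: a_def abs_mult)
      qed
      let ?S = "{(i, j). i \<le> ?n \<and> j \<le> ?m \<and> ?n - i + (?m - j) = 2}"
      define S1 where "S1 = (if 2 \<le> ?n then {(?n - 2, ?m)} else {})"
      define S2 where "S2 = (if 1 \<le> ?n \<and> 1 \<le> ?m then {(?n - 1, ?m - 1)} else {})"
      define S3 where "S3 = (if 2 \<le> ?m then {(?n, ?m - 2)} else {})"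
      have S: "?S = S1 \<union> S2 \<union> S3"
        unfolding S1_def S2_def S3_def by (rule pairs_at_distance_two)
      have "real p * \<bar>corr u v\<bar> = \<bar>\<Sum>(i, j)\<in>?S. a i j\<bar>"
        using arg_cong[of _ _ abs, OF corr_recursion[OF p]] by (simp add: a_def[abs_def] abs_mult)
      also have "\<dots> \<le> (\<Sum>(i, j)\<in>?S. \<bar>a i j\<bar>)"
        by (rule order_trans[OF sum_abs]) (auto intro!: sum_mono)
      also have "\<dots> \<le> (\<Sum>(i, j)\<in>S1. \<bar>a i j\<bar>) + (\<Sum>(i, j)\<in>S2. \<bar>a i j\<bar>) + (\<Sum>(i, j)\<in>S3. \<bar>a i j\<bar>)"
      proof -
        have f: "finite S1" "finite S2" "finite S3" by (auto simp: S1_def S2_def S3_def)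
        have "S1 \<inter> S2 = {}" "(S1 \<union> S2) \<inter> S3 = {}" by (auto simp: S1_def S2_def S3_def)
        then show ?thesis unfolding S using f by (simp add: sum.union_disjoint)
      qed
      also have "\<dots> \<le> (if 2 \<le> ?n then moment_bound (?n - 2) ?m / 2 else 0)
          + (if 1 \<le> ?n \<and> 1 \<le> ?m then moment_bound (?n - 1) (?m - 1) else 0)
          + (if 2 \<le> ?m then moment_bound ?n (?m - 2) / 2 else 0)"
        using a1 a2 a3 unfolding S1_def S2_def S3_def by (intro add_mono) auto
      also have "\<dots> = real p * moment_bound ?n ?m"
        unfolding Suc by (rule moment_bound_recursion) (use p Suc in simp)
      finally show ?thesis using Suc by (simp del: of_nat_Suc)
    qed
  qed
qed

text \<open>The central binomial coefficient is at most \<open>4 ^ n\<close>; only a subexponential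
  factor is given away, which the growth rate does not see.\<close>

theorem second_moment_le:
  assumes "length v = n"
  shows "(\<integral>w. (X n 0 1 w v)\<^sup>2 \<partial>M) \<le> 2 ^ n / fact n"
proof (cases "set v \<subseteq> {..<d}")
  case False
  then show ?thesis by (simp add: X_bad_letter)
next
  case True
  have "(\<integral>w. (X n 0 1 w v)\<^sup>2 \<partial>M) = corr v v"
    using assms by (simp add: corr_def power2_eq_square)
  also have "\<dots> \<le> moment_bound n n"
    using abs_corr_le[OF True True] assms by simp
  also have "\<dots> = real ((2 * n) choose n) / (2 ^ n * fact n)"
    by (simp add: moment_bound_def mult_2)
  also have "\<dots> \<le> real (2 ^ (2 * n)) / (2 ^ n * fact n)"
  proof (intro divide_right_mono of_nat_mono)
    have "(2 * n) choose n \<le> (\<Sum>k\<le>2 * n. (2 * n) choose k)"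
      by (intro member_le_sum) auto
    then show "(2 * n) choose n \<le> 2 ^ (2 * n)" by (simp add: choose_row_sum)
  qed simp
  also have "\<dots> = 2 ^ n / fact n"
    by (simp add: power_mult power2_eq_square field_simps flip: power_mult_distrib)
  finally show ?thesis .
qed

end

subsection \<open>Exponential growth rates\<close>

lemma powr_two_over_eq_root:
  assumes "0 \<le> (b::real)" "0 < n"
  shows "b powr (2 / real n) = root n (b\<^sup>2)"
proof (cases "b = 0")
  case False
  with assms have b: "0 < b" by simp
  have "root n (b\<^sup>2) = (b\<^sup>2) powr (1 / real n)" using b assms by (simp add: root_powr_inverse)
  also have "\<dots> = (b powr 2) powr (1 / real n)" using b by simp
  finally show ?thesis by (simp only: powr_powr) simp
qed (use assms in simp)

text \<open>The \<open>n\<close>-th root of a polynomial tends to 1. The cube is the degree met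
  later: two factors from the Borel-Cantelli threshold and one from the Gamma function.\<close>

lemma limsup_powr_le:
  assumes b: "\<And>n. 0 \<le> b n" and K: "0 < K" and D: "0 \<le> D"
    and le: "eventually (\<lambda>n. (b n)\<^sup>2 \<le> K * (real n + 1) ^ 3 * D ^ n) sequentially"
  shows "limsup (\<lambda>n. ereal (b n powr (2 / real n))) \<le> ereal D"
proof -
  define u where "u n = root n (8 * K) * root n (real n) ^ 3 * D" for n
  have "u \<longlonglongrightarrow> 1 * 1 ^ 3 * D"
    unfolding u_def using K by (intro tendsto_intros LIMSEQ_root LIMSEQ_root_const) auto
  then have "limsup (\<lambda>n. ereal (u n)) = ereal D"
    by (intro lim_imp_Limsup) auto
  moreover have "limsup (\<lambda>n. ereal (b n powr (2 / real n))) \<le> limsup (\<lambda>n. ereal (u n))"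
  proof (rule Limsup_mono)
    show "eventually (\<lambda>n. ereal (b n powr (2 / real n)) \<le> ereal (u n)) sequentially"
      using le eventually_gt_at_top[of 0]
    proof eventually_elim
      case (elim n)
      have "(real n + 1) ^ 3 \<le> (2 * real n) ^ 3" using elim(2) by (intro power_mono) auto
      then have "K * (real n + 1) ^ 3 * D ^ n \<le> K * (2 * real n) ^ 3 * D ^ n"
        using K D by (intro mult_right_mono mult_left_mono) auto
      then have "(b n)\<^sup>2 \<le> 8 * K * real n ^ 3 * D ^ n"
        using elim(1) by (simp add: power_mult_distrib)
      then have "root n ((b n)\<^sup>2) \<le> root n (8 * K * real n ^ 3 * D ^ n)"
        using elim(2) by (simp add: real_root_le_iff)
      also have "\<dots> = u n"
        unfolding u_def using elim(2) D by (simp add: real_root_mult real_root_power real_root_power_cancel)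
      finally show ?case using powr_two_over_eq_root[OF b elim(2)] by simp
    qed
  qed
  ultimately show ?thesis by simp
qed

lemma limsup_powr_lessD:
  assumes b: "\<And>n. 0 \<le> b n" and D: "0 < D" and lt: "limsup (\<lambda>n. ereal (b n powr (2 / real n))) < ereal D"
  shows "\<exists>K>0. \<forall>n. (b n)\<^sup>2 \<le> K * D ^ n"
proof -
  have "eventually (\<lambda>n. ereal (b n powr (2 / real n)) < ereal D) sequentially"
    by (rule Limsup_lessD[OF lt])
  then have "eventually (\<lambda>n. (b n)\<^sup>2 \<le> D ^ n) sequentially"
    using eventually_gt_at_top[of 0]
  proof eventually_elim
    case (elim n)
    then have "root n ((b n)\<^sup>2) \<le> D" using powr_two_over_eq_root[OF b elim(2), of n] by simp
    then have "root n ((b n)\<^sup>2) ^ n \<le> D ^ n" using elim(2) by (intro power_mono) auto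
    then show ?case using elim(2) by simp
  qed
  then obtain n0 where n0: "\<And>n. n \<ge> n0 \<Longrightarrow> (b n)\<^sup>2 \<le> D ^ n" by (auto simp: eventually_sequentially)
  \<comment> \<open>The finitely many indices before the bound sets in, among them
    \<open>n = 0\<close> with its degenerate exponent, are absorbed into the constant.\<close>
  define K where "K = 1 + (\<Sum>n<n0. (b n)\<^sup>2 / D ^ n)"
  have K1: "K \<ge> 1" unfolding K_def using D by (auto intro!: sum_nonneg)
  have "(b n)\<^sup>2 \<le> K * D ^ n" for n
  proof (cases "n < n0")
    case True
    have "(b n)\<^sup>2 / D ^ n \<le> (\<Sum>n<n0. (b n)\<^sup>2 / D ^ n)"
      by (rule member_le_sum) (use True D in auto)
    then have "(b n)\<^sup>2 / D ^ n \<le> K" by (simp add: K_def)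
    then show ?thesis using D by (simp add: pos_divide_le_eq)
  next
    case False
    then have "(b n)\<^sup>2 \<le> 1 * D ^ n" using n0 by simp
    also have "\<dots> \<le> K * D ^ n" using K1 D by (intro mult_right_mono) auto
    finally show ?thesis .
  qed
  then show ?thesis using K1 by (intro exI[of _ K]) auto
qed

lemma Gamma_plus_one_pos: "0 < x \<Longrightarrow> Gamma (x + 1) = x * Gamma (x :: real)"
  using nonpos_Ints_nonpos[of x] by (intro Gamma_plus1) auto

text \<open>From \<open>n\<close> to \<open>n + 2\<close> the square gains
  \<open>(n + 2)^2 / 4\<close> and \<open>fact n / 2 ^ n\<close> gains
  \<open>(n + 2) (n + 1) / 4\<close>. The quotient is at least 1 and at most
  \<open>(n + 3) / (n + 1)\<close>, which telescopes into the factor \<open>n + 1\<close>. The base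
  values are 1 and \<open>pi / 4\<close>.\<close>

lemma Gamma_half_square_bounds:
  "fact n / 2 ^ n \<le> (Gamma (real n / 2 + 1))\<^sup>2 \<and> (Gamma (real n / 2 + 1))\<^sup>2 \<le> (real n + 1) * fact n / 2 ^ n"
proof (induction n rule: induct_nat_012)
  case 0
  show ?case by simp
next
  case 1
  have g: "Gamma (real 1 / 2 + 1) = 1 / 2 * Gamma (1 / 2 :: real)"
    using Gamma_plus_one_pos[of "1 / 2"] by simp
  have "(Gamma (real 1 / 2 + 1))\<^sup>2 = pi / 4"
    unfolding g by (simp add: Gamma_one_half_real power_mult_distrib power_divide)
  then show ?case using pi_ge_two pi_less_4 by simp
next
  case (ge2 n)
  define G where "G = (Gamma (real n / 2 + 1))\<^sup>2"
  define q where "q = fact n / (2::real) ^ n"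
  have q0: "0 \<le> q" by (simp add: q_def)
  have "Gamma (real (Suc (Suc n)) / 2 + 1) = (real n / 2 + 1) * Gamma (real n / 2 + 1)"
    using Gamma_plus_one_pos[of "real n / 2 + 1"] by (simp add: add_divide_distrib add_ac)
  then have G: "(Gamma (real (Suc (Suc n)) / 2 + 1))\<^sup>2 = (real n / 2 + 1)\<^sup>2 * G"
    by (simp add: G_def power_mult_distrib)
  have q: "fact (Suc (Suc n)) / (2::real) ^ Suc (Suc n) = (real n + 2) * (real n + 1) / 4 * q"
  proof -
    have "fact (Suc (Suc n)) = (real n + 2) * (real n + 1) * fact n" by (simp add: algebra_simps)
    then show ?thesis by (simp only: q_def) simp
  qed
  have IH: "q \<le> G" "G \<le> (real n + 1) * q" using ge2(1) by (simp_all add: G_def q_def)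
  have sq: "(real n / 2 + 1)\<^sup>2 = (real n + 2)\<^sup>2 / 4" by (simp add: power2_eq_square field_simps)
  have "(real n + 2) * (real n + 1) / 4 * q \<le> (real n + 2)\<^sup>2 / 4 * q"
    using q0 by (intro mult_right_mono) (auto simp: power2_eq_square)
  also have "\<dots> \<le> (real n + 2)\<^sup>2 / 4 * G" using IH by (intro mult_left_mono) auto
  finally have lo: "(real n + 2) * (real n + 1) / 4 * q \<le> (real n + 2)\<^sup>2 / 4 * G" .
  have "(real n + 2)\<^sup>2 / 4 * G \<le> (real n + 2)\<^sup>2 / 4 * ((real n + 1) * q)" using IH by (intro mult_left_mono) auto
  also have "\<dots> = (real n + 2) * ((real n + 2) * (real n + 1) / 4 * q)" by (simp add: power2_eq_square)
  also have "\<dots> \<le> (real n + 3) * ((real n + 2) * (real n + 1) / 4 * q)"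
    using q0 by (intro mult_right_mono) auto
  finally have hi: "(real n + 2)\<^sup>2 / 4 * G \<le> (real n + 3) * ((real n + 2) * (real n + 1) / 4 * q)" .
  have "(real (Suc (Suc n)) + 1) * fact (Suc (Suc n)) / 2 ^ Suc (Suc n) = (real n + 3) * ((real n + 2) * (real n + 1) / 4 * q)"
    unfolding times_divide_eq_right[symmetric] q by simp
  then show ?case using lo hi unfolding G q sq by simp
qed

subsection \<open>Admissible norms\<close>

definition words :: "nat \<Rightarrow> nat \<Rightarrow> nat list set" where
  "words d n = {v. set v \<subseteq> {..<d} \<and> length v = n}"

lemma finite_words [simp]: "finite (words d n)"
  unfolding words_def by (rule finite_lists_length_eq) simp

lemma card_words: "card (words d n) = d ^ n"
  unfolding words_def by (subst card_lists_length_eq) auto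

text \<open>Points of \<open>word_space\<close> are arbitrary functions on words; restricting them
  to one level produces an element on which the norm axioms apply.\<close>

definition level :: "nat \<Rightarrow> nat \<Rightarrow> (nat list \<Rightarrow> real) \<Rightarrow> nat list \<Rightarrow> real" where
  "level d n x v = (if v \<in> words d n then x v else 0)"

lemma level_tens: "level d n x \<in> tens d n"
  by (simp add: level_def tens_def words_def)

locale unit_admissible_norms =
  fixes d :: nat and N :: "nat \<Rightarrow> (nat list \<Rightarrow> real) \<Rightarrow> real"
  assumes admissible: "admissible_norms d N" and basis_norm: "\<forall>i<d. N 1 (basis_tensor i) = 1"
begin

lemma norm_nonneg: "a \<in> tens d n \<Longrightarrow> 0 \<le> N n a"
  and norm_zero: "N n (\<lambda>_. 0) = 0"
  and norm_scale: "a \<in> tens d n \<Longrightarrow> N n (\<lambda>w. c * a w) = \<bar>c\<bar> * N n a"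
  and norm_add: "a \<in> tens d n \<Longrightarrow> b \<in> tens d n \<Longrightarrow> N n (\<lambda>w. a w + b w) \<le> N n a + N n b"
proof -
  have "is_norm_on (tens d n) (N n)" using admissible by (auto simp: admissible_norms_def)
  note n = this[unfolded is_norm_on_def]
  show "a \<in> tens d n \<Longrightarrow> 0 \<le> N n a" using n by blast
  have "(\<lambda>_. 0) \<in> tens d n" by (simp add: tens_def)
  then show "N n (\<lambda>_. 0) = 0" using n by blast
  show "a \<in> tens d n \<Longrightarrow> N n (\<lambda>w. c * a w) = \<bar>c\<bar> * N n a" using n by blast
  show "a \<in> tens d n \<Longrightarrow> b \<in> tens d n \<Longrightarrow> N n (\<lambda>w. a w + b w) \<le> N n a + N n b" using n by blast
qed

lemma norm_tprod: "a \<in> tens d n \<Longrightarrow> b \<in> tens d m \<Longrightarrow> N (n + m) (tprod n a b) \<le> N n a * N m b"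
  using admissible by (auto simp: admissible_norms_def)

lemma tens_sum: "(\<And>j. j \<in> J \<Longrightarrow> a j \<in> tens d n) \<Longrightarrow> (\<lambda>w. \<Sum>j\<in>J. a j w) \<in> tens d n"
  unfolding tens_def
proof (rule CollectI, intro allI impI)
  fix w assume a: "\<And>j. j \<in> J \<Longrightarrow> a j \<in> {a. \<forall>w. a w \<noteq> 0 \<longrightarrow> length w = n \<and> set w \<subseteq> {..<d}}"
    and "(\<Sum>j\<in>J. a j w) \<noteq> 0"
  then obtain j where "j \<in> J" "a j w \<noteq> 0" by (meson sum.neutral)
  then show "length w = n \<and> set w \<subseteq> {..<d}" using a by blast
qed

lemma norm_sum:
  assumes "finite J" "\<And>j. j \<in> J \<Longrightarrow> a j \<in> tens d n"
  shows "N n (\<lambda>w. \<Sum>j\<in>J. a j w) \<le> (\<Sum>j\<in>J. N n (a j))"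
  using assms
proof (induction J rule: finite_induct)
  case empty
  show ?case by (simp add: norm_zero)
next
  case (insert j J)
  have "N n (\<lambda>w. a j w + (\<Sum>j\<in>J. a j w)) \<le> N n (a j) + N n (\<lambda>w. \<Sum>j\<in>J. a j w)"
    using insert by (intro norm_add tens_sum) auto
  then show ?case using insert by auto
qed

text \<open>Letters are split off one at a time by submultiplicativity. Level 0 is excluded because
  the assumptions do not fix the norm of the scalar 1.\<close>

lemma norm_basis_word:
  assumes "v \<in> words d n" "0 < n"
  shows "N n (\<lambda>w. if w = v then 1 else 0) \<le> 1"
  using assms(2,1)
proof (induction n arbitrary: v rule: nat_induct_non_zero)
  case 1
  then obtain i where "v = [i]" "i < d" by (auto simp: words_def length_Suc_conv)
  moreover have "(\<lambda>w. if w = [i] then 1 else 0) = basis_tensor i"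
    by (simp add: basis_tensor_def fun_eq_iff)
  ultimately show ?case using basis_norm by simp
next
  case (Suc n)
  then obtain i v' where v: "v = i # v'" "i < d" "v' \<in> words d n" by (auto simp: words_def length_Suc_conv)
  let ?e = "\<lambda>w. if w = v' then 1 else (0::real)"
  have b: "basis_tensor i \<in> tens d 1" using v by (auto simp: tens_def basis_tensor_def)
  have e: "?e \<in> tens d n" using v by (auto simp: tens_def words_def)
  have "tprod 1 (basis_tensor i) ?e = (\<lambda>w. if w = v then 1 else 0)"
  proof
    fix w show "tprod 1 (basis_tensor i) ?e w = (if w = v then 1 else 0)"
      using v by (cases w) (auto simp: tprod_def basis_tensor_def)
  qed
  then have "N (Suc n) (\<lambda>w. if w = v then 1 else 0) = N (1 + n) (tprod 1 (basis_tensor i) ?e)"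
    by simp
  also have "\<dots> \<le> N 1 (basis_tensor i) * N n ?e" by (rule norm_tprod[OF b e])
  also have "\<dots> \<le> 1" using basis_norm v Suc by simp
  finally show ?case .
qed

lemma norm_level_le:
  assumes "0 < n"
  shows "N n (level d n x) \<le> (\<Sum>v\<in>words d n. \<bar>x v\<bar>)"
proof -
  let ?e = "\<lambda>v w. if w = v then 1 else (0::real)"
  have e: "?e v \<in> tens d n" if "v \<in> words d n" for v using that by (auto simp: tens_def words_def)
  have "level d n x = (\<lambda>w. \<Sum>v\<in>words d n. x v * ?e v w)"
    by (auto simp: level_def fun_eq_iff if_distrib[of "\<lambda>c. _ * c"] cong: if_cong)
  then have "N n (level d n x) = N n (\<lambda>w. \<Sum>v\<in>words d n. x v * ?e v w)" by simp
  also have "\<dots> \<le> (\<Sum>v\<in>words d n. N n (\<lambda>w. x v * ?e v w))"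
    by (rule norm_sum[OF finite_words]) (simp add: tens_def words_def)
  also have "\<dots> = (\<Sum>v\<in>words d n. \<bar>x v\<bar> * N n (?e v))"
    using e by (intro sum.cong norm_scale) auto
  also have "\<dots> \<le> (\<Sum>v\<in>words d n. \<bar>x v\<bar> * 1)"
    using norm_basis_word assms by (intro sum_mono mult_left_mono) auto
  finally show ?thesis by simp
qed

lemma norm_level_diff_le:
  assumes "0 < n"
  shows "\<bar>N n (level d n x) - N n (level d n y)\<bar> \<le> (\<Sum>v\<in>words d n. \<bar>x v - y v\<bar>)"
proof -
  have *: "N n (level d n x) - N n (level d n y) \<le> (\<Sum>v\<in>words d n. \<bar>x v - y v\<bar>)" for x y
  proof -
    have "level d n x = (\<lambda>w. level d n y w + level d n (\<lambda>v. x v - y v) w)"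
      by (auto simp: level_def fun_eq_iff)
    then have "N n (level d n x) \<le> N n (level d n y) + N n (level d n (\<lambda>v. x v - y v))"
      using norm_add[OF level_tens level_tens, of n y "\<lambda>v. x v - y v"] by simp
    also have "N n (level d n (\<lambda>v. x v - y v)) \<le> (\<Sum>v\<in>words d n. \<bar>x v - y v\<bar>)"
      by (rule norm_level_le[OF assms])
    finally show ?thesis by simp
  qed
  show ?thesis using *[of x y] *[of y x] by (simp add: abs_le_iff abs_minus_commute)
qed

text \<open>At positive levels the norm is Lipschitz in finitely many coordinates, hence continuous
  for the product topology, whose Borel sets are the product sigma-algebra because words are
  countable. Level 0 follows from homogeneity.\<close>

lemma norm_level_measurable [measurable]: "(\<lambda>x. N n (level d n x)) \<in> borel_measurable word_space"
proof (cases "n = 0")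
  case True
  have "level d 0 x = (\<lambda>v. x [] * (if v = [] then 1 else 0))" for x
    by (auto simp: level_def words_def fun_eq_iff)
  moreover have "(\<lambda>v. if v = [] then 1 else 0) \<in> tens d 0" by (simp add: tens_def)
  ultimately have "N 0 (level d 0 x) = \<bar>x []\<bar> * N 0 (\<lambda>v. if v = [] then 1 else 0)" for x
    using norm_scale by metis
  then show ?thesis using True by simp
next
  case False
  then have n: "0 < n" by simp
  have "((\<lambda>y. N n (level d n y)) \<longlongrightarrow> N n (level d n x)) (at x)" for x
  proof -
    have "((\<lambda>y. y v) \<longlongrightarrow> x v) (at x)" for v
      using continuous_on_product_coordinates[of v]
      by (metis UNIV_I continuous_on_eq_continuous_at isCont_def open_UNIV)
    then have "((\<lambda>y. \<Sum>v\<in>words d n. \<bar>y v - x v\<bar>) \<longlongrightarrow> (\<Sum>v\<in>words d n. \<bar>x v - x v\<bar>)) (at x)"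
      by (intro tendsto_intros)
    then have "((\<lambda>y. \<Sum>v\<in>words d n. \<bar>y v - x v\<bar>) \<longlongrightarrow> 0) (at x)" by simp
    then have "((\<lambda>y. N n (level d n y) - N n (level d n x)) \<longlongrightarrow> 0) (at x)"
      by (rule Lim_null_comparison[rotated]) (use norm_level_diff_le[OF n] in \<open>auto intro!: always_eventually\<close>)
    then show ?thesis by (simp add: LIM_zero_iff)
  qed
  then have "continuous_on UNIV (\<lambda>x. N n (level d n x))"
    by (simp add: continuous_on_eq_continuous_at isCont_def)
  then have "(\<lambda>x. N n (level d n x)) \<in> borel_measurable borel" by (rule borel_measurable_continuous_onI)
  then show ?thesis
    by (simp add: measurable_cong_sets[OF sets_PiM_equal_borel refl])
qed

text \<open>Stated for arbitrary coefficients, so that it is a measurable functional on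
  \<open>word_space\<close> and inherits its law from the law of the signature.\<close>

definition growth :: "(nat list \<Rightarrow> real) \<Rightarrow> ereal" where
  "growth x = limsup (\<lambda>n. ereal ((Gamma (real n / 2 + 1) * N n (level d n x)) powr (2 / real n)))"

lemma growth_measurable [measurable]: "growth \<in> borel_measurable word_space"
  unfolding growth_def by measurable

lemma Gamma_half_pos: "0 < Gamma (real n / 2 + 1)"
  by (intro Gamma_real_pos) auto

lemma growth_nonneg: "0 \<le> growth x"
  unfolding growth_def by (rule le_Limsup) (auto intro!: always_eventually)

text \<open>The power \<open>2 / n\<close> turns the factor \<open>sqrt h ^ n\<close> at level
  \<open>n\<close> into \<open>h\<close>, independently of the level.\<close>

lemma growth_scale:
  assumes "0 < h"
  shows "growth (\<lambda>v. sqrt h ^ length v * x v) = ereal h * growth x"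
proof -
  have lev: "level d n (\<lambda>v. sqrt h ^ length v * x v) = (\<lambda>v. sqrt h ^ n * level d n x v)" for n
    by (auto simp: level_def words_def fun_eq_iff)
  have eq: "(Gamma (real n / 2 + 1) * N n (level d n (\<lambda>v. sqrt h ^ length v * x v))) powr (2 / real n)
      = h * (Gamma (real n / 2 + 1) * N n (level d n x)) powr (2 / real n)" if "0 < n" for n
  proof -
    have nn: "0 \<le> Gamma (real n / 2 + 1) * N n (level d n x)"
      using Gamma_half_pos norm_nonneg[OF level_tens] by (intro mult_nonneg_nonneg) (auto simp: less_imp_le)
    have "Gamma (real n / 2 + 1) * N n (level d n (\<lambda>v. sqrt h ^ length v * x v)) = sqrt h ^ n * (Gamma (real n / 2 + 1) * N n (level d n x))"
      unfolding lev norm_scale[OF level_tens] using assms by simp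
    also have "\<dots> powr (2 / real n) = (sqrt h ^ n) powr (2 / real n) * (Gamma (real n / 2 + 1) * N n (level d n x)) powr (2 / real n)"
      using assms nn by (simp add: powr_mult)
    also have "(sqrt h ^ n) powr (2 / real n) = h"
      using that assms by (subst powr_two_over_eq_root)
        (simp_all add: power_mult[symmetric] mult.commute[of n] power_mult real_root_power_cancel)
    finally show ?thesis .
  qed
  have "growth (\<lambda>v. sqrt h ^ length v * x v)
      = limsup (\<lambda>n. ereal h * ereal ((Gamma (real n / 2 + 1) * N n (level d n x)) powr (2 / real n)))"
    unfolding growth_def
    by (rule Limsup_eq) (use eventually_gt_at_top[of 0] in eventually_elim, simp add: eq)
  also have "\<dots> = ereal h * growth x"
    unfolding growth_def using assms by (intro Limsup_ereal_mult_left) auto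
  finally show ?thesis .
qed

text \<open>Up to polynomial factors \<open>\<Gamma>(n/2 + 1)\<^sup>2\<close> is \<open>n! / 2\<^sup>n\<close>, so the convolution bound for the norms turns
  into the binomial theorem for their squares.\<close>

lemma growth_subadditive:
  assumes conv: "\<And>v. z v = (\<Sum>j\<le>length v. x (take j v) * y (drop j v))"
    and x: "growth x \<le> ereal \<alpha>" and y: "growth y \<le> ereal \<beta>"
  shows "growth z \<le> ereal (\<alpha> + \<beta>)"
proof (rule ereal_le_epsilon2)
  fix e :: real assume e: "0 < e"
  define q where "q n = Gamma (real n / 2 + 1)" for n
  have q: "0 < q n" for n unfolding q_def by (rule Gamma_half_pos)
  define a b c where "a n = q n * N n (level d n x)" and "b n = q n * N n (level d n y)"
    and "c n = q n * N n (level d n z)" for n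
  have nn: "0 \<le> a n" "0 \<le> b n" "0 \<le> c n" for n
    unfolding a_def b_def c_def by (intro mult_nonneg_nonneg less_imp_le[OF q] norm_nonneg[OF level_tens])+
  \<comment> \<open>The slack \<open>e / 2\<close> makes the inequalities strict, which is what
    turns a limsup into exponential bounds valid for all \<open>n\<close>.\<close>
  define A where "A = \<alpha> + e / 2"
  define D where "D = \<beta> + e / 2"
  have "0 \<le> \<alpha>" "0 \<le> \<beta>" using growth_nonneg[of x] growth_nonneg[of y] x y by (metis ereal_less_eq(5) order_trans)+
  then have AD: "0 < A" "0 < D" using e by (auto simp: A_def D_def)
  have "growth x < ereal A" using x e by (rule_tac le_less_trans) (auto simp: A_def)
  then obtain K1 where K1: "0 < K1" "\<And>n. (a n)\<^sup>2 \<le> K1 * A ^ n"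
    using limsup_powr_lessD[of a A] nn AD unfolding growth_def a_def q_def by auto
  have "growth y < ereal D" using y e by (rule_tac le_less_trans) (auto simp: D_def)
  then obtain K2 where K2: "0 < K2" "\<And>n. (b n)\<^sup>2 \<le> K2 * D ^ n"
    using limsup_powr_lessD[of b D] nn AD unfolding growth_def b_def q_def by auto
  have key: "(c n)\<^sup>2 \<le> K1 * K2 * (real n + 1) ^ 3 * (A + D) ^ n" for n
  proof -
    \<comment> \<open>The convolution over prefixes and suffixes is, at each level, a sum of tensor
      products, to which submultiplicativity applies.\<close>
    have lev: "level d n z = (\<lambda>v. \<Sum>j\<le>n. tprod j (level d j x) (level d (n - j) y) v)"
    proof
      fix v
      show "level d n z v = (\<Sum>j\<le>n. tprod j (level d j x) (level d (n - j) y) v)"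
      proof (cases "v \<in> words d n")
        case True
        have "tprod j (level d j x) (level d (n - j) y) v = x (take j v) * y (drop j v)" if "j \<le> n" for j
          using that True set_take_subset[of j v] set_drop_subset[of j v]
          by (auto simp: tprod_def level_def words_def)
        then show ?thesis using True conv[of v] by (simp add: level_def words_def)
      next
        case False
        have "tprod j (level d j x) (level d (n - j) y) v = 0" if j: "j \<le> n" for j
        proof (rule ccontr)
          assume "tprod j (level d j x) (level d (n - j) y) v \<noteq> 0"
          then have "j \<le> length v" "take j v \<in> words d j" "drop j v \<in> words d (n - j)"
            by (auto simp: tprod_def level_def split: if_splits)
          moreover have "set v = set (take j v) \<union> set (drop j v)" by (metis append_take_drop_id set_append)
          ultimately have "v \<in> words d n" using j by (auto simp: words_def)
          then show False using False by simp
        qed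
        then show ?thesis using False by (simp add: level_def)
      qed
    qed
    have tp: "tprod j (level d j x) (level d (n - j) y) \<in> tens d n" if j: "j \<le> n" for j
      unfolding tens_def
    proof (safe)
      fix v i assume nz: "tprod j (level d j x) (level d (n - j) y) v \<noteq> 0"
      then have *: "j \<le> length v" "take j v \<in> words d j" "drop j v \<in> words d (n - j)"
        by (auto simp: tprod_def level_def split: if_splits)
      then show "length v = n" using j by (auto simp: words_def)
      have "set v = set (take j v) \<union> set (drop j v)" by (metis append_take_drop_id set_append)
      then show "i < d" if "i \<in> set v" using * that by (auto simp: words_def)
    qed
    have "N n (level d n z) \<le> (\<Sum>j\<le>n. N n (tprod j (level d j x) (level d (n - j) y)))"
      unfolding lev by (rule norm_sum) (use tp in auto)
    also have "\<dots> \<le> (\<Sum>j\<le>n. N j (level d j x) * N (n - j) (level d (n - j) y))"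
    proof (rule sum_mono)
      fix j assume "j \<in> {..n}"
      then have "j + (n - j) = n" by simp
      then show "N n (tprod j (level d j x) (level d (n - j) y)) \<le> N j (level d j x) * N (n - j) (level d (n - j) y)"
        using norm_tprod[OF level_tens[of d j x] level_tens[of d "n - j" y]] by simp
    qed
    finally have "c n \<le> q n * (\<Sum>j\<le>n. N j (level d j x) * N (n - j) (level d (n - j) y))"
      unfolding c_def using q by (intro mult_left_mono) (auto simp: less_imp_le)
    also have "\<dots> = (\<Sum>j\<le>n. q n / (q j * q (n - j)) * (a j * b (n - j)))"
      unfolding sum_distrib_left a_def b_def using less_imp_neq[OF q] by (intro sum.cong) (auto simp: field_simps)
    finally have cn: "c n \<le> (\<Sum>j\<le>n. q n / (q j * q (n - j)) * (a j * b (n - j)))" .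
    have summand: "(q n / (q j * q (n - j)) * (a j * b (n - j)))\<^sup>2 \<le> (real n + 1) * real (n choose j) * (K1 * A ^ j * (K2 * D ^ (n - j)))"
      if j: "j \<le> n" for j
    proof -
      have G: "(q n)\<^sup>2 \<le> (real n + 1) * fact n / 2 ^ n" "fact j / 2 ^ j \<le> (q j)\<^sup>2" "fact (n - j) / 2 ^ (n - j) \<le> (q (n - j))\<^sup>2"
        unfolding q_def using Gamma_half_square_bounds by auto
      have "(q n / (q j * q (n - j)))\<^sup>2 = (q n)\<^sup>2 / ((q j)\<^sup>2 * (q (n - j))\<^sup>2)"
        by (simp add: power_divide power_mult_distrib)
      also have "\<dots> \<le> ((real n + 1) * fact n / 2 ^ n) / ((fact j / 2 ^ j) * (fact (n - j) / 2 ^ (n - j)))"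
        using G by (intro frac_le mult_mono) auto
      also have "\<dots> = (real n + 1) * real (n choose j)"
      proof -
        have "(2::real) ^ n = 2 ^ j * 2 ^ (n - j)" using j by (simp flip: power_add)
        then show ?thesis by (simp add: binomial_fact[OF j])
      qed
      finally have 1: "(q n / (q j * q (n - j)))\<^sup>2 \<le> (real n + 1) * real (n choose j)" .
      have 2: "(a j * b (n - j))\<^sup>2 \<le> K1 * A ^ j * (K2 * D ^ (n - j))"
        unfolding power_mult_distrib using K1 K2 AD by (intro mult_mono) (auto intro!: mult_nonneg_nonneg less_imp_le)
      show ?thesis unfolding power_mult_distrib[of "q n / _"] using 1 2 by (intro mult_mono) auto
    qed
    have "(c n)\<^sup>2 \<le> (\<Sum>j\<le>n. q n / (q j * q (n - j)) * (a j * b (n - j)))\<^sup>2"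
      using cn nn by (intro power_mono)
    \<comment> \<open>Cauchy-Schwarz over \<open>n + 1\<close> summands produces the squares that
      the binomial theorem needs and costs only a polynomial factor.\<close>
    also have "\<dots> \<le> real (Suc n) * (\<Sum>j\<le>n. (q n / (q j * q (n - j)) * (a j * b (n - j)))\<^sup>2)"
      using Cauchy_Schwarz_ineq_sum[of "\<lambda>_. 1" "\<lambda>j. q n / (q j * q (n - j)) * (a j * b (n - j))" "{..n}"] by simp
    also have "\<dots> \<le> real (Suc n) * (\<Sum>j\<le>n. (real n + 1) * real (n choose j) * (K1 * A ^ j * (K2 * D ^ (n - j))))"
      using summand by (intro mult_left_mono sum_mono) auto
    also have "\<dots> = real (Suc n) * ((real n + 1) * (K1 * K2) * (\<Sum>j\<le>n. real (n choose j) * A ^ j * D ^ (n - j)))"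
      unfolding sum_distrib_left by (simp add: mult_ac)
    also have "\<dots> = K1 * K2 * (real n + 1) ^ 2 * (A + D) ^ n"
    proof -
      have "(\<Sum>j\<le>n. real (n choose j) * A ^ j * D ^ (n - j)) = (A + D) ^ n" by (simp only: binomial_ring)
      moreover have "real (Suc n) = real n + 1" by simp
      ultimately show ?thesis by (simp only: power2_eq_square mult_ac)
    qed
    also have "\<dots> \<le> K1 * K2 * (real n + 1) ^ 3 * (A + D) ^ n"
      using K1 K2 AD by (intro mult_right_mono mult_left_mono power_increasing) auto
    finally show ?thesis .
  qed
  have "limsup (\<lambda>n. ereal (c n powr (2 / real n))) \<le> ereal (A + D)"
    by (rule limsup_powr_le[where K="K1 * K2"]) (use nn K1 K2 AD key in auto)
  then have "growth z \<le> ereal (A + D)" by (simp add: growth_def c_def q_def)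
  also have "\<dots> = ereal (\<alpha> + \<beta>) + ereal e" by (simp add: A_def D_def)
  finally show "growth z \<le> ereal (\<alpha> + \<beta>) + ereal e" .
qed

end

subsection \<open>The growth rate of the Brownian signature\<close>

locale normed_brownian_signature = brownian_signature M d B X + unit_admissible_norms d N
  for M :: "'a measure" and d B X N
begin

lemma level_sig_coeffs: "level d n (sig_coeffs X s t w) = X n s t w"
proof
  fix v
  show "level d n (sig_coeffs X s t w) v = X n s t w v"
    using X_tens[of n s t w] by (auto simp: level_def words_def sig_coeffs_def tens_def)
qed

lemma Ltilde_eq_growth: "Ltilde N X s t w = growth (sig_coeffs X s t w)"
  by (simp add: Ltilde_def growth_def level_sig_coeffs)

text \<open>The normalised square of the \<open>l1\<close> norm has mean at most
  \<open>d ^ (2 * n)\<close>. Markov's inequality at \<open>(n + 1)^2\<close> times this value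
  leaves probabilities at most \<open>1 / (n + 1)^2\<close>, which are summable.\<close>

lemma AE_l1_norm_bound:
  "AE w in M. eventually (\<lambda>n. fact n / 2 ^ n * (\<Sum>v\<in>words d n. \<bar>X n 0 1 w v\<bar>)\<^sup>2 \<le> (real n + 1)\<^sup>2 * (real d ^ 2) ^ n) sequentially"
proof -
  define Y where "Y n w = fact n / 2 ^ n * (\<Sum>v\<in>words d n. \<bar>X n 0 1 w v\<bar>)\<^sup>2" for n w
  define D where "D n = (real d ^ 2) ^ n" for n
  have D: "0 < D n" for n using d_pos by (simp add: D_def)
  have [measurable]: "Y n \<in> borel_measurable M" for n unfolding Y_def by measurable
  have Y0: "0 \<le> Y n w" for n w by (simp add: Y_def)
  have Y: "integrable M (Y n) \<and> (\<integral>w. Y n w \<partial>M) \<le> D n" for n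
  proof -
    have sq: "integrable M (\<lambda>w. (X n 0 1 w v)\<^sup>2)" if "v \<in> words d n" for v
      using square_integrable_X[of v] that by (simp add: words_def)
    have le: "(\<Sum>v\<in>words d n. \<bar>X n 0 1 w v\<bar>)\<^sup>2 \<le> real d ^ n * (\<Sum>v\<in>words d n. (X n 0 1 w v)\<^sup>2)" for w
      using Cauchy_Schwarz_ineq_sum[of "\<lambda>_. 1" "\<lambda>v. \<bar>X n 0 1 w v\<bar>" "words d n"] by (simp add: card_words)
    define Z where "Z w = fact n / 2 ^ n * (real d ^ n * (\<Sum>v\<in>words d n. (X n 0 1 w v)\<^sup>2))" for w
    have YZ: "Y n w \<le> Z w" for w unfolding Y_def Z_def by (intro mult_left_mono le) auto
    have Zi: "integrable M Z" unfolding Z_def using sq by (intro integrable_mult_right Bochner_Integration.integrable_sum) auto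
    have Yi: "integrable M (Y n)"
      by (rule Bochner_Integration.integrable_bound[OF Zi])
        (auto intro!: AE_I2 order_trans[OF YZ abs_ge_self] simp: Y0)
    have "(\<integral>w. Y n w \<partial>M) \<le> (\<integral>w. Z w \<partial>M)" by (rule integral_mono[OF Yi Zi YZ])
    also have "\<dots> = fact n / 2 ^ n * (real d ^ n * (\<Sum>v\<in>words d n. \<integral>w. (X n 0 1 w v)\<^sup>2 \<partial>M))"
      unfolding Z_def using sq by simp
    also have "\<dots> \<le> fact n / 2 ^ n * (real d ^ n * (\<Sum>v\<in>words d n. 2 ^ n / fact n))"
      by (intro mult_left_mono sum_mono second_moment_le) (auto simp: words_def)
    also have "\<dots> = D n" by (simp add: card_words D_def power2_eq_square power_mult_distrib)
    finally show ?thesis using Yi by simp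
  qed
  define A where "A n = {w \<in> space M. (real n + 1)\<^sup>2 * D n \<le> Y n w}" for n
  have A: "measure M (A n) \<le> 1 / real (Suc n) ^ 2" for n
  proof -
    have "measure M (A n) \<le> (\<integral>w. Y n w \<partial>M) / ((real n + 1)\<^sup>2 * D n)"
      unfolding A_def using D Y Y0 by (intro integral_Markov_inequality_measure[where A="{}"]) auto
    also have "\<dots> \<le> D n / ((real n + 1)\<^sup>2 * D n)"
      using Y D by (intro divide_right_mono) (auto simp: less_imp_le)
    also have "\<dots> = 1 / real (Suc n) ^ 2" using less_imp_neq[OF D[of n]] by (simp add: add.commute)
    finally show ?thesis .
  qed
  have "AE w in M. eventually (\<lambda>n. w \<in> space M - A n) sequentially"
  proof (rule borel_cantelli_AE1)
    show "summable (\<lambda>n. measure M (A n))"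
    proof (rule summable_comparison_test')
      have "summable (\<lambda>n. 1 / real n ^ 2)" using inverse_power_summable[of 2, where 'a=real] by (simp add: inverse_eq_divide)
      then show "summable (\<lambda>n. 1 / real (Suc n) ^ 2)" by (rule summable_Suc_iff[THEN iffD2])
      show "norm (measure M (A n)) \<le> 1 / real (Suc n) ^ 2" if "0 \<le> n" for n using A by simp
    qed
  qed (auto simp: A_def emeasure_eq_measure)
  then show ?thesis
  proof eventually_elim
    case (elim w)
    then show ?case by eventually_elim (auto simp: A_def Y_def D_def)
  qed
qed

lemma AE_growth_le: "AE w in M. growth (sig_coeffs X 0 1 w) \<le> ereal (real d ^ 2)"
  using AE_l1_norm_bound
proof eventually_elim
  case (elim w)
  show ?case
    unfolding growth_def level_sig_coeffs
  proof (rule limsup_powr_le[where K=1])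
    show "0 \<le> Gamma (real n / 2 + 1) * N n (X n 0 1 w)" for n
      by (intro mult_nonneg_nonneg less_imp_le[OF Gamma_half_pos] norm_nonneg X_tens)
    show "eventually (\<lambda>n. (Gamma (real n / 2 + 1) * N n (X n 0 1 w))\<^sup>2 \<le> 1 * (real n + 1) ^ 3 * (real d ^ 2) ^ n) sequentially"
      using elim eventually_gt_at_top[of 0]
    proof eventually_elim
      case (elim n)
      let ?S = "\<Sum>v\<in>words d n. \<bar>X n 0 1 w v\<bar>"
      have "N n (X n 0 1 w) \<le> ?S"
        using norm_level_le[OF elim(2), of "sig_coeffs X 0 1 w"] unfolding level_sig_coeffs
        by (simp add: sig_coeffs_def words_def)
      then have "(N n (X n 0 1 w))\<^sup>2 \<le> ?S\<^sup>2" by (intro power_mono norm_nonneg X_tens)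
      then have "(Gamma (real n / 2 + 1) * N n (X n 0 1 w))\<^sup>2 \<le> ((real n + 1) * fact n / 2 ^ n) * ?S\<^sup>2"
        unfolding power_mult_distrib using Gamma_half_square_bounds[of n] by (intro mult_mono) auto
      also have "\<dots> = (real n + 1) * (fact n / 2 ^ n * ?S\<^sup>2)" by simp
      also have "\<dots> \<le> (real n + 1) * ((real n + 1)\<^sup>2 * (real d ^ 2) ^ n)"
        using elim(1) by (intro mult_left_mono) auto
      also have "\<dots> = 1 * (real n + 1) ^ 3 * (real d ^ 2) ^ n"
        by (simp add: power2_eq_square power3_eq_cube)
      finally show ?case .
    qed
  qed auto
qed

lemma AE_growth_subadditive:
  assumes "AE w in M. growth (sig_coeffs X 0 1 w) \<le> ereal C" "AE w in M. growth (sig_coeffs X 1 2 w) \<le> ereal C"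
  shows "AE w in M. growth (sig_coeffs X 0 2 w) \<le> growth (sig_coeffs X 0 1 w) + growth (sig_coeffs X 1 2 w)"
proof -
  \<comment> \<open>Words are countable, so Chen's identity holds for all of them outside one null
    set.\<close>
  have "AE w in M. \<forall>v. X (length v) 0 2 w v = (\<Sum>j\<le>length v. X j 0 1 w (take j v) * X (length v - j) 1 2 w (drop j v))"
    using chen[of 0 1 2] by (simp add: AE_all_countable)
  with assms show ?thesis
  proof eventually_elim
    case (elim w)
    obtain \<alpha> where \<alpha>: "growth (sig_coeffs X 0 1 w) = ereal \<alpha>"
      using elim(1) growth_nonneg[of "sig_coeffs X 0 1 w"] by (cases "growth (sig_coeffs X 0 1 w)") auto
    obtain \<beta> where \<beta>: "growth (sig_coeffs X 1 2 w) = ereal \<beta>"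
      using elim(2) growth_nonneg[of "sig_coeffs X 1 2 w"] by (cases "growth (sig_coeffs X 1 2 w)") auto
    have "growth (sig_coeffs X 0 2 w) \<le> ereal (\<alpha> + \<beta>)"
      by (rule growth_subadditive[of _ "sig_coeffs X 0 1 w" "sig_coeffs X 1 2 w"])
        (use elim(3) \<alpha> \<beta> in \<open>auto simp: sig_coeffs_def intro!: sum.cong\<close>)
    then show ?case using \<alpha> \<beta> by simp
  qed
qed

text \<open>The growth rates over \<open>[0, 1]\<close> and \<open>[1, 2]\<close> are independent copies of \<open>\<xi>\<close>, and the rate over
  \<open>[0, 2]\<close> has the law of \<open>2 \<xi>\<close>. Subadditivity with equal means forces equality, and comparing second
  moments gives zero variance.\<close>

theorem growth_AE_const: "\<exists>c. c \<le> real d ^ 2 \<and> (AE w in M. growth (sig_coeffs X 0 1 w) = ereal c)"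
proof -
  define C where "C = real d ^ 2"
  \<comment> \<open>\<open>real_of_ereal\<close> sends an infinite growth rate to 0, a default met
    only on a null set for the intervals used here.\<close>
  define F where "F x = real_of_ereal (growth x)" for x
  have F[measurable]: "F \<in> borel_measurable word_space" unfolding F_def by measurable
  define p where "p w = F (sig_coeffs X 0 1 w)" for w
  define q where "q w = F (sig_coeffs X 1 2 w)" for w
  define r where "r w = F (sig_coeffs X 0 2 w)" for w
  have [measurable]: "p \<in> borel_measurable M" "q \<in> borel_measurable M" "r \<in> borel_measurable M"
    unfolding p_def q_def r_def by measurable
  interpret s: normed_brownian_signature M d "shift_path B 1" "shift_sig X 1" N
    by (intro normed_brownian_signature.intro shift unit_admissible_norms_axioms) simp
  have g1: "AE w in M. growth (sig_coeffs X 0 1 w) \<le> ereal C" unfolding C_def by (rule AE_growth_le)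
  have "sig_coeffs (shift_sig X 1) 0 1 w = sig_coeffs X 1 2 w" for w
    by (simp add: sig_coeffs_def fun_eq_iff)
  then have g2: "AE w in M. growth (sig_coeffs X 1 2 w) \<le> ereal C" unfolding C_def using s.AE_growth_le by simp
  have bounds: "AE w in M. growth (sig_coeffs X 0 1 w) = ereal (p w) \<and> 0 \<le> p w \<and> p w \<le> C \<and> 0 \<le> q w \<and> q w \<le> C
      \<and> 0 \<le> r w \<and> r w \<le> p w + q w"
    using g1 g2 AE_growth_subadditive[OF g1 g2]
  proof eventually_elim
    case (elim w)
    obtain \<alpha> where \<alpha>: "growth (sig_coeffs X 0 1 w) = ereal \<alpha>" "0 \<le> \<alpha>"
      using elim(1) growth_nonneg[of "sig_coeffs X 0 1 w"] by (cases "growth (sig_coeffs X 0 1 w)") auto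
    obtain \<beta> where \<beta>: "growth (sig_coeffs X 1 2 w) = ereal \<beta>" "0 \<le> \<beta>"
      using elim(2) growth_nonneg[of "sig_coeffs X 1 2 w"] by (cases "growth (sig_coeffs X 1 2 w)") auto
    obtain \<gamma> where \<gamma>: "growth (sig_coeffs X 0 2 w) = ereal \<gamma>" "0 \<le> \<gamma>"
      using elim(3) \<alpha> \<beta> growth_nonneg[of "sig_coeffs X 0 2 w"] by (cases "growth (sig_coeffs X 0 2 w)") auto
    show ?case using elim \<alpha> \<beta> \<gamma> by (simp add: p_def q_def r_def F_def)
  qed
  have ip: "integrable M p" and iq: "integrable M q" and ip2: "integrable M (\<lambda>w. (p w)\<^sup>2)"
    and iq2: "integrable M (\<lambda>w. (q w)\<^sup>2)" and ir: "integrable M r"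
  proof -
    have b: "AE w in M. norm (p w) \<le> C" "AE w in M. norm (q w) \<le> C" "AE w in M. norm (r w) \<le> 2 * C"
      using bounds by (eventually_elim; auto)+
    show "integrable M p" by (rule integrable_const_bound[OF b(1)]) measurable
    show "integrable M q" by (rule integrable_const_bound[OF b(2)]) measurable
    show "integrable M r" by (rule integrable_const_bound[OF b(3)]) measurable
    have b2: "AE w in M. norm ((p w)\<^sup>2) \<le> C\<^sup>2" "AE w in M. norm ((q w)\<^sup>2) \<le> C\<^sup>2"
      using bounds by (eventually_elim; auto intro: power_mono)+
    show "integrable M (\<lambda>w. (p w)\<^sup>2)" by (rule integrable_const_bound[OF b2(1)]) measurable
    show "integrable M (\<lambda>w. (q w)\<^sup>2)" by (rule integrable_const_bound[OF b2(2)]) measurable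
  qed
  have Fscale: "F (\<lambda>v. sqrt 2 ^ length v * X (length v) 0 1 w v) = 2 * p w" for w
    using growth_scale[of 2 "sig_coeffs X 0 1 w"] by (simp add: F_def p_def sig_coeffs_def)
  have F1: "F (\<lambda>v. X (length v) 0 1 w v) = p w" for w
    by (simp add: p_def sig_coeffs_def[abs_def])
  have F2: "(\<lambda>x. (F x)\<^sup>2) \<in> borel_measurable word_space" by measurable
  have Eq: "(\<integral>w. q w \<partial>M) = (\<integral>w. p w \<partial>M)" and Eq2: "(\<integral>w. (q w)\<^sup>2 \<partial>M) = (\<integral>w. (p w)\<^sup>2 \<partial>M)"
    using integral_scaling[of 1 1 F] integral_scaling[of 1 1 "\<lambda>x. (F x)\<^sup>2"] F F2 by (simp_all add: q_def F1)
  have Er: "(\<integral>w. r w \<partial>M) = 2 * (\<integral>w. p w \<partial>M)" and Er2: "(\<integral>w. (r w)\<^sup>2 \<partial>M) = 4 * (\<integral>w. (p w)\<^sup>2 \<partial>M)"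
    using integral_scaling[of 0 2 F] integral_scaling[of 0 2 "\<lambda>x. (F x)\<^sup>2"] F F2 by (simp_all add: r_def Fscale power_mult_distrib)
  have dp: "determined M d B 1 p" unfolding p_def by (rule determined_sig_coeffs) auto
  have dq: "determined M d (shift_path B 1) 1 q"
    using determined_future_sig_coeffs[of 1 1 1 F] by (simp add: q_def[abs_def])
  have ipq: "integrable M (\<lambda>w. p w * q w)" and Epq: "(\<integral>w. p w * q w \<partial>M) = (\<integral>w. p w \<partial>M)\<^sup>2"
    using integrable_past_future[OF _ dp dq ip iq] integral_past_future[OF _ dp dq ip iq] Eq by (simp_all add: power2_eq_square)
  \<comment> \<open>A nonnegative variable with mean zero vanishes almost surely, so subadditivity
    is an equality here.\<close>
  have "(\<integral>w. p w + q w - r w \<partial>M) = 0"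
    using ip iq ir Eq Er by simp
  moreover have "AE w in M. 0 \<le> p w + q w - r w" using bounds by eventually_elim auto
  ultimately have "AE w in M. p w + q w - r w = 0"
    using ip iq ir integral_nonneg_eq_0_iff_AE[of M "\<lambda>w. p w + q w - r w"] by simp
  then have "AE w in M. (r w)\<^sup>2 = (p w)\<^sup>2 + (2 * (p w * q w) + (q w)\<^sup>2)"
  proof eventually_elim
    case (elim w)
    then have "r w = p w + q w" by simp
    then show ?case by (simp add: power2_eq_square algebra_simps)
  qed
  then have "(\<integral>w. (r w)\<^sup>2 \<partial>M) = (\<integral>w. (p w)\<^sup>2 + (2 * (p w * q w) + (q w)\<^sup>2) \<partial>M)"
    by (intro integral_cong_AE) auto
  also have "\<dots> = 2 * (\<integral>w. (p w)\<^sup>2 \<partial>M) + 2 * (\<integral>w. p w \<partial>M)\<^sup>2"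
    using ip2 iq2 ipq Epq Eq2 by simp
  \<comment> \<open>Independence gives \<open>2 E p^2 + 2 (E p)^2\<close> for the second moment of
    \<open>p + q\<close>, whereas scaling gives \<open>4 E p^2\<close> for that of
    \<open>r\<close>.\<close>
  finally have var: "(\<integral>w. (p w)\<^sup>2 \<partial>M) = (\<integral>w. p w \<partial>M)\<^sup>2" using Er2 by simp
  define c where "c = (\<integral>w. p w \<partial>M)"
  have ex: "(p w - c)\<^sup>2 = (p w)\<^sup>2 - (2 * c * p w - c\<^sup>2)" for w by (simp add: power2_eq_square algebra_simps)
  have iv: "integrable M (\<lambda>w. (p w - c)\<^sup>2)" unfolding ex using ip ip2 by simp
  have "(\<integral>w. (p w - c)\<^sup>2 \<partial>M) = 0"
    unfolding ex using ip ip2 var by (simp add: prob_space c_def power2_eq_square)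
  then have "AE w in M. (p w - c)\<^sup>2 = 0"
    using integral_nonneg_eq_0_iff_AE[OF iv] by simp
  then have "AE w in M. growth (sig_coeffs X 0 1 w) = ereal c"
    using bounds by eventually_elim simp
  moreover have "c \<le> C"
  proof -
    have "AE w in M. p w \<le> C" using bounds by eventually_elim auto
    then have "c \<le> (\<integral>w. C \<partial>M)" unfolding c_def by (intro integral_mono_AE[OF ip]) auto
    then show ?thesis by (simp add: prob_space)
  qed
  ultimately show ?thesis unfolding C_def by blast
qed

end

theorem mainTheorem6:
  fixes M :: "'a measure" and d :: nat and B :: "real \<Rightarrow> 'a \<Rightarrow> nat \<Rightarrow> real"
    and N :: "nat \<Rightarrow> (nat list \<Rightarrow> real) \<Rightarrow> real"
    and X :: "nat \<Rightarrow> real \<Rightarrow> real \<Rightarrow> 'a \<Rightarrow> nat list \<Rightarrow> real"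
    and s t :: real
  assumes "1 \<le> d"
    and "std_brownian M d B"
    and "admissible_norms d N"
    and "\<forall>i<d. N 1 (basis_tensor i) = 1"
    and "strat_signature M d B X"
    and "0 \<le> s" and "s < t"
  shows "\<exists>c::real. c \<le> real d ^ 2 * (t - s) \<and> (AE w in M. Ltilde N X s t w = ereal c)"
proof -
  define h where "h = t - s"
  have h: "0 < h" using assms(7) by (simp add: h_def)
  have "prob_space M" using assms(2) by (simp add: std_brownian_def)
  then interpret b: normed_brownian_signature M d B X N
    using assms by (intro normed_brownian_signature.intro brownian_signature.intro
        brownian_signature_axioms.intro unit_admissible_norms.intro) auto
  \<comment> \<open>The map \<open>u -> s + h * u\<close> carries \<open>[0, 1]\<close> to
    \<open>[s, t]\<close>. Constancy is applied to the restarted and rescaled motion, and undoing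
    the scaling multiplies its constant by \<open>h\<close>.\<close>
  interpret b': normed_brownian_signature M d "aff_path B s h (\<lambda>_. 1)" "aff_sig X s h (\<lambda>_. 1)" N
    using assms(6) h
    by (intro normed_brownian_signature.intro b.brownian_signature_aff b.unit_admissible_norms_axioms) auto
  obtain c where c: "c \<le> real d ^ 2"
    "AE w in M. b.growth (sig_coeffs (aff_sig X s h (\<lambda>_. 1)) 0 1 w) = ereal c"
    using b'.growth_AE_const by blast
  have "sig_coeffs X s t w = (\<lambda>v. sqrt h ^ length v * sig_coeffs (aff_sig X s h (\<lambda>_. 1)) 0 1 w v)" for w
    using h by (simp add: sig_coeffs_def aff_sig_def fun_eq_iff h_def)
  then have "Ltilde N X s t w = ereal h * b.growth (sig_coeffs (aff_sig X s h (\<lambda>_. 1)) 0 1 w)" for w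
    using b.growth_scale[OF h] by (simp add: b.Ltilde_eq_growth)
  with c(2) have "AE w in M. Ltilde N X s t w = ereal (h * c)"
    by (auto elim!: eventually_mono)
  moreover have "h * c \<le> real d ^ 2 * (t - s)"
    using c(1) h mult_left_mono[of c "real d ^ 2" h] by (simp add: h_def mult.commute)
  ultimately show ?thesis by blast
qed

end
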